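(* Let $\mathcal V,\mathcal W,\mathcal Z$ be commutative topological groups, $\mathfrak S\subset\mathfrak P(X)$ an interval system, $\mu:\mathfrak S\to\mathcal W$ a measure, and $L:\mathcal V\times\mathcal W\to\mathcal Z$ a biadditive pairing which is continuous in its second variable. Let $f:X\to\mathcal V$ be a function and $a\in\mathcal Z$. Then the following statements are equivalent: (1) The extended Lebesgue-McShane integral of $f$ is $a$. (2) The filter base $L(f,\mu)_*\,{}^{\mathrm{LM}}\mathfrak F^{\mathfrak S}$ converges to $a$. (3) The filter base $L(f,\mu)_*\,{}^{\mathrm{LM}}\mathfrak F_0^{\mathfrak S}$ converges to $a$. (4) The filter base $L(f,\mu)_*\,{}^{\mathrm{LM}}\mathfrak F_{00}^{\mathfrak S}$ converges to $a$.
   Context: Conventions. "Countable" includes finite. All commutative topological groups are assumed complete and Hausdorff. Neighborhoods need not be open. $\mathfrak P(X)$ is the power set of $X$. Interval system: a family $\mathfrak S\subset\mathfrak P(X)$ such that for all $A,B\in\mathfrak S$ each of $A\setminus B$ and $A\cap B$ is the union of a countable family of pairwise disjoint elements of $\mathfrak S$. $\boldsymbol\Sigma\mathfrak S$, $\boldsymbol\Sigma_0\mathfrak S$, $\boldsymbol\Sigma_{00}\mathfrak S$ denote the families of countable unions, finite unions, and finite disjoint unions of elements of $\mathfrak S$, respectively. Absolute sum: for a countable family $\{a_\lambda\}_{\lambda\in\Lambda}$ in a commutative topological group, $\sum^{\mathrm{abs}}_{\lambda\in\Lambda}a_\lambda=a$ means: for each neighborhood $\mathcal T$ of $0$ there is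 a finite $\Xi\subset\Lambda$ with $\sum_{\lambda\in\Omega}a_\lambda\in a-\mathcal T$ for all finite $\Omega$, $\Xi\subset\Omega\subset\Lambda$. Measure: $\mu:\mathfrak S\to\mathcal W$ with $\mu(A)=\sum^{\mathrm{abs}}_{\lambda}\mu(A_\lambda)$ whenever $A\in\mathfrak S$ is a countable disjoint union of $A_\lambda\in\mathfrak S$. Step-function: $s=\sum_{j\in J}c_j\chi_{E_j}:X\to\mathcal V$ with $J$ finite, $c_j\in\mathcal V$, $E_j\in\mathfrak S$. Envelope: for $\mathcal A\subset\mathcal V\times X$, $D\subset X$ put $\mathcal A^D=\{v:(v,x)\in\mathcal A\ \forall x\in D\}$. $\mathcal A$ is an envelope if it contains the graph $\{(s(x),x):x\in X\}$ of some step-function and there is a countable $\mathfrak D\subset\mathfrak S$ with $\mathcal A=\bigl(\bigcup_{D\in\mathfrak D}\mathcal A^D\times D\bigr)\cup\bigl(\{0\}\times(X\setminus\bigcup\mathfrak D)\bigr)$. $\int^{\mathrm p}L(\mathcal A,\mu)$ is the closure in $\mathcal Z$ of the set of all $\sum_{j\in J}L(c_j,\mu(E_j))$ with $J$ finite, $c_j\in\mathcal V$, $E_j\in\mathfrak S$, and the graph of $\sum_jc_j\chi_{E_j}$ contained in $\mathcal A$. Extended Lebesgue-McShane integral: write $f|_B$ for the function equal to $f$ on $B$ and $0$ outside $B$. The extended Lebesgue-McShane integral of $f$ is $a$ if for each neighborhood $\mathcal T$ of $0$ in $\mathcal Z$ there is $A\in\boldsymbol\Sigma\mathfrak S$ such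 that for all $B\in\boldsymbol\Sigma\mathfrak S$ with $A\subset B$ there is an envelope $\mathcal B$ containing the graph of $f|_B$ with $\int^{\mathrm p}L(\mathcal B,\mu)\subset a+\mathcal T$. Tag system: a pair $(\mathfrak D,h)$ with $\mathfrak D\subset\mathfrak S$ countable and $h:\bigcup\mathfrak D\to\mathfrak D$ with $x\in h(x)$ for all $x$; it is supported on $A=\bigcup\mathfrak D$. A tagged Lebesgue-McShane division associated to $(\mathfrak D,h)$ is a pair $(\mathfrak E,c)$ where $\mathfrak E\subset\mathfrak S$ is a countable set of pairwise disjoint nonempty sets with $\bigcup\mathfrak E=\bigcup\mathfrak D$, and $c:\mathfrak E\to\bigcup\mathfrak D$ is a function with $E\subset h(c(E))$ for each $E\in\mathfrak E$. Filter bases: let $\mathsf F(X,\mathfrak S)$ be the commutative group of finite formal sums $\sum_{j\in J}\delta_{x_j}\cdot E_j$ ($x_j\in X$, $E_j\in\mathfrak S$). For a tagged division let $\mathfrak F_{(\mathfrak E,c)}$ be the filter base on $\mathsf F(X,\mathfrak S)$ consisting of the sets $\bigl\{\sum_{E\in\Omega}\delta_{c(E)}\cdot E:\ \Omega\text{ finite},\ \Xi\subset\Omega\subset\mathfrak E\bigr\}$ for finite $\Xi\subset\mathfrak E$. For a family of filter bases $\mathfrak F_\lambda$ let $\prod_\lambda\mathfrak F_\lambda$ be the set of all unions $\bigcup_\lambda F(\lambda)$, where $F$ is a choice function, $F(\lambda)\in\mathfrak F_\lambda$ (the finest common coarsening). Put ${}^{\mathrm{LM}}\mathfrak F^{(\mathfrak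 D,h)}=\prod\mathfrak F_{(\mathfrak E,c)}$ over all tagged Lebesgue-McShane divisions associated to $(\mathfrak D,h)$, and for $A\in\boldsymbol\Sigma\mathfrak S$ put ${}^{\mathrm{LM}}\mathfrak F^A=\bigcup{}^{\mathrm{LM}}\mathfrak F^{(\mathfrak D,h)}$ over all tag systems supported on $A$. For a preordered set $(P,\leq)$, a subset $S\subset P$ is a $\leq$-top if every $p\in P$ satisfies $p\leq s$ for some $s\in S$, and $s\in S$, $s\leq t$ imply $t\in S$. For filter bases $\mathfrak F_p$ ($p\in P$) put $\mathrm{dir}^{\leq}_{p\in P}\mathfrak F_p=\bigcup_{S\ \leq\text{-top}}\prod_{p\in S}\mathfrak F_p$. Then ${}^{\mathrm{LM}}\mathfrak F^{\mathfrak S}=\mathrm{dir}^{\subset}_{A\in\boldsymbol\Sigma\mathfrak S}{}^{\mathrm{LM}}\mathfrak F^A$, ${}^{\mathrm{LM}}\mathfrak F^{\mathfrak S}_0=\mathrm{dir}^{\subset}_{A\in\boldsymbol\Sigma_0\mathfrak S}{}^{\mathrm{LM}}\mathfrak F^A$, ${}^{\mathrm{LM}}\mathfrak F^{\mathfrak S}_{00}=\mathrm{dir}^{\dot\subset}_{A\in\boldsymbol\Sigma_{00}\mathfrak S}{}^{\mathrm{LM}}\mathfrak F^A$, where for $A,B\in\boldsymbol\Sigma_{00}\mathfrak S$, $A\,\dot\subset\,B$ means that $B$ is the disjoint union of $A$ and some $C\in\boldsymbol\Sigma_{00}\mathfrak S$. $L(f,\mu)$ acts on formal sums by $L(f,\mu)\bigl(\sum_j\delta_{x_j}\cdot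 E_j\bigr)=\sum_jL(f(x_j),\mu(E_j))\in\mathcal Z$, and $L(f,\mu)_*\mathfrak F$ is the image filter base $\{L(f,\mu)(F):F\in\mathfrak F\}$. A filter base converges to $a$ if every neighborhood of $a$ contains one of its elements. *)

theory Defs
  imports
    "HOL-Analysis.Analysis"
    "HOL-Library.Disjoint_Sets"
    "HOL-Library.FuncSet"
    "HOL-Library.Poly_Mapping"
begin

text \<open>A uniformity satisfying the axioms of
  \<^class>\<open>uniform_topological_group_add\<close> is necessarily the group uniformity induced by the topology
  (library lemma \<open>cauchy_seq_finset_iff_vanishing\<close>), so carrying it as a
  parameter adds no structure; \<^class>\<open>complete_uniform_space\<close> is completeness with respect to it.\<close>

class complete_hausdorff_ab_group_add =
  topological_ab_group_add + uniform_topological_group_add + complete_uniform_space + t2_space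

text \<open>Countable families are indexed by arbitrary subsets of \<^typ>\<open>nat\<close>. In particular empty
  families are allowed, so the empty set belongs to all three of the families of unions below.\<close>

definition interval_system :: "'x set \<Rightarrow> 'x set set \<Rightarrow> bool" where
  "interval_system X \<SS> \<longleftrightarrow> \<SS> \<subseteq> Pow X \<and>
     (\<forall>A\<in>\<SS>. \<forall>B\<in>\<SS>. \<forall>C\<in>{A - B, A \<inter> B}.
        \<exists>(I::nat set) E. (\<forall>i\<in>I. E i \<in> \<SS>) \<and> disjoint_family_on E I \<and> C = (\<Union>i\<in>I. E i))"

definition Sigma_unions :: "'x set set \<Rightarrow> 'x set set" where
  "Sigma_unions \<SS> = {\<Union>\<DD> |\<DD>. \<DD> \<subseteq> \<SS> \<and> countable \<DD>}"

definition Sigma0_unions :: "'x set set \<Rightarrow> 'x set set" where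
  "Sigma0_unions \<SS> = {\<Union>\<DD> |\<DD>. \<DD> \<subseteq> \<SS> \<and> finite \<DD>}"

definition Sigma00_unions :: "'x set set \<Rightarrow> 'x set set" where
  "Sigma00_unions \<SS> = {\<Union>\<DD> |\<DD>. \<DD> \<subseteq> \<SS> \<and> finite \<DD> \<and> disjoint \<DD>}"

text \<open>The absolute sum over a countable family is the library's \<^const>\<open>has_sum\<close>, i.e. the limit of
  the finite partial sums along the finite subsets of the index set, directed by inclusion.\<close>

definition group_measure ::
    "'x set set \<Rightarrow> ('x set \<Rightarrow> 'w::complete_hausdorff_ab_group_add) \<Rightarrow> bool" where
  "group_measure \<SS> \<mu> \<longleftrightarrow>
     (\<forall>A\<in>\<SS>. \<forall>(I::nat set) E.
        (\<forall>i\<in>I. E i \<in> \<SS>) \<and> disjoint_family_on E I \<and> A = (\<Union>i\<in>I. E i) \<longrightarrow>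
        ((\<lambda>i. \<mu> (E i)) has_sum \<mu> A) I)"

definition graph_on :: "'x set \<Rightarrow> ('x \<Rightarrow> 'v) \<Rightarrow> ('v \<times> 'x) set" where
  "graph_on X f = {(f x, x) |x. x \<in> X}"

definition step_sum :: "nat set \<Rightarrow> (nat \<Rightarrow> 'v::ab_group_add) \<Rightarrow> (nat \<Rightarrow> 'x set) \<Rightarrow> 'x \<Rightarrow> 'v" where
  "step_sum J c E x = (\<Sum>j\<in>J. if x \<in> E j then c j else 0)"

definition step_function :: "'x set set \<Rightarrow> ('x \<Rightarrow> 'v::ab_group_add) \<Rightarrow> bool" where
  "step_function \<SS> s \<longleftrightarrow> (\<exists>J c E. finite J \<and> (\<forall>j\<in>J. E j \<in> \<SS>) \<and> s = step_sum J c E)"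

definition common_section :: "('v \<times> 'x) set \<Rightarrow> 'x set \<Rightarrow> 'v set" where
  "common_section \<A> D = {v. \<forall>x\<in>D. (v, x) \<in> \<A>}"

definition envelope :: "'x set \<Rightarrow> 'x set set \<Rightarrow> ('v::ab_group_add \<times> 'x) set \<Rightarrow> bool" where
  "envelope X \<SS> \<A> \<longleftrightarrow> \<A> \<subseteq> UNIV \<times> X \<and>
     (\<exists>s. step_function \<SS> s \<and> graph_on X s \<subseteq> \<A>) \<and>
     (\<exists>\<DD>. \<DD> \<subseteq> \<SS> \<and> countable \<DD> \<and>
        \<A> = (\<Union>D\<in>\<DD>. common_section \<A> D \<times> D) \<union> ({0} \<times> (X - \<Union>\<DD>)))"

definition envelope_integral ::
    "'x set \<Rightarrow> 'x set set \<Rightarrow> ('v::ab_group_add \<Rightarrow> 'w \<Rightarrow> 'z) \<Rightarrow> ('x set \<Rightarrow> 'w) \<Rightarrow> ('v \<times> 'x) set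
      \<Rightarrow> 'z::complete_hausdorff_ab_group_add set" where
  "envelope_integral X \<SS> L \<mu> \<A> =
     closure {\<Sum>j\<in>J. L (c j) (\<mu> (E j)) |(J::nat set) c E.
       finite J \<and> (\<forall>j\<in>J. E j \<in> \<SS>) \<and> graph_on X (step_sum J c E) \<subseteq> \<A>}"

definition zero_outside :: "('x \<Rightarrow> 'v::ab_group_add) \<Rightarrow> 'x set \<Rightarrow> 'x \<Rightarrow> 'v" where
  "zero_outside f B x = (if x \<in> B then f x else 0)"

definition has_extended_LM_integral ::
    "'x set \<Rightarrow> 'x set set \<Rightarrow> ('v::ab_group_add \<Rightarrow> 'w \<Rightarrow> 'z::complete_hausdorff_ab_group_add)
      \<Rightarrow> ('x set \<Rightarrow> 'w) \<Rightarrow> ('x \<Rightarrow> 'v) \<Rightarrow> 'z \<Rightarrow> bool" where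
  "has_extended_LM_integral X \<SS> L \<mu> f a \<longleftrightarrow>
     (\<forall>\<T>. 0 \<in> interior \<T> \<longrightarrow>
       (\<exists>A\<in>Sigma_unions \<SS>. \<forall>B\<in>Sigma_unions \<SS>. A \<subseteq> B \<longrightarrow>
         (\<exists>\<B>. envelope X \<SS> \<B> \<and> graph_on X (zero_outside f B) \<subseteq> \<B> \<and>
              envelope_integral X \<SS> L \<mu> \<B> \<subseteq> (\<lambda>t. a + t) ` \<T>)))"

definition fb_prod :: "'i set \<Rightarrow> ('i \<Rightarrow> 'a set set) \<Rightarrow> 'a set set" where
  "fb_prod \<Lambda> \<FF> = {\<Union>l\<in>\<Lambda>. F l |F. \<forall>l\<in>\<Lambda>. F l \<in> \<FF> l}"

definition is_top :: "'p set \<Rightarrow> ('p \<Rightarrow> 'p \<Rightarrow> bool) \<Rightarrow> 'p set \<Rightarrow> bool" where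
  "is_top P le S \<longleftrightarrow> S \<subseteq> P \<and> (\<forall>p\<in>P. \<exists>s\<in>S. le p s) \<and> (\<forall>s\<in>S. \<forall>t\<in>P. le s t \<longrightarrow> t \<in> S)"

definition fb_dir :: "'p set \<Rightarrow> ('p \<Rightarrow> 'p \<Rightarrow> bool) \<Rightarrow> ('p \<Rightarrow> 'a set set) \<Rightarrow> 'a set set" where
  "fb_dir P le \<FF> = \<Union>{fb_prod S \<FF> |S. is_top P le S}"

definition fb_image :: "('a \<Rightarrow> 'b) \<Rightarrow> 'a set set \<Rightarrow> 'b set set" where
  "fb_image g \<FF> = {g ` F |F. F \<in> \<FF>}"

definition fb_converges :: "'z::topological_space set set \<Rightarrow> 'z \<Rightarrow> bool" where
  "fb_converges \<FF> a \<longleftrightarrow> (\<forall>\<T>. a \<in> interior \<T> \<longrightarrow> (\<exists>F\<in>\<FF>. F \<subseteq> \<T>))"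

text \<open>Formal sums are elements of the free abelian group \<open>('x \<times> 'x set) \<Rightarrow>\<^sub>0 int\<close>, the generator
  \<open>\<delta>\<^sub>x \<cdot> E\<close> being \<open>frag_of (x, E)\<close>; the sums used below have support in \<open>X \<times> \<SS>\<close>. Tag functions are
  taken extensional, so that each function with the prescribed domain is represented only once.\<close>

definition tag_system :: "'x set set \<Rightarrow> 'x set set \<Rightarrow> ('x \<Rightarrow> 'x set) \<Rightarrow> bool" where
  "tag_system \<SS> \<DD> h \<longleftrightarrow> \<DD> \<subseteq> \<SS> \<and> countable \<DD> \<and> h \<in> \<Union>\<DD> \<rightarrow>\<^sub>E \<DD> \<and> (\<forall>x\<in>\<Union>\<DD>. x \<in> h x)"

definition LM_divisions ::
    "'x set set \<Rightarrow> 'x set set \<Rightarrow> ('x \<Rightarrow> 'x set) \<Rightarrow> ('x set set \<times> ('x set \<Rightarrow> 'x)) set" where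
  "LM_divisions \<SS> \<DD> h = {(\<EE>, c). \<EE> \<subseteq> \<SS> \<and> countable \<EE> \<and> disjoint \<EE> \<and> {} \<notin> \<EE> \<and>
     \<Union>\<EE> = \<Union>\<DD> \<and> c \<in> \<EE> \<rightarrow>\<^sub>E \<Union>\<DD> \<and> (\<forall>E\<in>\<EE>. E \<subseteq> h (c E))}"

definition division_fb ::
    "'x set set \<times> ('x set \<Rightarrow> 'x) \<Rightarrow> (('x \<times> 'x set) \<Rightarrow>\<^sub>0 int) set set" where
  "division_fb = (\<lambda>(\<EE>, c).
     {{\<Sum>E\<in>\<Omega>. frag_of (c E, E) |\<Omega>. finite \<Omega> \<and> \<Xi> \<subseteq> \<Omega> \<and> \<Omega> \<subseteq> \<EE>} |\<Xi>. finite \<Xi> \<and> \<Xi> \<subseteq> \<EE>})"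

definition LM_fb_tag ::
    "'x set set \<Rightarrow> 'x set set \<Rightarrow> ('x \<Rightarrow> 'x set) \<Rightarrow> (('x \<times> 'x set) \<Rightarrow>\<^sub>0 int) set set" where
  "LM_fb_tag \<SS> \<DD> h = fb_prod (LM_divisions \<SS> \<DD> h) division_fb"

definition LM_fb_on :: "'x set set \<Rightarrow> 'x set \<Rightarrow> (('x \<times> 'x set) \<Rightarrow>\<^sub>0 int) set set" where
  "LM_fb_on \<SS> A = \<Union>{LM_fb_tag \<SS> \<DD> h |\<DD> h. tag_system \<SS> \<DD> h \<and> \<Union>\<DD> = A}"

definition dot_subset :: "'x set set \<Rightarrow> 'x set \<Rightarrow> 'x set \<Rightarrow> bool" where
  "dot_subset \<SS> A B \<longleftrightarrow> (\<exists>C\<in>Sigma00_unions \<SS>. A \<inter> C = {} \<and> B = A \<union> C)"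

definition LM_fb :: "'x set set \<Rightarrow> (('x \<times> 'x set) \<Rightarrow>\<^sub>0 int) set set" where
  "LM_fb \<SS> = fb_dir (Sigma_unions \<SS>) (\<subseteq>) (LM_fb_on \<SS>)"

definition LM_fb0 :: "'x set set \<Rightarrow> (('x \<times> 'x set) \<Rightarrow>\<^sub>0 int) set set" where
  "LM_fb0 \<SS> = fb_dir (Sigma0_unions \<SS>) (\<subseteq>) (LM_fb_on \<SS>)"

definition LM_fb00 :: "'x set set \<Rightarrow> (('x \<times> 'x set) \<Rightarrow>\<^sub>0 int) set set" where
  "LM_fb00 \<SS> = fb_dir (Sigma00_unions \<SS>) (dot_subset \<SS>) (LM_fb_on \<SS>)"

definition int_multiple :: "int \<Rightarrow> 'z::ab_group_add \<Rightarrow> 'z" where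
  "int_multiple k z = (if 0 \<le> k then \<Sum>i<nat k. z else - (\<Sum>i<nat (- k). z))"

text \<open>The homomorphism on the free abelian group with \<open>\<delta>\<^sub>x \<cdot> E \<mapsto> L (f x) (\<mu> E)\<close>.\<close>

definition formal_sum_eval ::
    "('v \<Rightarrow> 'w \<Rightarrow> 'z::ab_group_add) \<Rightarrow> ('x \<Rightarrow> 'v) \<Rightarrow> ('x set \<Rightarrow> 'w)
      \<Rightarrow> (('x \<times> 'x set) \<Rightarrow>\<^sub>0 int) \<Rightarrow> 'z" where
  "formal_sum_eval L f \<mu> u =
     (\<Sum>(x, E)\<in>Poly_Mapping.keys u. int_multiple (Poly_Mapping.lookup u (x, E)) (L (f x) (\<mu> E)))"

definition biadditive :: "('v::ab_group_add \<Rightarrow> 'w::ab_group_add \<Rightarrow> 'z::ab_group_add) \<Rightarrow> bool" where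
  "biadditive L \<longleftrightarrow> (\<forall>v. Modules.additive (L v)) \<and> (\<forall>w. Modules.additive (\<lambda>v. L v w))"

end

theory Submission
  imports Defs
begin

text \<open>Call a gauge \<open>h\<close> on \<open>B\<close> good for \<open>G\<close> if along every \<open>h\<close>-fine division of \<open>B\<close> the finite sums
  eventually lie in \<open>G\<close>. All four statements say that for each neighbourhood \<open>G\<close> of \<open>a\<close> suitable large
  sets have good gauges.

  The key fact is that for a good gauge and a fine division there are a finite part \<open>\<Xi>\<close> of the
  division and a finer gauge such that all finite fine families disjoint from \<open>\<Xi>\<close> have small sums:
  otherwise infinitely many pairwise disjoint families with large sums could be put into a single fine
  division. It makes \<open>{(f y, z). z \<in> h y}\<close>, enlarged by the value \<open>0\<close> off \<open>\<Xi>\<close>, an envelope with small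
  integral, and it allows one to pass from countable unions to finite unions containing \<open>\<Xi>\<close>.

  Conversely, given an envelope, a tag \<open>x\<close> may be used on every set on which the value \<open>f x\<close> is
  admissible. A finite part of a division is completed to a step function in the envelope, and the
  completion is small by the Cauchy property of the absolute sums of the given step function.

  To return from finite to countable unions, \<open>B\<close> is exhausted by finite unions, and on the \<open>n\<close>-th layer
  a gauge is used whose sums vary by less than the \<open>n\<close>-th term of a summable sequence of neighbourhoods,
  as in the Saks-Henstock lemma.\<close>

text \<open>\<open>Sigma_unions\<close> is closed under countable unions and finite intersections,
  but in general only under differences with finite unions. Completing a family to a division must
  therefore remove only finitely many sets from each set that it cuts; this is why the key fact
  first confines the finer gauge to the members of the given division. The other constraint is
  countability: a gauge has countably many values but possibly uncountably many points, so tags are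
  chosen per value.

  There is no norm, and \<open>L\<close> is continuous only for a fixed first argument. Estimates
  are identities between finite sums with errors in neighbourhoods, recorded as iterated differences
  \<open>sdiff\<close>; limits are taken for one finite step function at a time. In the final
  expressions the terms close to \<open>a\<close> have coefficients with sum 1, so \<open>a\<close>
  survives and only the depth of nesting has to be paid for.\<close>

definition cover :: "('t \<times> 'x set) set \<Rightarrow> 'x set" where
  "cover T = \<Union>(snd ` T)"

definition adapted :: "'x set set \<Rightarrow> 'x set \<Rightarrow> bool" where
  "adapted \<A> P \<longleftrightarrow> (\<forall>A\<in>\<A>. P \<subseteq> A \<or> P \<inter> A = {})"

lemma cover_Un [simp]: "cover (S \<union> T) = cover S \<union> cover T"
  by (auto simp: cover_def)

lemma cover_empty [simp]: "cover {} = {}"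
  by (auto simp: cover_def)

lemma cover_mono: "S \<subseteq> T \<Longrightarrow> cover S \<subseteq> cover T"
  by (auto simp: cover_def)

lemma in_coverI: "(t, E) \<in> T \<Longrightarrow> x \<in> E \<Longrightarrow> x \<in> cover T"
  by (force simp: cover_def)

lemma in_coverE:
  assumes "x \<in> cover T"
  obtains t E where "(t, E) \<in> T" "x \<in> E"
  using assms by (force simp: cover_def)

lemma cover_UN: "cover (\<Union>i\<in>I. T i) = (\<Union>i\<in>I. cover (T i))"
  by (auto simp: cover_def)

section \<open>Unions of intervals and their disjoint tagged refinements\<close>

locale intervals =
  fixes X :: "'x set" and \<SS> :: "'x set set"
  assumes intervals: "interval_system X \<SS>"
begin

text \<open>Since the sets are nonempty and distinct pairs have disjoint sets, a set occurs with
  only one tag. The tag type is left free because refinements record different things in it: nothing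
  (\<open>unit\<close>), a point, or the member of another family from which a piece was
  cut.\<close>

definition tagged :: "('t \<times> 'x set) set \<Rightarrow> bool" where
  "tagged T \<longleftrightarrow> countable T \<and> (\<forall>(t, E)\<in>T. E \<in> \<SS> \<and> E \<noteq> {}) \<and>
     (\<forall>p\<in>T. \<forall>q\<in>T. p \<noteq> q \<longrightarrow> snd p \<inter> snd q = {})"

abbreviation Sig :: "'x set set" where "Sig \<equiv> Sigma_unions \<SS>"

abbreviation Sig0 :: "'x set set" where "Sig0 \<equiv> Sigma0_unions \<SS>"

lemma SS_subset: "E \<in> \<SS> \<Longrightarrow> E \<subseteq> X"
  using intervals by (auto simp: interval_system_def)

lemma in_SigI: "\<DD> \<subseteq> \<SS> \<Longrightarrow> countable \<DD> \<Longrightarrow> \<Union>\<DD> \<in> Sig"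
  by (auto simp: Sigma_unions_def)

lemma in_SigE:
  assumes "A \<in> Sig"
  obtains \<DD> where "\<DD> \<subseteq> \<SS>" "countable \<DD>" "A = \<Union>\<DD>"
  using assms by (auto simp: Sigma_unions_def)

lemma Sig_subset: "A \<in> Sig \<Longrightarrow> A \<subseteq> X"
  using SS_subset by (auto simp: Sigma_unions_def)

lemma SS_Sig: "E \<in> \<SS> \<Longrightarrow> E \<in> Sig"
  using in_SigI[of "{E}"] by simp

lemma Sig_empty: "{} \<in> Sig"
  using in_SigI[of "{}"] by simp

lemma Sig_UN:
  assumes "countable I" "\<And>i. i \<in> I \<Longrightarrow> A i \<in> Sig"
  shows "(\<Union>i\<in>I. A i) \<in> Sig"
proof -
  have "\<forall>i\<in>I. \<exists>\<DD>. \<DD> \<subseteq> \<SS> \<and> countable \<DD> \<and> A i = \<Union>\<DD>"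
    using assms(2) in_SigE by metis
  then obtain \<DD> where D: "\<And>i. i \<in> I \<Longrightarrow> \<DD> i \<subseteq> \<SS> \<and> countable (\<DD> i) \<and> A i = \<Union>(\<DD> i)"
    by metis
  have "\<Union>(\<Union>i\<in>I. \<DD> i) \<in> Sig"
  proof (rule in_SigI)
    show "(\<Union>i\<in>I. \<DD> i) \<subseteq> \<SS>" using D by blast
    show "countable (\<Union>i\<in>I. \<DD> i)" using D assms(1) by blast
  qed
  moreover have "\<Union>(\<Union>i\<in>I. \<DD> i) = (\<Union>i\<in>I. A i)"
    using D by auto
  ultimately show ?thesis by simp
qed

lemma Sig_Un: "A \<in> Sig \<Longrightarrow> B \<in> Sig \<Longrightarrow> A \<union> B \<in> Sig"
  using Sig_UN[of "{A, B}" id] by auto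

lemma SS_pieces:
  assumes "A \<in> \<SS>" "B \<in> \<SS>" "C = A - B \<or> C = A \<inter> B"
  shows "\<exists>\<P>. countable \<P> \<and> \<P> \<subseteq> \<SS> \<and> disjoint \<P> \<and> {} \<notin> \<P> \<and> \<Union>\<P> = C"
proof -
  have "\<forall>C\<in>{A - B, A \<inter> B}. \<exists>(I::nat set) E. (\<forall>i\<in>I. E i \<in> \<SS>) \<and> disjoint_family_on E I \<and> C = (\<Union>i\<in>I. E i)"
    using intervals assms(1,2) unfolding interval_system_def by blast
  then obtain I :: "nat set" and E where IE: "\<forall>i\<in>I. E i \<in> \<SS>" "disjoint_family_on E I" "C = (\<Union>i\<in>I. E i)"
    using assms(3) by (metis insertCI)
  show ?thesis
  proof (intro exI conjI)
    show "countable (E ` I - {{}})" by simp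
    show "disjoint (E ` I - {{}})"
      using disjoint_family_on_disjoint_image[OF IE(2)] by (rule pairwise_subset) auto
  qed (use IE in auto)
qed

lemma Sig_Int:
  assumes "A \<in> Sig" "B \<in> Sig"
  shows "A \<inter> B \<in> Sig"
proof -
  obtain \<DD> where D: "\<DD> \<subseteq> \<SS>" "countable \<DD>" "A = \<Union>\<DD>" using assms(1) by (rule in_SigE)
  obtain \<EE> where E: "\<EE> \<subseteq> \<SS>" "countable \<EE>" "B = \<Union>\<EE>" using assms(2) by (rule in_SigE)
  have "(\<Union>p\<in>\<DD>\<times>\<EE>. fst p \<inter> snd p) \<in> Sig"
  proof (rule Sig_UN)
    fix p assume "p \<in> \<DD> \<times> \<EE>"
    then have "fst p \<in> \<SS>" "snd p \<in> \<SS>" using D E by auto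
    from SS_pieces[OF this, of "fst p \<inter> snd p"] show "fst p \<inter> snd p \<in> Sig"
      using in_SigI by metis
  qed (use D E in auto)
  moreover have "(\<Union>p\<in>\<DD>\<times>\<EE>. fst p \<inter> snd p) = A \<inter> B" using D E by auto
  ultimately show ?thesis by simp
qed

lemma Sig_Diff_SS:
  assumes "A \<in> Sig" "B \<in> \<SS>"
  shows "A - B \<in> Sig"
proof -
  obtain \<DD> where D: "\<DD> \<subseteq> \<SS>" "countable \<DD>" "A = \<Union>\<DD>" using assms(1) by (rule in_SigE)
  have "(\<Union>d\<in>\<DD>. d - B) \<in> Sig"
  proof (rule Sig_UN)
    fix d assume "d \<in> \<DD>"
    then show "d - B \<in> Sig"
      using SS_pieces[of d B "d - B"] D(1) assms(2) in_SigI by (metis subsetD)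
  qed (use D in auto)
  moreover have "(\<Union>d\<in>\<DD>. d - B) = A - B" using D by auto
  ultimately show ?thesis by simp
qed

text \<open>One member of \<open>\<SS>\<close> can be removed at a time. Removing infinitely many
  would amount to a countable intersection, under which \<open>Sig\<close> need not be closed; hence
  the care about finiteness in all later completions.\<close>

lemma Sig_Diff_finite:
  assumes "finite \<F>" "A \<in> Sig" "\<F> \<subseteq> \<SS>"
  shows "A - \<Union>\<F> \<in> Sig"
  using assms
proof (induction \<F>)
  case (insert B \<F>)
  then have "(A - \<Union>\<F>) - B \<in> Sig" using Sig_Diff_SS by auto
  moreover have "A - \<Union>(insert B \<F>) = (A - \<Union>\<F>) - B" by auto
  ultimately show ?case by simp
qed simp

lemma Sig_Diff_Sig0: "A \<in> Sig \<Longrightarrow> B \<in> Sig0 \<Longrightarrow> A - B \<in> Sig"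
  using Sig_Diff_finite by (auto simp: Sigma0_unions_def)

lemma Sig0_Sig: "A \<in> Sig0 \<Longrightarrow> A \<in> Sig"
  unfolding Sigma0_unions_def Sigma_unions_def using countable_finite by blast

lemma Sig0_Union: "finite \<DD> \<Longrightarrow> \<DD> \<subseteq> \<SS> \<Longrightarrow> \<Union>\<DD> \<in> Sig0"
  by (auto simp: Sigma0_unions_def)

lemma Sig0_Un:
  assumes "A \<in> Sig0" "B \<in> Sig0"
  shows "A \<union> B \<in> Sig0"
proof -
  obtain \<DD> \<EE> where D: "\<DD> \<subseteq> \<SS>" "finite \<DD>" "A = \<Union>\<DD>" "\<EE> \<subseteq> \<SS>" "finite \<EE>" "B = \<Union>\<EE>"
    using assms by (auto simp: Sigma0_unions_def)
  then show ?thesis using Sig0_Union[of "\<DD> \<union> \<EE>"] by (simp add: Union_Un_distrib)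
qed

lemma taggedI:
  assumes "countable T" "\<And>t E. (t, E) \<in> T \<Longrightarrow> E \<in> \<SS>" "\<And>t E. (t, E) \<in> T \<Longrightarrow> E \<noteq> {}"
    and "\<And>p q. p \<in> T \<Longrightarrow> q \<in> T \<Longrightarrow> p \<noteq> q \<Longrightarrow> snd p \<inter> snd q = {}"
  shows "tagged T"
  using assms unfolding tagged_def by auto

lemma tagged_subset:
  assumes "tagged T" "S \<subseteq> T"
  shows "tagged S"
proof (rule taggedI)
  show "countable S" using assms countable_subset unfolding tagged_def by auto
  show "E \<in> \<SS>" "E \<noteq> {}" if "(t, E) \<in> S" for t E
    using assms(1) subsetD[OF assms(2) that] unfolding tagged_def by auto
  show "snd p \<inter> snd q = {}" if "p \<in> S" "q \<in> S" "p \<noteq> q" for p q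
    using assms(1) subsetD[OF assms(2)] that unfolding tagged_def by simp
qed

lemma tagged_countable: "tagged T \<Longrightarrow> countable T"
  by (simp add: tagged_def)

lemma tagged_SS: "tagged T \<Longrightarrow> (t, E) \<in> T \<Longrightarrow> E \<in> \<SS>"
  by (auto simp: tagged_def)

lemma tagged_snd_SS: "tagged T \<Longrightarrow> snd ` T \<subseteq> \<SS>"
  by (auto simp: tagged_def)

lemma tagged_nonempty: "tagged T \<Longrightarrow> (t, E) \<in> T \<Longrightarrow> E \<noteq> {}"
  by (auto simp: tagged_def)

lemma tagged_disjoint:
  assumes "tagged T" "p \<in> T" "q \<in> T" "p \<noteq> q"
  shows "snd p \<inter> snd q = {}"
  using assms unfolding tagged_def by blast

lemma tagged_eq:
  assumes "tagged T" "(s, D) \<in> T" "(t, E) \<in> T" "x \<in> D" "x \<in> E"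
  shows "s = t \<and> D = E"
  using tagged_disjoint[OF assms(1-3)] assms(4,5) by auto

lemma tagged_inj: "tagged T \<Longrightarrow> inj_on snd T"
  by (rule inj_onI) (metis Int_absorb prod.collapse tagged_disjoint tagged_nonempty)

lemma tagged_empty [simp]: "tagged {}"
  by (simp add: tagged_def)

lemma cover_disjointD:
  assumes "cover S \<inter> cover T = {}" "p \<in> S" "q \<in> T"
  shows "snd p \<inter> snd q = {}"
proof -
  have "snd p \<subseteq> cover S" "snd q \<subseteq> cover T"
    using assms(2,3) by (auto simp: cover_def)
  then show ?thesis using assms(1) by auto
qed

lemma tagged_UN:
  assumes "countable I" "\<And>i. i \<in> I \<Longrightarrow> tagged (T i)"
    and "\<And>i j. i \<in> I \<Longrightarrow> j \<in> I \<Longrightarrow> i \<noteq> j \<Longrightarrow> cover (T i) \<inter> cover (T j) = {}"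
  shows "tagged (\<Union>i\<in>I. T i)"
proof (rule taggedI)
  show "countable (\<Union>i\<in>I. T i)"
    using assms(1,2) by (simp add: tagged_countable)
  show "E \<in> \<SS>" "E \<noteq> {}" if tE: "(t, E) \<in> (\<Union>i\<in>I. T i)" for t E
  proof -
    obtain i where i: "i \<in> I" "(t, E) \<in> T i" using tE by auto
    show "E \<in> \<SS>" "E \<noteq> {}"
      using tagged_SS[OF assms(2)[OF i(1)] i(2)] tagged_nonempty[OF assms(2)[OF i(1)] i(2)] .
  qed
  show "snd p \<inter> snd q = {}" if pq: "p \<in> (\<Union>i\<in>I. T i)" "q \<in> (\<Union>i\<in>I. T i)" "p \<noteq> q" for p q
  proof -
    obtain i j where ij: "i \<in> I" "p \<in> T i" "j \<in> I" "q \<in> T j" using pq by auto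
    show ?thesis
    proof (cases "i = j")
      case True
      then show ?thesis using tagged_disjoint[OF assms(2)[OF ij(1)]] ij pq(3) by simp
    next
      case False
      show ?thesis using cover_disjointD[OF assms(3)[OF ij(1,3) False] ij(2,4)] .
    qed
  qed
qed

lemma tagged_Un:
  assumes "tagged S" "tagged T" "cover S \<inter> cover T = {}"
  shows "tagged (S \<union> T)"
proof -
  have "tagged (\<Union>b\<in>UNIV. if b then S else T)"
    by (rule tagged_UN) (use assms in \<open>auto simp: Int_commute split: if_splits\<close>)
  moreover have "(\<Union>b\<in>UNIV. if b then S else T) = S \<union> T" by (auto split: if_splits)
  ultimately show ?thesis by simp
qed

lemma disjoint_cover:
  assumes "tagged (S \<union> T)" "S \<inter> T = {}"
  shows "cover S \<inter> cover T = {}"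
proof -
  have "snd p \<inter> snd q = {}" if "p \<in> S" "q \<in> T" for p q
    by (rule tagged_disjoint[OF assms(1)]) (use that assms(2) in auto)
  then show ?thesis unfolding cover_def by force
qed

lemma cover_disjoint_imp:
  assumes "tagged S" "cover S \<inter> cover T = {}"
  shows "S \<inter> T = {}"
proof -
  have "False" if "p \<in> S" "p \<in> T" for p
  proof -
    obtain t E where p: "p = (t, E)" by (cases p)
    then have "E \<noteq> {}" using tagged_nonempty[OF assms(1)] that(1) by simp
    then obtain x where x: "x \<in> E" by blast
    have "x \<in> cover S" "x \<in> cover T" using in_coverI[OF _ x] that p by simp_all
    then show False using assms(2) by auto
  qed
  then show ?thesis by (rule Int_emptyI)
qed

lemma cover_Sig: "tagged T \<Longrightarrow> cover T \<in> Sig"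
  using in_SigI[of "snd ` T"] tagged_countable[of T] tagged_snd_SS[of T] by (simp add: cover_def)

lemma cover_Sig0: "tagged T \<Longrightarrow> finite T \<Longrightarrow> cover T \<in> Sig0"
  using Sig0_Union[of "snd ` T"] tagged_snd_SS[of T] by (simp add: cover_def)

lemma disjoint_snd:
  assumes "tagged T"
  shows "disjoint (snd ` T)"
proof (rule disjointI)
  fix D E assume DE: "D \<in> snd ` T" "E \<in> snd ` T" "D \<noteq> E"
  then obtain p q where "p \<in> T" "q \<in> T" "D = snd p" "E = snd q" by auto
  then show "D \<inter> E = {}" using tagged_disjoint[OF assms, of p q] DE(3) by auto
qed

lemma SS_Diff_pieces:
  assumes "finite \<F>" "A \<in> \<SS>" "\<F> \<subseteq> \<SS>"
  shows "\<exists>\<P>. countable \<P> \<and> \<P> \<subseteq> \<SS> \<and> disjoint \<P> \<and> {} \<notin> \<P> \<and> \<Union>\<P> = A - \<Union>\<F>"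
  using assms
proof (induction \<F>)
  case empty
  then show ?case by (intro exI[of _ "if A = {} then {} else {A}"]) auto
next
  case (insert B \<F>)
  then obtain \<P> where P: "countable \<P>" "\<P> \<subseteq> \<SS>" "disjoint \<P>" "{} \<notin> \<P>" "\<Union>\<P> = A - \<Union>\<F>"
    by auto
  have "\<forall>p\<in>\<P>. \<exists>\<Q>. countable \<Q> \<and> \<Q> \<subseteq> \<SS> \<and> disjoint \<Q> \<and> {} \<notin> \<Q> \<and> \<Union>\<Q> = p - B"
  proof
    fix p assume "p \<in> \<P>"
    then have "p \<in> \<SS>" "B \<in> \<SS>" using P(2) insert.prems by auto
    then show "\<exists>\<Q>. countable \<Q> \<and> \<Q> \<subseteq> \<SS> \<and> disjoint \<Q> \<and> {} \<notin> \<Q> \<and> \<Union>\<Q> = p - B"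
      by (rule SS_pieces) simp
  qed
  from bchoice[OF this] obtain \<Q> where "\<forall>p\<in>\<P>. countable (\<Q> p) \<and> \<Q> p \<subseteq> \<SS> \<and> disjoint (\<Q> p) \<and> {} \<notin> \<Q> p \<and> \<Union>(\<Q> p) = p - B" ..
  then have Q: "countable (\<Q> p)" "\<Q> p \<subseteq> \<SS>" "disjoint (\<Q> p)" "{} \<notin> \<Q> p" "\<Union>(\<Q> p) = p - B"
    if "p \<in> \<P>" for p using that by auto
  have "C \<inter> D = {}" if "C \<in> \<Q> p" "D \<in> \<Q> q" "p \<in> \<P>" "q \<in> \<P>" "C \<noteq> D" for C D p q
  proof (cases "p = q")
    case True
    then show ?thesis using Q[OF that(3)] that(1,2,5) by (auto dest: disjointD)
  next
    case False
    then have "p \<inter> q = {}" using P(3) that by (auto dest: disjointD)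
    moreover have "C \<subseteq> p" "D \<subseteq> q" using Q[OF that(3)] Q[OF that(4)] that(1,2) by blast+
    ultimately show ?thesis by blast
  qed
  then have "disjoint (\<Union>p\<in>\<P>. \<Q> p)" by (intro disjointI) blast
  moreover have "\<Union>(\<Union>p\<in>\<P>. \<Q> p) = A - \<Union>(insert B \<F>)"
  proof -
    have "\<Union>(\<Union>p\<in>\<P>. \<Q> p) = (\<Union>p\<in>\<P>. \<Union>(\<Q> p))" by auto
    also have "\<dots> = (\<Union>p\<in>\<P>. p - B)" using Q by (intro SUP_cong) auto
    also have "\<dots> = \<Union>\<P> - B" by auto
    finally show ?thesis using P(5) by auto
  qed
  moreover have "countable (\<Union>p\<in>\<P>. \<Q> p)" "(\<Union>p\<in>\<P>. \<Q> p) \<subseteq> \<SS>" "{} \<notin> (\<Union>p\<in>\<P>. \<Q> p)"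
    using P(1) Q(1) by simp (use Q(2,4) in blast)+
  ultimately show ?case by blast
qed

text \<open>Each point goes to the first member containing it in an enumeration. Only finitely many
  earlier members are subtracted, so every difference splits into pieces from \<open>\<SS>\<close>,
  and a piece inherits the tag of its member.\<close>

lemma refine_SS:
  assumes "countable \<G>" "\<And>t G. (t, G) \<in> \<G> \<Longrightarrow> G \<in> \<SS>"
  shows "\<exists>T. tagged T \<and> cover T = cover \<G> \<and> (\<forall>(t, E)\<in>T. \<exists>G. (t, G) \<in> \<G> \<and> E \<subseteq> G)"
proof (cases "\<G> = {}")
  case True
  then show ?thesis by (intro exI[of _ "{}"]) simp
next
  case False
  \<comment> \<open>The enumeration may repeat members; at a repetition the difference
    \<open>U n\<close> is empty and yields no pieces.\<close>
  define g where "g = from_nat_into \<G>"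
  have g: "range g = \<G>" unfolding g_def using False assms(1) by (rule range_from_nat_into)
  have gS: "snd (g n) \<in> \<SS>" for n
    using assms(2)[of "fst (g n)" "snd (g n)"] g by (metis prod.collapse rangeI)
  define U where "U n = snd (g n) - \<Union>((\<lambda>m. snd (g m)) ` {..<n})" for n
  have "\<exists>\<P>. countable \<P> \<and> \<P> \<subseteq> \<SS> \<and> disjoint \<P> \<and> {} \<notin> \<P> \<and> \<Union>\<P> = U n" for n
    unfolding U_def by (rule SS_Diff_pieces) (use gS in auto)
  then have "\<forall>n. \<exists>\<P>. countable \<P> \<and> \<P> \<subseteq> \<SS> \<and> disjoint \<P> \<and> {} \<notin> \<P> \<and> \<Union>\<P> = U n"
    by (rule allI)
  from choice[OF this] obtain P where "\<forall>n. countable (P n) \<and> P n \<subseteq> \<SS> \<and> disjoint (P n) \<and> {} \<notin> P n \<and> \<Union>(P n) = U n" ..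
  then have P: "countable (P n)" "P n \<subseteq> \<SS>" "disjoint (P n)" "{} \<notin> P n" "\<Union>(P n) = U n" for n
    by auto
  define T where "T = (\<Union>n. Pair (fst (g n)) ` P n)"
  have cov: "cover (Pair (fst (g n)) ` P n) = U n" for n
    using P[of n] by (auto simp: cover_def image_image)
  have Udisj: "U m \<inter> U n = {}" if "m < n" for m n
    using that unfolding U_def by blast
  have "tagged T" unfolding T_def
  proof (rule tagged_UN)
    fix n
    show "tagged (Pair (fst (g n)) ` P n)"
    proof (rule taggedI)
      show "snd p \<inter> snd q = {}" if "p \<in> Pair (fst (g n)) ` P n" "q \<in> Pair (fst (g n)) ` P n" "p \<noteq> q" for p q
        by (rule disjointD[OF P(3)[of n]]) (use that in auto)
    qed (use P[of n] in auto)
  next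
    fix m n :: nat assume "m \<noteq> n"
    then show "cover (Pair (fst (g m)) ` P m) \<inter> cover (Pair (fst (g n)) ` P n) = {}"
      unfolding cov using Udisj[of m n] Udisj[of n m] by (cases "m < n") auto
  qed simp
  moreover have "cover T = cover \<G>"
  proof -
    have "(\<Union>n. U n) = (\<Union>n. snd (g n))"
    proof (intro equalityI subsetI)
      fix x assume "x \<in> (\<Union>n. snd (g n))"
      then obtain n where n: "x \<in> snd (g n)" by blast
      have "x \<in> U (LEAST n. x \<in> snd (g n))"
        unfolding U_def using LeastI[of "\<lambda>n. x \<in> snd (g n)", OF n] not_less_Least by blast
      then show "x \<in> (\<Union>n. U n)" by blast
    qed (auto simp: U_def)
    then show ?thesis unfolding T_def cover_UN cov using g by (auto simp: cover_def)
  qed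
  moreover have "\<forall>(t, E)\<in>T. \<exists>G. (t, G) \<in> \<G> \<and> E \<subseteq> G"
  proof (clarsimp simp: T_def)
    fix n E assume "E \<in> P n"
    then have "E \<subseteq> snd (g n)" using P[of n] unfolding U_def by blast
    then show "\<exists>G. (fst (g n), G) \<in> \<G> \<and> E \<subseteq> G"
      using g by (metis prod.collapse rangeI)
  qed
  ultimately show ?thesis by blast
qed

lemma refine_Sig:
  assumes "countable \<G>" "\<And>t G. (t, G) \<in> \<G> \<Longrightarrow> G \<in> Sig"
  shows "\<exists>T. tagged T \<and> cover T = cover \<G> \<and> (\<forall>(t, E)\<in>T. \<exists>G. (t, G) \<in> \<G> \<and> E \<subseteq> G)"
proof -
  have "\<forall>p\<in>\<G>. \<exists>\<DD>. \<DD> \<subseteq> \<SS> \<and> countable \<DD> \<and> snd p = \<Union>\<DD>"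
  proof
    fix p assume "p \<in> \<G>"
    then have "snd p \<in> Sig" using assms(2)[of "fst p" "snd p"] by simp
    then show "\<exists>\<DD>. \<DD> \<subseteq> \<SS> \<and> countable \<DD> \<and> snd p = \<Union>\<DD>" by (rule in_SigE) blast
  qed
  from bchoice[OF this] obtain \<DD> where "\<forall>p\<in>\<G>. \<DD> p \<subseteq> \<SS> \<and> countable (\<DD> p) \<and> snd p = \<Union>(\<DD> p)" ..
  then have D: "\<DD> p \<subseteq> \<SS>" "countable (\<DD> p)" "snd p = \<Union>(\<DD> p)" if "p \<in> \<G>" for p
    using that by auto
  define \<H> where "\<H> = (\<Union>p\<in>\<G>. Pair (fst p) ` \<DD> p)"
  have "\<exists>T. tagged T \<and> cover T = cover \<H> \<and> (\<forall>(t, E)\<in>T. \<exists>G. (t, G) \<in> \<H> \<and> E \<subseteq> G)"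
  proof (rule refine_SS)
    show "countable \<H>" unfolding \<H>_def using assms(1) D(2) by simp
    show "G \<in> \<SS>" if "(t, G) \<in> \<H>" for t G using that D(1) unfolding \<H>_def by auto
  qed
  moreover have "cover \<H> = cover \<G>"
  proof -
    have "cover (Pair (fst p) ` \<DD> p) = snd p" if "p \<in> \<G>" for p
      using D(3)[OF that] by (simp add: cover_def image_image)
    then have "(\<Union>p\<in>\<G>. cover (Pair (fst p) ` \<DD> p)) = (\<Union>p\<in>\<G>. snd p)" by (rule SUP_cong[OF refl])
    then show ?thesis unfolding \<H>_def cover_UN by (simp add: cover_def)
  qed
  moreover have sub: "\<exists>G'. (t, G') \<in> \<G> \<and> G \<subseteq> G'" if tG: "(t, G) \<in> \<H>" for t G
  proof -
    obtain p where p: "p \<in> \<G>" "t = fst p" "G \<in> \<DD> p" using tG unfolding \<H>_def by fastforce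
    then have "G \<subseteq> snd p" using D(3)[OF p(1)] by auto
    then show ?thesis using p by (metis prod.collapse)
  qed
  ultimately obtain T where T: "tagged T" "cover T = cover \<G>" "\<forall>(t, E)\<in>T. \<exists>G. (t, G) \<in> \<H> \<and> E \<subseteq> G"
    by auto
  have "\<exists>G. (t, G) \<in> \<G> \<and> E \<subseteq> G" if tE: "(t, E) \<in> T" for t E
  proof -
    obtain G where G: "(t, G) \<in> \<H>" "E \<subseteq> G" using T(3) tE by auto
    from sub[OF this(1)] show ?thesis using G(2) by (meson order_trans)
  qed
  then show ?thesis using T(1,2) by auto
qed

text \<open>Cutting along the members of \<open>\<A>\<close> one after another leaves sets of
  \<open>Sig\<close> rather than of \<open>\<SS>\<close>. The decomposition into
  \<open>\<SS>\<close> is therefore done once, at the end; it preserves adaptedness because subsets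
  of adapted sets are adapted.\<close>

lemma refine_adapted:
  assumes "finite \<A>" "\<A> \<subseteq> \<SS>" "countable \<G>" "\<And>t G. (t, G) \<in> \<G> \<Longrightarrow> G \<in> Sig"
  shows "\<exists>T. tagged T \<and> cover T = cover \<G> \<and>
    (\<forall>(t, E)\<in>T. adapted \<A> E \<and> (\<exists>G. (t, G) \<in> \<G> \<and> E \<subseteq> G))"
proof -
  have "\<exists>\<H>. countable \<H> \<and> cover \<H> = cover \<G> \<and>
    (\<forall>(t, E)\<in>\<H>. E \<in> Sig \<and> adapted \<A> E \<and> (\<exists>G. (t, G) \<in> \<G> \<and> E \<subseteq> G))"
    using assms(1,2)
  proof (induction \<A>)
    case empty
    then show ?case using assms(3,4) by (intro exI[of _ \<G>]) (auto simp: adapted_def)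
  next
    case (insert A \<A>)
    have "\<A> \<subseteq> \<SS>" using insert.prems by simp
    from insert.IH[OF this] obtain \<H> where H: "countable \<H>" "cover \<H> = cover \<G>"
      "\<forall>(t, E)\<in>\<H>. E \<in> Sig \<and> adapted \<A> E \<and> (\<exists>G. (t, G) \<in> \<G> \<and> E \<subseteq> G)"
      by (elim exE conjE)
    define \<K> where "\<K> = (\<lambda>(t, E). (t, E \<inter> A)) ` \<H> \<union> (\<lambda>(t, E). (t, E - A)) ` \<H>"
    have "countable \<K>" using H(1) by (simp add: \<K>_def)
    moreover have "cover \<K> = cover \<G>"
    proof -
      have "cover \<K> = (\<Union>p\<in>\<H>. snd p \<inter> A) \<union> (\<Union>p\<in>\<H>. snd p - A)"
        by (simp add: \<K>_def cover_def image_Un image_image case_prod_beta)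
      also have "\<dots> = (\<Union>p\<in>\<H>. snd p)" by auto
      finally show ?thesis using H(2) by (simp add: cover_def)
    qed
    moreover have "E \<in> Sig \<and> adapted (insert A \<A>) E \<and> (\<exists>G. (t, G) \<in> \<G> \<and> E \<subseteq> G)" if tE: "(t, E) \<in> \<K>" for t E
    proof -
      obtain E' where E': "(t, E') \<in> \<H>" "E = E' \<inter> A \<or> E = E' - A"
        using tE by (auto simp: \<K>_def)
      have A: "A \<in> \<SS>" using insert by auto
      have E'2: "E' \<in> Sig" "adapted \<A> E'" "\<exists>G. (t, G) \<in> \<G> \<and> E' \<subseteq> G" using H(3) E' by auto
      have "E \<in> Sig" using E'(2) E'2(1) A Sig_Int[OF _ SS_Sig] Sig_Diff_SS by auto
      moreover have "adapted (insert A \<A>) E"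
        using E'(2) E'2(2) unfolding adapted_def by blast
      moreover have "E \<subseteq> E'" using E'(2) by auto
      ultimately show ?thesis using E'2(3) by (meson order_trans)
    qed
    ultimately show ?case by (intro exI[of _ \<K>]) auto
  qed
  then obtain \<H> where H: "countable \<H>" "cover \<H> = cover \<G>"
      "\<forall>(t, E)\<in>\<H>. E \<in> Sig \<and> adapted \<A> E \<and> (\<exists>G. (t, G) \<in> \<G> \<and> E \<subseteq> G)" by (elim exE conjE)
  obtain T where T: "tagged T" "cover T = cover \<H>" "\<forall>(t, E)\<in>T. \<exists>G. (t, G) \<in> \<H> \<and> E \<subseteq> G"
    using refine_Sig[OF H(1)] H(3) by auto
  have "adapted \<A> E \<and> (\<exists>G. (t, G) \<in> \<G> \<and> E \<subseteq> G)" if tE: "(t, E) \<in> T" for t E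
  proof -
    obtain G where G: "(t, G) \<in> \<H>" "E \<subseteq> G" using T(3) tE by auto
    then have "adapted \<A> G" "\<exists>G'. (t, G') \<in> \<G> \<and> G \<subseteq> G'" using H(3) by auto
    moreover from this(1) have "adapted \<A> E" using G(2) unfolding adapted_def by fast
    ultimately show ?thesis using G(2) by (meson order_trans)
  qed
  then show ?thesis using T H(2) by auto
qed

lemma adapted_partition:
  assumes "finite \<A>" "\<A> \<subseteq> \<SS>" "B \<in> Sig"
  obtains T :: "(unit \<times> 'x set) set" where "tagged T" "cover T = B"
    "\<And>t P. (t, P) \<in> T \<Longrightarrow> adapted \<A> P"
proof -
  have "\<exists>T::(unit \<times> 'x set) set. tagged T \<and> cover T = cover {((), B)} \<and>
      (\<forall>(t, P)\<in>T. adapted \<A> P \<and> (\<exists>G. (t, G) \<in> {((), B)} \<and> P \<subseteq> G))"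
    by (rule refine_adapted[OF assms(1,2)]) (use assms(3) in auto)
  then obtain T :: "(unit \<times> 'x set) set" where T: "tagged T" "cover T = cover {((), B)}"
    "\<forall>(t, P)\<in>T. adapted \<A> P \<and> (\<exists>G. (t, G) \<in> {((), B)} \<and> P \<subseteq> G)" by (elim exE conjE)
  show ?thesis by (rule that[OF T(1)]) (use T(2,3) in \<open>auto simp: cover_def\<close>)
qed

section \<open>Gauges and fine families\<close>

definition is_gauge :: "'x set \<Rightarrow> ('x \<Rightarrow> 'x set) \<Rightarrow> bool" where
  "is_gauge B h \<longleftrightarrow> countable (h ` B) \<and> (\<forall>x\<in>B. x \<in> h x \<and> h x \<in> \<SS> \<and> h x \<subseteq> B)"

text \<open>A tag need not lie in its set, as usual for McShane-type integrals. Covering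
  \<open>B\<close> is not demanded, so the finite parts of a division over which sums are formed are
  fine families too.\<close>

definition is_fine :: "'x set \<Rightarrow> ('x \<Rightarrow> 'x set) \<Rightarrow> ('x \<times> 'x set) set \<Rightarrow> bool" where
  "is_fine B h T \<longleftrightarrow> tagged T \<and> (\<forall>(x, E)\<in>T. x \<in> B \<and> E \<subseteq> h x)"

lemma gaugeD:
  assumes "is_gauge B h" "x \<in> B"
  shows "x \<in> h x" "h x \<in> \<SS>" "h x \<subseteq> B"
  using assms by (auto simp: is_gauge_def)

lemma gauge_countable: "is_gauge B h \<Longrightarrow> countable (h ` B)"
  by (simp add: is_gauge_def)

lemma gauge_Sig: "is_gauge B h \<Longrightarrow> B \<in> Sig"
proof -
  assume g: "is_gauge B h"
  have "\<Union>(h ` B) \<in> Sig" by (rule in_SigI) (use g in \<open>auto simp: is_gauge_def\<close>)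
  moreover have "\<Union>(h ` B) = B" using g by (auto simp: is_gauge_def)
  ultimately show ?thesis by simp
qed

lemma fine_tagged: "is_fine B h T \<Longrightarrow> tagged T"
  by (simp add: is_fine_def)

lemma fineD:
  assumes "is_fine B h T" "(x, E) \<in> T"
  shows "x \<in> B" "E \<subseteq> h x"
  using assms by (auto simp: is_fine_def)

lemma fine_subset: "is_fine B h T \<Longrightarrow> S \<subseteq> T \<Longrightarrow> is_fine B h S"
  unfolding is_fine_def using tagged_subset by blast

lemma fine_Un: "is_fine B h S \<Longrightarrow> is_fine B h T \<Longrightarrow> cover S \<inter> cover T = {} \<Longrightarrow> is_fine B h (S \<union> T)"
  unfolding is_fine_def using tagged_Un by blast

lemma fine_mono:
  assumes "is_fine C k T" "C \<subseteq> B" "\<And>x. x \<in> C \<Longrightarrow> k x \<subseteq> h x"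
  shows "is_fine B h T"
  using assms unfolding is_fine_def by blast

lemma fine_cover_subset: "is_gauge B h \<Longrightarrow> is_fine B h T \<Longrightarrow> cover T \<subseteq> B"
  unfolding is_fine_def is_gauge_def cover_def by fastforce

lemma fine_UN:
  assumes "countable I" "\<And>i. i \<in> I \<Longrightarrow> is_fine B h (T i)"
    and "\<And>i j. i \<in> I \<Longrightarrow> j \<in> I \<Longrightarrow> i \<noteq> j \<Longrightarrow> cover (T i) \<inter> cover (T j) = {}"
  shows "is_fine B h (\<Union>i\<in>I. T i)"
  using tagged_UN[of I T] assms unfolding is_fine_def by blast

text \<open>The function \<open>g\<close> takes values in \<open>Sig\<close>, for instance
  intersections of gauge sets. The decomposition into members of \<open>\<SS>\<close> is chosen for
  the value \<open>g x\<close> and not for the point \<open>x\<close>, so countably many values of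
  \<open>g\<close> lead to countably many values of \<open>h\<close>.\<close>

lemma gauge_refine:
  assumes "B \<in> Sig" "countable (g ` B)" "\<And>x. x \<in> B \<Longrightarrow> x \<in> g x \<and> g x \<in> Sig"
  shows "\<exists>h. is_gauge B h \<and> (\<forall>x\<in>B. h x \<subseteq> g x)"
proof -
  have "\<forall>G\<in>g ` B. \<exists>\<DD>. \<DD> \<subseteq> \<SS> \<and> countable \<DD> \<and> G \<inter> B = \<Union>\<DD>"
  proof
    fix G assume "G \<in> g ` B"
    then have "G \<inter> B \<in> Sig" using assms(1,3) Sig_Int by auto
    then show "\<exists>\<DD>. \<DD> \<subseteq> \<SS> \<and> countable \<DD> \<and> G \<inter> B = \<Union>\<DD>" by (rule in_SigE) blast
  qed
  from bchoice[OF this] obtain \<DD> where "\<forall>G\<in>g ` B. \<DD> G \<subseteq> \<SS> \<and> countable (\<DD> G) \<and> G \<inter> B = \<Union>(\<DD> G)" ..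
  then have D: "\<DD> (g x) \<subseteq> \<SS>" "countable (\<DD> (g x))" "g x \<inter> B = \<Union>(\<DD> (g x))" if "x \<in> B" for x
    using that by auto
  have "\<forall>x\<in>B. \<exists>E. E \<in> \<DD> (g x) \<and> x \<in> E"
    using D(3) assms(3) by blast
  from bchoice[OF this] obtain h where "\<forall>x\<in>B. h x \<in> \<DD> (g x) \<and> x \<in> h x" ..
  then have h: "h x \<in> \<DD> (g x)" "x \<in> h x" if "x \<in> B" for x using that by auto
  have "countable (h ` B)"
  proof (rule countable_subset)
    show "h ` B \<subseteq> (\<Union>G\<in>g ` B. \<DD> G)" using h by blast
    show "countable (\<Union>G\<in>g ` B. \<DD> G)" using assms(2) D(2) by (intro countable_UN) auto
  qed
  moreover have "x \<in> h x \<and> h x \<in> \<SS> \<and> h x \<subseteq> B \<and> h x \<subseteq> g x" if "x \<in> B" for x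
    using h[OF that] D(1,3)[OF that] by blast
  ultimately show ?thesis unfolding is_gauge_def by auto
qed

lemma gauge_exists:
  assumes "B \<in> Sig"
  shows "\<exists>h. is_gauge B h"
proof -
  have "countable ((\<lambda>_. B) ` B)" by (rule countable_subset[of _ "{B}"]) auto
  then show ?thesis using gauge_refine[of B "\<lambda>_. B"] assms by auto
qed

lemma gauge_Int:
  assumes "is_gauge B h" "is_gauge C k"
  shows "\<exists>l. is_gauge (B \<inter> C) l \<and> (\<forall>x\<in>B \<inter> C. l x \<subseteq> h x \<and> l x \<subseteq> k x)"
proof -
  have "\<exists>l. is_gauge (B \<inter> C) l \<and> (\<forall>x\<in>B \<inter> C. l x \<subseteq> h x \<inter> k x)"
  proof (rule gauge_refine)
    show "B \<inter> C \<in> Sig" using Sig_Int gauge_Sig assms by blast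
    have "(\<lambda>x. h x \<inter> k x) ` (B \<inter> C) \<subseteq> (\<lambda>(a, b). a \<inter> b) ` (h ` B \<times> k ` C)" by force
    moreover have "countable ((\<lambda>(a, b). a \<inter> b) ` (h ` B \<times> k ` C))"
      using assms gauge_countable by blast
    ultimately show "countable ((\<lambda>x. h x \<inter> k x) ` (B \<inter> C))" by (rule countable_subset)
    show "x \<in> h x \<inter> k x \<and> h x \<inter> k x \<in> Sig" if "x \<in> B \<inter> C" for x
      using that gaugeD(1,2)[OF assms(1), of x] gaugeD(1,2)[OF assms(2), of x] Sig_Int[of "h x" "k x"] SS_Sig by simp
  qed
  then show ?thesis by auto
qed

text \<open>One tag per value of \<open>h\<close> suffices: the sets \<open>h x \<inter> R\<close>
  with these tags form a countable family with union \<open>R\<close>, and refinement makes it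
  disjoint. The typical \<open>R\<close> is what a finite fine family leaves uncovered.\<close>

lemma fine_exists:
  assumes "is_gauge B h" "R \<in> Sig" "R \<subseteq> B"
  shows "\<exists>T. is_fine B h T \<and> cover T = R"
proof -
  have "\<forall>G\<in>h ` B. \<exists>x. x \<in> B \<and> h x = G" by auto
  from bchoice[OF this] obtain t where t: "\<forall>G\<in>h ` B. t G \<in> B \<and> h (t G) = G" ..
  define \<G> where "\<G> = (\<lambda>G. (t G, G \<inter> R)) ` (h ` B)"
  have "\<exists>T. tagged T \<and> cover T = cover \<G> \<and> (\<forall>(t, E)\<in>T. \<exists>G. (t, G) \<in> \<G> \<and> E \<subseteq> G)"
  proof (rule refine_Sig)
    show "countable \<G>" unfolding \<G>_def using gauge_countable[OF assms(1)] by blast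
    show "G \<in> Sig" if "(x, G) \<in> \<G>" for x G
      using that assms Sig_Int SS_Sig gaugeD(2) unfolding \<G>_def by fastforce
  qed
  then obtain T where T: "tagged T" "cover T = cover \<G>" "\<forall>(t, E)\<in>T. \<exists>G. (t, G) \<in> \<G> \<and> E \<subseteq> G"
    by blast
  have "cover \<G> = R"
    using assms unfolding cover_def \<G>_def image_image is_gauge_def by fastforce
  moreover have "is_fine B h T"
    unfolding is_fine_def
  proof (intro conjI T(1), clarify)
    fix x E assume "(x, E) \<in> T"
    then obtain G where "G \<in> h ` B" "x = t G" "E \<subseteq> G \<inter> R" using T(3) unfolding \<G>_def by fastforce
    then show "x \<in> B \<and> E \<subseteq> h x" using t by blast
  qed
  ultimately show ?thesis using T(2) by blast
qed

end

section \<open>Sums along the fine divisions of a good gauge\<close>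

definition sdiff :: "'z::ab_group_add set \<Rightarrow> 'z set \<Rightarrow> 'z set" where
  "sdiff G H = {g - h |g h. g \<in> G \<and> h \<in> H}"

lemma sdiffI: "g \<in> G \<Longrightarrow> h \<in> H \<Longrightarrow> g - h \<in> sdiff G H"
  by (auto simp: sdiff_def)

lemma sdiffE:
  assumes "x \<in> sdiff G H"
  obtains g h where "g \<in> G" "h \<in> H" "x = g - h"
  using assms by (auto simp: sdiff_def)

locale valued_intervals = intervals X \<SS> for X :: "'x set" and \<SS> +
  fixes \<phi> :: "'x \<Rightarrow> 'x set \<Rightarrow> 'z::ab_group_add"
begin

definition val :: "('x \<times> 'x set) set \<Rightarrow> 'z" where
  "val T = (\<Sum>(x, E)\<in>T. \<phi> x E)"

lemma val_Un: "finite S \<Longrightarrow> finite T \<Longrightarrow> S \<inter> T = {} \<Longrightarrow> val (S \<union> T) = val S + val T"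
  unfolding val_def by (rule sum.union_disjoint)

definition good :: "'x set \<Rightarrow> ('x \<Rightarrow> 'x set) \<Rightarrow> 'z set \<Rightarrow> bool" where
  "good B h G \<longleftrightarrow> is_gauge B h \<and>
    (\<forall>T. is_fine B h T \<and> cover T = B \<longrightarrow>
      (\<exists>\<Xi>. finite \<Xi> \<and> \<Xi> \<subseteq> T \<and> (\<forall>\<Omega>. finite \<Omega> \<and> \<Xi> \<subseteq> \<Omega> \<and> \<Omega> \<subseteq> T \<longrightarrow> val \<Omega> \<in> G)))"

lemma good_gauge: "good B h G \<Longrightarrow> is_gauge B h"
  by (simp add: good_def)

lemma goodE:
  assumes "good B h G" "is_fine B h T" "cover T = B"
  obtains \<Xi> where "finite \<Xi>" "\<Xi> \<subseteq> T"
    "\<And>\<Omega>. finite \<Omega> \<Longrightarrow> \<Xi> \<subseteq> \<Omega> \<Longrightarrow> \<Omega> \<subseteq> T \<Longrightarrow> val \<Omega> \<in> G"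
proof -
  have "\<exists>\<Xi>. finite \<Xi> \<and> \<Xi> \<subseteq> T \<and> (\<forall>\<Omega>. finite \<Omega> \<and> \<Xi> \<subseteq> \<Omega> \<and> \<Omega> \<subseteq> T \<longrightarrow> val \<Omega> \<in> G)"
    using assms by (simp add: good_def)
  then show ?thesis using that by metis
qed

lemma goodI:
  assumes "is_gauge B h"
    and "\<And>T. is_fine B h T \<Longrightarrow> cover T = B \<Longrightarrow>
      \<exists>\<Xi>. finite \<Xi> \<and> \<Xi> \<subseteq> T \<and> (\<forall>\<Omega>. finite \<Omega> \<longrightarrow> \<Xi> \<subseteq> \<Omega> \<longrightarrow> \<Omega> \<subseteq> T \<longrightarrow> val \<Omega> \<in> G)"
  shows "good B h G"
  unfolding good_def
proof (intro conjI allI impI)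
  fix T assume "is_fine B h T \<and> cover T = B"
  from assms(2)[OF conjunct1[OF this] conjunct2[OF this]]
  show "\<exists>\<Xi>. finite \<Xi> \<and> \<Xi> \<subseteq> T \<and> (\<forall>\<Omega>. finite \<Omega> \<and> \<Xi> \<subseteq> \<Omega> \<and> \<Omega> \<subseteq> T \<longrightarrow> val \<Omega> \<in> G)"
    by (simp only: imp_conjL)
qed (rule assms(1))

lemma good_mono:
  assumes "good B h G" "G \<subseteq> H"
  shows "good B h H"
proof (rule goodI)
  show "is_gauge B h" using assms(1) by (rule good_gauge)
  fix T assume T: "is_fine B h T" "cover T = B"
  from goodE[OF assms(1) T] obtain \<Xi> where "finite \<Xi>" "\<Xi> \<subseteq> T"
    "\<And>\<Omega>. finite \<Omega> \<Longrightarrow> \<Xi> \<subseteq> \<Omega> \<Longrightarrow> \<Omega> \<subseteq> T \<Longrightarrow> val \<Omega> \<in> G" by metis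
  then show "\<exists>\<Xi>. finite \<Xi> \<and> \<Xi> \<subseteq> T \<and> (\<forall>\<Omega>. finite \<Omega> \<longrightarrow> \<Xi> \<subseteq> \<Omega> \<longrightarrow> \<Omega> \<subseteq> T \<longrightarrow> val \<Omega> \<in> H)"
    using assms(2) by (intro exI[of _ \<Xi>]) auto
qed

text \<open>Both families are completed by the same fine family \<open>Q\<close> on the rest of
  \<open>B\<close>; its contribution cancels when the two sums in \<open>G\<close> are subtracted.
  Of \<open>P\<close>, which may be infinite, only large finite parts are compared.\<close>

lemma good_swap:
  assumes "good B h G" "is_fine B h \<Omega>" "finite \<Omega>" "is_fine B h P" "cover P = cover \<Omega>"
  obtains P0 where "finite P0" "P0 \<subseteq> P"
    "\<And>P'. finite P' \<Longrightarrow> P0 \<subseteq> P' \<Longrightarrow> P' \<subseteq> P \<Longrightarrow> val P' - val \<Omega> \<in> sdiff G G"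
proof -
  have g: "is_gauge B h" using assms(1) by (rule good_gauge)
  have "B - cover \<Omega> \<in> Sig"
    using Sig_Diff_Sig0[OF gauge_Sig[OF g] cover_Sig0[OF fine_tagged[OF assms(2)] assms(3)]] .
  from fine_exists[OF g this] obtain Q where Q: "is_fine B h Q" "cover Q = B - cover \<Omega>" by auto
  have sub: "cover \<Omega> \<subseteq> B" using fine_cover_subset[OF g assms(2)] .
  have O: "is_fine B h (\<Omega> \<union> Q)" "cover (\<Omega> \<union> Q) = B" "\<Omega> \<inter> Q = {}"
    using fine_Un[OF assms(2) Q(1)] cover_disjoint_imp[OF fine_tagged[OF assms(2)], of Q] Q(2) sub
    by auto
  have P: "is_fine B h (P \<union> Q)" "cover (P \<union> Q) = B" "P \<inter> Q = {}"
    using fine_Un[OF assms(4) Q(1)] cover_disjoint_imp[OF fine_tagged[OF assms(4)], of Q] Q(2) sub assms(5)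
    by auto
  obtain \<Xi> where X: "finite \<Xi>" "\<Xi> \<subseteq> \<Omega> \<union> Q"
    "\<And>\<Omega>'. finite \<Omega>' \<Longrightarrow> \<Xi> \<subseteq> \<Omega>' \<Longrightarrow> \<Omega>' \<subseteq> \<Omega> \<union> Q \<Longrightarrow> val \<Omega>' \<in> G"
    using goodE[OF assms(1) O(1,2)] by metis
  obtain \<Upsilon> where Y: "finite \<Upsilon>" "\<Upsilon> \<subseteq> P \<union> Q"
    "\<And>\<Omega>'. finite \<Omega>' \<Longrightarrow> \<Upsilon> \<subseteq> \<Omega>' \<Longrightarrow> \<Omega>' \<subseteq> P \<union> Q \<Longrightarrow> val \<Omega>' \<in> G"
    using goodE[OF assms(1) P(1,2)] by metis
  \<comment> \<open>The part of \<open>Q\<close> that either of the two divisions demands, used on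
    both sides so that it cancels.\<close>
  define Q' where "Q' = Q \<inter> (\<Xi> \<union> \<Upsilon>)"
  have Q': "finite Q'" "Q' \<subseteq> Q" using X Y by (auto simp: Q'_def)
  show ?thesis
  proof (rule that)
    show "finite (\<Upsilon> \<inter> P)" "\<Upsilon> \<inter> P \<subseteq> P" using Y by auto
    fix P' assume P': "finite P'" "\<Upsilon> \<inter> P \<subseteq> P'" "P' \<subseteq> P"
    have "val (\<Omega> \<union> Q') \<in> G"
      by (rule X(3)) (use X Q' assms(3) in \<open>auto simp: Q'_def\<close>)
    moreover have "val (P' \<union> Q') \<in> G"
      by (rule Y(3)) (use Y Q' P' in \<open>auto simp: Q'_def\<close>)
    moreover have "val (\<Omega> \<union> Q') = val \<Omega> + val Q'"
      by (rule val_Un) (use O(3) Q' assms(3) in auto)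
    moreover have "val (P' \<union> Q') = val P' + val Q'"
      by (rule val_Un) (use P(3) P' Q' in auto)
    moreover have "val P' - val \<Omega> = (val P' + val Q') - (val \<Omega> + val Q')" by simp
    ultimately show "val P' - val \<Omega> \<in> sdiff G G" using sdiffI by metis
  qed
qed

text \<open>The families with large sums have to fit into one division whose remainder is again a
  countable union of members of \<open>\<SS>\<close>. To this end \<open>h' x\<close> is kept inside
  the member of \<open>D\<close> that contains \<open>x\<close>. A finite fine family then meets
  only finitely many members of \<open>D\<close>, and these are put aside before the next family is
  chosen.\<close>

lemma good_small_off:
  assumes "good B h G" "is_fine B h D" "cover D = B"
  obtains h' \<Xi> where "is_gauge B h'" "\<And>x. x \<in> B \<Longrightarrow> h' x \<subseteq> h x"
    "finite \<Xi>" "\<Xi> \<subseteq> D" "val \<Xi> \<in> G"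
    "\<And>\<Omega>. finite \<Omega> \<Longrightarrow> is_fine B h' \<Omega> \<Longrightarrow> cover \<Omega> \<inter> cover \<Xi> = {} \<Longrightarrow> val \<Omega> \<in> sdiff G G"
proof -
  have g: "is_gauge B h" using assms(1) by (rule good_gauge)
  have D: "tagged D" using assms(2) by (rule fine_tagged)
  have "\<forall>x\<in>B. \<exists>q. q \<in> D \<and> x \<in> snd q" using assms(3) unfolding cover_def by force
  from bchoice[OF this] obtain d where "\<forall>x\<in>B. d x \<in> D \<and> x \<in> snd (d x)" ..
  then have d: "d x \<in> D" "x \<in> snd (d x)" if "x \<in> B" for x using that by auto
  have dS: "snd (d x) \<in> \<SS>" if "x \<in> B" for x using tagged_snd_SS[OF D] d(1)[OF that] by auto
  have "\<exists>h'. is_gauge B h' \<and> (\<forall>x\<in>B. h' x \<subseteq> h x \<inter> snd (d x))"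
  proof (rule gauge_refine)
    show "B \<in> Sig" using g by (rule gauge_Sig)
    have "(\<lambda>x. h x \<inter> snd (d x)) ` B \<subseteq> (\<lambda>(a, b). a \<inter> b) ` (h ` B \<times> snd ` D)"
      using d(1) by force
    moreover have "countable ((\<lambda>(a, b). a \<inter> b) ` (h ` B \<times> snd ` D))"
      using gauge_countable[OF g] tagged_countable[OF D] by simp
    ultimately show "countable ((\<lambda>x. h x \<inter> snd (d x)) ` B)" by (rule countable_subset)
    show "x \<in> h x \<inter> snd (d x) \<and> h x \<inter> snd (d x) \<in> Sig" if x: "x \<in> B" for x
      using gaugeD[OF g x] d(2)[OF x] Sig_Int[OF SS_Sig SS_Sig[OF dS[OF x]]] by simp
  qed
  then obtain h' where h': "is_gauge B h'" "\<And>x. x \<in> B \<Longrightarrow> h' x \<subseteq> h x" "\<And>x. x \<in> B \<Longrightarrow> h' x \<subseteq> snd (d x)"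
    by auto
  obtain \<Xi>0 where X0: "finite \<Xi>0" "\<Xi>0 \<subseteq> D"
    "\<And>\<Omega>. finite \<Omega> \<Longrightarrow> \<Xi>0 \<subseteq> \<Omega> \<Longrightarrow> \<Omega> \<subseteq> D \<Longrightarrow> val \<Omega> \<in> G"
    using goodE[OF assms] by metis
  have "\<exists>\<Xi>. finite \<Xi> \<and> \<Xi>0 \<subseteq> \<Xi> \<and> \<Xi> \<subseteq> D \<and>
    (\<forall>\<Omega>. finite \<Omega> \<longrightarrow> is_fine B h' \<Omega> \<longrightarrow> cover \<Omega> \<inter> cover \<Xi> = {} \<longrightarrow> val \<Omega> \<in> sdiff G G)"
  proof (rule ccontr)
    assume neg: "\<not> ?thesis"
    have "\<forall>\<Xi>. \<exists>\<Omega>. finite \<Xi> \<and> \<Xi>0 \<subseteq> \<Xi> \<and> \<Xi> \<subseteq> D \<longrightarrow>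
       finite \<Omega> \<and> is_fine B h' \<Omega> \<and> cover \<Omega> \<inter> cover \<Xi> = {} \<and> val \<Omega> \<notin> sdiff G G"
      using neg by metis
    from choice[OF this] obtain om where "\<forall>\<Xi>. finite \<Xi> \<and> \<Xi>0 \<subseteq> \<Xi> \<and> \<Xi> \<subseteq> D \<longrightarrow>
       finite (om \<Xi>) \<and> is_fine B h' (om \<Xi>) \<and> cover (om \<Xi>) \<inter> cover \<Xi> = {} \<and> val (om \<Xi>) \<notin> sdiff G G" ..
    then have om: "finite (om \<Xi>)" "is_fine B h' (om \<Xi>)" "cover (om \<Xi>) \<inter> cover \<Xi> = {}" "val (om \<Xi>) \<notin> sdiff G G"
      if "finite \<Xi>" "\<Xi>0 \<subseteq> \<Xi>" "\<Xi> \<subseteq> D" for \<Xi> using that by auto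
    define nx where "nx \<Xi> = \<Xi> \<union> {p \<in> D. snd p \<inter> cover (om \<Xi>) \<noteq> {}}" for \<Xi>
    define \<Theta> where "\<Theta> = rec_nat \<Xi>0 (\<lambda>_. nx)"
    have T0: "\<Theta> 0 = \<Xi>0" and TS: "\<Theta> (Suc n) = nx (\<Theta> n)" for n by (simp_all add: \<Theta>_def)
    have hit: "finite {p \<in> D. snd p \<inter> cover \<Omega> \<noteq> {}}" if fin: "finite \<Omega>" and fi: "is_fine B h' \<Omega>" for \<Omega>
    proof (rule finite_subset)
      show "finite ((\<lambda>(x, E). d x) ` \<Omega>)" using fin by simp
      show "{p \<in> D. snd p \<inter> cover \<Omega> \<noteq> {}} \<subseteq> (\<lambda>(x, E). d x) ` \<Omega>"
      proof
        fix p assume "p \<in> {p \<in> D. snd p \<inter> cover \<Omega> \<noteq> {}}"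
        then obtain z where z: "p \<in> D" "z \<in> snd p" "z \<in> cover \<Omega>" by auto
        from z(3) obtain x E where xE: "(x, E) \<in> \<Omega>" "z \<in> E" by (rule in_coverE)
        have x: "x \<in> B" "z \<in> h' x" using fineD[OF fi xE(1)] xE(2) by auto
        then have "z \<in> snd (d x)" using h'(3) by auto
        then have "p = d x" using tagged_disjoint[OF D z(1) d(1)[OF x(1)]] z(2) by auto
        then show "p \<in> (\<lambda>(x, E). d x) ` \<Omega>" using xE(1) by force
      qed
    qed
    have Th: "finite (\<Theta> n) \<and> \<Xi>0 \<subseteq> \<Theta> n \<and> \<Theta> n \<subseteq> D" for n
    proof (induction n)
      case 0
      then show ?case using X0 T0 by simp
    next
      case (Suc n)
      then show ?case using hit[OF om(1,2)] by (auto simp: TS nx_def)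
    qed
    define U where "U n = om (\<Theta> n)" for n
    have U: "finite (U n)" "is_fine B h' (U n)" "cover (U n) \<inter> cover (\<Theta> n) = {}" "val (U n) \<notin> sdiff G G" for n
      using om Th unfolding U_def by simp_all
    have Uh: "is_fine B h (U n)" for n using fine_mono[OF U(2) subset_refl] h'(2) by simp
    have UB: "cover (U n) \<subseteq> B" for n using fine_cover_subset[OF h'(1) U(2)] .
    have UT: "cover (U n) \<subseteq> cover (\<Theta> (Suc n))" for n
    proof
      fix z assume z: "z \<in> cover (U n)"
      then have "z \<in> B" using UB by auto
      then have "d z \<in> {p \<in> D. snd p \<inter> cover (U n) \<noteq> {}}" using d z by auto
      then have "d z \<in> \<Theta> (Suc n)" by (simp add: TS nx_def U_def)
      then show "z \<in> cover (\<Theta> (Suc n))" using d(2)[OF \<open>z \<in> B\<close>] unfolding cover_def by auto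
    qed
    have Tmono: "\<Theta> m \<subseteq> \<Theta> n" if "m \<le> n" for m n
      using that by (rule lift_Suc_mono_le[rotated]) (auto simp: TS nx_def)
    have Ud: "cover (U m) \<inter> cover (U n) = {}" if "m < n" for m n
    proof -
      have "cover (U m) \<subseteq> cover (\<Theta> n)"
        using UT[of m] cover_mono[OF Tmono[of "Suc m" n]] that by auto
      then show ?thesis using U(3)[of n] by auto
    qed
    have Ud': "cover (U m) \<inter> cover (U n) = {}" if "m \<noteq> n" for m n
      using Ud[of m n] Ud[of n m] that by (cases "m < n") auto
    define V where "V = (\<Union>n. cover (U n))"
    \<comment> \<open>Once \<open>q\<close> has been put aside, no later family meets it; if it is
      never put aside, no family meets it at all. In either case only finitely many sets are removed
      from \<open>snd q\<close>.\<close>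
    have rest: "snd q - V \<in> Sig" if q: "q \<in> D" for q
    proof -
      have "\<exists>N. \<forall>n\<ge>N. snd q \<inter> cover (U n) = {}"
      proof (cases "\<exists>N. q \<in> \<Theta> N")
        case True
        then obtain N where N: "q \<in> \<Theta> N" ..
        have "snd q \<inter> cover (U n) = {}" if "N \<le> n" for n
        proof -
          have "q \<in> \<Theta> n" using N Tmono[OF that] by auto
          then have "snd q \<subseteq> cover (\<Theta> n)" unfolding cover_def by auto
          then show ?thesis using U(3)[of n] by auto
        qed
        then show ?thesis by auto
      next
        case False
        have "snd q \<inter> cover (U n) = {}" for n
        proof (rule ccontr)
          assume "snd q \<inter> cover (U n) \<noteq> {}"
          then have "q \<in> \<Theta> (Suc n)" using q by (simp add: TS nx_def U_def)
          then show False using False by auto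
        qed
        then show ?thesis by auto
      qed
      then obtain N where N: "\<And>n. n \<ge> N \<Longrightarrow> snd q \<inter> cover (U n) = {}" by auto
      define \<F> where "\<F> = (\<Union>n<N. snd ` U n)"
      have F: "finite \<F>" "\<F> \<subseteq> \<SS>" using U(1) tagged_snd_SS[OF fine_tagged[OF U(2)]] by (auto simp: \<F>_def)
      have "snd q - V = snd q - \<Union>\<F>"
      proof -
        have "\<Union>\<F> = (\<Union>n<N. cover (U n))" by (auto simp: \<F>_def cover_def)
        moreover have "snd q \<inter> V \<subseteq> (\<Union>n<N. cover (U n))"
          unfolding V_def Int_UN_distrib
        proof (rule UN_least)
          fix n
          show "snd q \<inter> cover (U n) \<subseteq> (\<Union>n<N. cover (U n))"
            using N[of n] by (cases "n < N") auto
        qed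
        moreover have "(\<Union>n<N. cover (U n)) \<subseteq> V" by (auto simp: V_def)
        ultimately show ?thesis by auto
      qed
      moreover have "snd q \<in> Sig" using SS_Sig tagged_snd_SS[OF D] q by auto
      ultimately show ?thesis using Sig_Diff_finite[OF F(1) _ F(2)] by simp
    qed
    \<comment> \<open>What the families leave of a member of \<open>D\<close> keeps the tag of that
      member and hence stays fine for \<open>h\<close>.\<close>
    define \<G> where "\<G> = (\<lambda>q. (fst q, snd q - V)) ` D"
    have "\<exists>T. tagged T \<and> cover T = cover \<G> \<and> (\<forall>(t, E)\<in>T. \<exists>G. (t, G) \<in> \<G> \<and> E \<subseteq> G)"
    proof (rule refine_Sig)
      show "countable \<G>" using tagged_countable[OF D] by (simp add: \<G>_def)
      show "G \<in> Sig" if tG: "(t, G) \<in> \<G>" for t G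
        using tG rest unfolding \<G>_def by auto
    qed
    then obtain Q where Q: "tagged Q" "cover Q = cover \<G>" "\<forall>(t, E)\<in>Q. \<exists>G. (t, G) \<in> \<G> \<and> E \<subseteq> G"
      by (elim exE conjE)
    have "cover \<G> = cover D - V" by (auto simp: cover_def \<G>_def)
    with Q(2) assms(3) have Qc: "cover Q = B - V" by simp
    have Qf: "is_fine B h Q" unfolding is_fine_def
    proof (intro conjI Q(1), clarify)
      fix x E assume "(x, E) \<in> Q"
      then obtain G where G: "(x, G) \<in> \<G>" "E \<subseteq> G" using Q(3) by auto
      then obtain F where F: "(x, F) \<in> D" "G \<subseteq> F" unfolding \<G>_def by auto
      then show "x \<in> B \<and> E \<subseteq> h x" using fineD[OF assms(2) F(1)] G(2) by auto
    qed
    have Uf: "is_fine B h (\<Union>n. U n)" by (rule fine_UN) (use Uh Ud' in auto)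
    have Tf: "is_fine B h ((\<Union>n. U n) \<union> Q)"
      by (rule fine_Un[OF Uf Qf]) (auto simp: cover_UN Qc V_def)
    have "cover ((\<Union>n. U n) \<union> Q) = B"
      using UB by (auto simp: cover_UN Qc V_def)
    from goodE[OF assms(1) Tf this] obtain Y where Y: "finite Y" "Y \<subseteq> (\<Union>n. U n) \<union> Q"
      "\<And>\<Omega>. finite \<Omega> \<Longrightarrow> Y \<subseteq> \<Omega> \<Longrightarrow> \<Omega> \<subseteq> (\<Union>n. U n) \<union> Q \<Longrightarrow> val \<Omega> \<in> G" by metis
    have "finite {n. U n \<inter> Y \<noteq> {}}"
    proof -
      have "{n. U n \<inter> Y \<noteq> {}} = (\<Union>y\<in>Y. {n. y \<in> U n})" by auto
      moreover have "finite {n. y \<in> U n}" for y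
      proof (cases "\<exists>m. y \<in> U m")
        case True
        then obtain m where m: "y \<in> U m" ..
        have "n = m" if n: "y \<in> U n" for n
        proof (rule ccontr)
          assume "n \<noteq> m"
          from cover_disjoint_imp[OF fine_tagged[OF U(2)] Ud'[OF this]] show False using m n by auto
        qed
        then have "{n. y \<in> U n} \<subseteq> {m}" by auto
        then show ?thesis by (rule finite_subset) simp
      qed simp
      ultimately show ?thesis using Y(1) by simp
    qed
    \<comment> \<open>A family disjoint from \<open>Y\<close> may be added to \<open>Y\<close>
      without leaving \<open>G\<close>, so its sum is a difference of two elements of
      \<open>G\<close>, against its choice.\<close>
    then obtain N where N: "N \<notin> {n. U n \<inter> Y \<noteq> {}}"
      using ex_new_if_finite[OF infinite_UNIV_nat] by metis
    have "val (Y \<union> U N) \<in> G" "val Y \<in> G"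
      by (rule Y(3); use Y U(1) in auto)+
    moreover have "val (Y \<union> U N) = val Y + val (U N)"
      by (rule val_Un) (use Y(1) U(1) N in auto)
    ultimately have "val (U N) \<in> sdiff G G" using sdiffI by (metis add_diff_cancel_left')
    then show False using U(4) by simp
  qed
  then obtain \<Xi> where X: "finite \<Xi>" "\<Xi>0 \<subseteq> \<Xi>" "\<Xi> \<subseteq> D"
    "\<And>\<Omega>. finite \<Omega> \<Longrightarrow> is_fine B h' \<Omega> \<Longrightarrow> cover \<Omega> \<inter> cover \<Xi> = {} \<Longrightarrow> val \<Omega> \<in> sdiff G G" by auto
  show ?thesis by (rule that[OF h'(1,2) X(1,3) X0(3)[OF X(1-3)] X(4)])
qed

text \<open>A division of \<open>B\<close> is completed by a fine family on \<open>A - B\<close>;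
  this family stays off \<open>\<Xi>\<close>, so its finite sums are small and can be subtracted
  again. \<open>\<Xi>\<close> is fixed before \<open>B\<close>, \<open>h1\<close> and
  \<open>G\<close>, and \<open>B\<close> may exceed \<open>A\<close>: one finite family thus serves
  all larger finite unions.\<close>

lemma good_restrict:
  assumes "good A h0 G0" "is_fine A h0 D" "cover D = A"
  obtains \<Xi> where "finite \<Xi>" "\<Xi> \<subseteq> D"
    "\<And>B h1 G. B \<in> Sig0 \<Longrightarrow> cover \<Xi> \<subseteq> B \<Longrightarrow> good (A \<union> B) h1 G \<Longrightarrow> \<exists>h2. good B h2 (sdiff G (sdiff G0 G0))"
proof -
  obtain h' \<Xi> where h': "is_gauge A h'" "\<And>x. x \<in> A \<Longrightarrow> h' x \<subseteq> h0 x"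
    and X: "finite \<Xi>" "\<Xi> \<subseteq> D" "val \<Xi> \<in> G0"
    and off: "\<And>\<Omega>. finite \<Omega> \<Longrightarrow> is_fine A h' \<Omega> \<Longrightarrow> cover \<Omega> \<inter> cover \<Xi> = {} \<Longrightarrow> val \<Omega> \<in> sdiff G0 G0"
    using good_small_off[OF assms] by metis
  show ?thesis
  proof (rule that[OF X(1,2)])
    fix B h1 G
    assume B: "B \<in> Sig0" "cover \<Xi> \<subseteq> B" and g: "good (A \<union> B) h1 G"
    have g1: "is_gauge (A \<union> B) h1" using g by (rule good_gauge)
    obtain hb where hb: "is_gauge B hb" using gauge_exists[OF Sig0_Sig[OF B(1)]] ..
    have "(A \<union> B) \<inter> B = B" "A \<inter> (A \<union> B) = A" by auto
    then obtain h2 k where h2: "is_gauge B h2" "\<And>x. x \<in> B \<Longrightarrow> h2 x \<subseteq> h1 x"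
      and k: "is_gauge A k" "\<And>x. x \<in> A \<Longrightarrow> k x \<subseteq> h' x" "\<And>x. x \<in> A \<Longrightarrow> k x \<subseteq> h1 x"
      using gauge_Int[OF g1 hb] gauge_Int[OF h'(1) g1] by auto
    have "A - B \<in> Sig" using Sig_Diff_Sig0[OF gauge_Sig[OF k(1)] B(1)] .
    then obtain Q where Q: "is_fine A k Q" "cover Q = A - B"
      using fine_exists[OF k(1)] by auto
    have Q1: "is_fine (A \<union> B) h1 Q" using fine_mono[OF Q(1), of "A \<union> B" h1] k(3) by auto
    have Q2: "is_fine A h' Q" using fine_mono[OF Q(1), of A h'] k(2) by auto
    have "good B h2 (sdiff G (sdiff G0 G0))"
    proof (rule goodI[OF h2(1)])
      fix T assume T: "is_fine B h2 T" "cover T = B"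
      have T1: "is_fine (A \<union> B) h1 T" using fine_mono[OF T(1), of "A \<union> B" h1] h2(2) by auto
      have TQ: "is_fine (A \<union> B) h1 (T \<union> Q)" by (rule fine_Un[OF T1 Q1]) (use T Q in auto)
      have TQd: "T \<inter> Q = {}"
        by (rule cover_disjoint_imp[OF fine_tagged[OF T(1)]]) (use T Q in auto)
      have "cover (T \<union> Q) = A \<union> B" using T(2) Q(2) by auto
      from goodE[OF g TQ this] obtain Y where Y: "finite Y" "Y \<subseteq> T \<union> Q"
        "\<And>\<Omega>. finite \<Omega> \<Longrightarrow> Y \<subseteq> \<Omega> \<Longrightarrow> \<Omega> \<subseteq> T \<union> Q \<Longrightarrow> val \<Omega> \<in> G" by metis
      have QY: "val (Y \<inter> Q) \<in> sdiff G0 G0"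
      proof (rule off)
        show "finite (Y \<inter> Q)" using Y by simp
        show "is_fine A h' (Y \<inter> Q)" by (rule fine_subset[OF Q2]) simp
        have "cover (Y \<inter> Q) \<subseteq> A - B" using cover_mono[of "Y \<inter> Q" Q] Q(2) by simp
        then show "cover (Y \<inter> Q) \<inter> cover \<Xi> = {}" using B(2) by auto
      qed
      have "val \<Omega> \<in> sdiff G (sdiff G0 G0)" if "finite \<Omega>" "Y \<inter> T \<subseteq> \<Omega>" "\<Omega> \<subseteq> T" for \<Omega>
      proof -
        have "val (\<Omega> \<union> (Y \<inter> Q)) \<in> G" by (rule Y(3)) (use Y that in auto)
        moreover have "val (\<Omega> \<union> (Y \<inter> Q)) = val \<Omega> + val (Y \<inter> Q)"
          by (rule val_Un) (use Y that TQd in auto)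
        moreover have "val \<Omega> = (val \<Omega> + val (Y \<inter> Q)) - val (Y \<inter> Q)" by simp
        ultimately show ?thesis using QY sdiffI by metis
      qed
      then show "\<exists>\<Xi>. finite \<Xi> \<and> \<Xi> \<subseteq> T \<and>
        (\<forall>\<Omega>. finite \<Omega> \<longrightarrow> \<Xi> \<subseteq> \<Omega> \<longrightarrow> \<Omega> \<subseteq> T \<longrightarrow> val \<Omega> \<in> sdiff G (sdiff G0 G0))"
        using Y(1) by (intro exI[of _ "Y \<inter> T"]) auto
    qed
    from exI[of "\<lambda>h. good B h (sdiff G (sdiff G0 G0))", OF this]
    show "\<exists>h2. good B h2 (sdiff G (sdiff G0 G0))" .
  qed
qed

text \<open>The gauges provided by \<open>near\<close> vary with \<open>\<E>\<close>, so no single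
  one serves a division of \<open>B\<close>. A finite part \<open>\<Omega>\<close> of a division
  determines a finite extension \<open>C\<close> of \<open>A0\<close>. It need not be fine for the
  gauge of \<open>C\<close>, but each layer of it can be exchanged for a family that is, with an
  error in \<open>W n\<close> on layer \<open>n\<close>. What \<open>\<Omega>\<close> leaves of
  \<open>A0\<close> is small by \<open>good_small_off\<close>.\<close>

lemma good_extend:
  assumes A0: "A0 \<in> Sig0"
    and near: "\<And>\<E>. finite \<E> \<Longrightarrow> \<E> \<subseteq> \<SS> \<Longrightarrow> disjoint \<E> \<Longrightarrow> \<Union>\<E> \<inter> A0 = {} \<Longrightarrow> \<exists>h. good (A0 \<union> \<Union>\<E>) h G"
    and cauchy: "\<And>\<E> n. finite \<E> \<Longrightarrow> \<E> \<subseteq> \<SS> \<Longrightarrow> disjoint \<E> \<Longrightarrow> \<Union>\<E> \<inter> A0 = {} \<Longrightarrow>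
      \<exists>B' h G'. A0 \<union> \<Union>\<E> \<subseteq> B' \<and> good B' h G' \<and> sdiff G' G' \<subseteq> W n"
    and sums: "\<And>F u. finite F \<Longrightarrow> (\<And>n::nat. n \<in> F \<Longrightarrow> u n \<in> W n) \<Longrightarrow> sum u F \<in> W0"
    and B: "B \<in> Sig" "A0 \<subseteq> B"
  shows "\<exists>h. good B h (sdiff (sdiff G (sdiff G G)) W0)"
proof -
  have "B - A0 \<in> Sig" using Sig_Diff_Sig0[OF B(1) A0] .
  then obtain T0 :: "(unit \<times> 'x set) set" where T0: "tagged T0" "cover T0 = B - A0"
    by (rule adapted_partition[of "{}", rotated 2]) auto
  define \<P> where "\<P> = snd ` T0"
  have P: "countable \<P>" "\<P> \<subseteq> \<SS>" "disjoint \<P>" "\<Union>\<P> = B - A0"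
    using tagged_countable[OF T0(1)] tagged_snd_SS[OF T0(1)] disjoint_snd[OF T0(1)] T0(2)
    by (simp_all add: \<P>_def cover_def)
  have "\<forall>x\<in>B - A0. \<exists>p. p \<in> \<P> \<and> x \<in> p" using P(4) by auto
  from bchoice[OF this] obtain pc where "\<forall>x\<in>B - A0. pc x \<in> \<P> \<and> x \<in> pc x" ..
  then have pc: "pc x \<in> \<P>" "x \<in> pc x" if "x \<in> B" "x \<notin> A0" for x using that by auto
  \<comment> \<open>Points of \<open>A0\<close> share level 0 with the piece numbered 0, if there is
    one. This does no harm because \<open>Bn 0\<close> contains both.\<close>
  define lev where "lev x = (if x \<in> A0 then 0 else to_nat_on \<P> (pc x))" for x
  define \<E> where "\<E> n = {p \<in> \<P>. to_nat_on \<P> p \<le> n}" for n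
  have E: "finite (\<E> n)" "\<E> n \<subseteq> \<SS>" "disjoint (\<E> n)" "\<Union>(\<E> n) \<inter> A0 = {}" for n
  proof -
    have "inj_on (to_nat_on \<P>) (\<E> n)"
      using inj_on_to_nat_on[OF P(1)] by (rule inj_on_subset) (auto simp: \<E>_def)
    moreover have "finite (to_nat_on \<P> ` \<E> n)"
      by (rule finite_subset[of _ "{..n}"]) (auto simp: \<E>_def)
    ultimately show "finite (\<E> n)" by (rule finite_imageD[rotated])
    show "\<E> n \<subseteq> \<SS>" "\<Union>(\<E> n) \<inter> A0 = {}" using P by (auto simp: \<E>_def)
    show "disjoint (\<E> n)" using P(3) by (rule pairwise_subset) (auto simp: \<E>_def)
  qed
  have "\<forall>n. \<exists>q. A0 \<union> \<Union>(\<E> n) \<subseteq> fst q \<and> good (fst q) (fst (snd q)) (snd (snd q)) \<and>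
      sdiff (snd (snd q)) (snd (snd q)) \<subseteq> W n"
    using cauchy[OF E] by (metis fst_conv snd_conv)
  from choice[OF this] obtain q where q: "\<forall>n. A0 \<union> \<Union>(\<E> n) \<subseteq> fst (q n) \<and> good (fst (q n)) (fst (snd (q n))) (snd (snd (q n))) \<and>
      sdiff (snd (snd (q n))) (snd (snd (q n))) \<subseteq> W n" ..
  define Bn where "Bn n = fst (q n)" for n
  define H where "H n = fst (snd (q n))" for n
  define Gn where "Gn n = snd (snd (q n))" for n
  have Bn: "A0 \<union> \<Union>(\<E> n) \<subseteq> Bn n" "good (Bn n) (H n) (Gn n)" "sdiff (Gn n) (Gn n) \<subseteq> W n" for n
    using q by (simp_all add: Bn_def H_def Gn_def)
  have gH: "is_gauge (Bn n) (H n)" for n using good_gauge[OF Bn(2)] .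
  have levB: "x \<in> Bn (lev x)" if "x \<in> B" for x
  proof (cases "x \<in> A0")
    case True
    then show ?thesis using Bn(1) by auto
  next
    case False
    then have "pc x \<in> \<E> (lev x)" using pc[OF that] by (simp add: \<E>_def lev_def)
    then show ?thesis using Bn(1)[of "lev x"] pc(2)[OF that False] by auto
  qed
  obtain h0 where h0: "good A0 h0 G" using near[of "{}"] by auto
  have g0: "is_gauge A0 h0" using h0 by (rule good_gauge)
  \<comment> \<open>The first factor controls the variation on the layer of \<open>x\<close>. The
    second keeps sets tagged in \<open>A0\<close> inside \<open>A0\<close> and all others outside,
    so that a division of \<open>B\<close> contains a division of \<open>A0\<close>.\<close>
  define g where "g x = H (lev x) x \<inter> (if x \<in> A0 then h0 x else pc x)" for x
  have "\<exists>h. is_gauge B h \<and> (\<forall>x\<in>B. h x \<subseteq> g x)"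
  proof (rule gauge_refine[OF B(1)])
    show "countable (g ` B)"
    proof (rule countable_subset)
      show "g ` B \<subseteq> (\<Union>n. (\<lambda>(a, b). a \<inter> b) ` (H n ` Bn n \<times> (h0 ` A0 \<union> \<P>)))"
      proof
        fix y assume "y \<in> g ` B"
        then obtain x where x: "x \<in> B" "y = g x" by auto
        have "y \<in> (\<lambda>(a, b). a \<inter> b) ` (H (lev x) ` Bn (lev x) \<times> (h0 ` A0 \<union> \<P>))"
          unfolding x(2) g_def using levB[OF x(1)] pc(1)[OF x(1)] by (cases "x \<in> A0") force+
        then show "y \<in> (\<Union>n. (\<lambda>(a, b). a \<inter> b) ` (H n ` Bn n \<times> (h0 ` A0 \<union> \<P>)))" by auto
      qed
      show "countable (\<Union>n. (\<lambda>(a, b). a \<inter> b) ` (H n ` Bn n \<times> (h0 ` A0 \<union> \<P>)))"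
        using gauge_countable[OF gH] gauge_countable[OF g0] P(1) by simp
    qed
    fix x assume x: "x \<in> B"
    have "x \<in> (if x \<in> A0 then h0 x else pc x) \<and> (if x \<in> A0 then h0 x else pc x) \<in> Sig"
      using gaugeD(1,2)[OF g0] pc[OF x] P(2) SS_Sig by auto
    moreover have "x \<in> H (lev x) x" "H (lev x) x \<in> Sig"
      using gaugeD(1,2)[OF gH levB[OF x]] SS_Sig by auto
    ultimately show "x \<in> g x \<and> g x \<in> Sig" unfolding g_def using Sig_Int by auto
  qed
  then obtain h where h: "is_gauge B h" "\<And>x. x \<in> B \<Longrightarrow> h x \<subseteq> g x" by auto
  have hH: "h x \<subseteq> H (lev x) x" if "x \<in> B" for x using h(2)[OF that] by (auto simp: g_def)
  have hA: "h x \<subseteq> h0 x" "h x \<subseteq> A0" if "x \<in> A0" for x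
    using h(2)[of x] that B(2) gaugeD(3)[OF g0 that] by (auto simp: g_def)
  have hN: "h x \<inter> A0 = {}" if "x \<in> B" "x \<notin> A0" for x
    using h(2)[OF that(1)] that pc(1)[OF that] P(4) by (auto simp: g_def)
  have "good B h (sdiff (sdiff G (sdiff G G)) W0)"
  proof (rule goodI[OF h(1)])
    fix T assume T: "is_fine B h T" "cover T = B"
    have Tt: "tagged T" using T(1) by (rule fine_tagged)
    define D0 where "D0 = {p \<in> T. fst p \<in> A0}"
    have D0: "is_fine A0 h0 D0" unfolding is_fine_def
    proof (intro conjI)
      show "tagged D0" using Tt by (rule tagged_subset) (auto simp: D0_def)
      show "\<forall>(x, E)\<in>D0. x \<in> A0 \<and> E \<subseteq> h0 x"
        using fineD[OF T(1)] hA(1) by (auto simp: D0_def) blast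
    qed
    have D0c: "cover D0 = A0"
    proof
      show "cover D0 \<subseteq> A0" by (rule fine_cover_subset[OF g0 D0])
      show "A0 \<subseteq> cover D0"
      proof
        fix z assume z: "z \<in> A0"
        then have "z \<in> cover T" using T(2) B(2) by auto
        then obtain x E where xE: "(x, E) \<in> T" "z \<in> E" by (rule in_coverE)
        have "x \<in> B" "z \<in> h x" using fineD[OF T(1) xE(1)] xE(2) by auto
        then have "x \<in> A0" using hN[of x] z by auto
        then show "z \<in> cover D0" using in_coverI[of x E D0] xE by (simp add: D0_def)
      qed
    qed
    obtain h' \<Xi> where h': "is_gauge A0 h'" "\<And>x. x \<in> A0 \<Longrightarrow> h' x \<subseteq> h0 x"
      and X: "finite \<Xi>" "\<Xi> \<subseteq> D0" "val \<Xi> \<in> G"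
      and off: "\<And>\<Omega>. finite \<Omega> \<Longrightarrow> is_fine A0 h' \<Omega> \<Longrightarrow> cover \<Omega> \<inter> cover \<Xi> = {} \<Longrightarrow> val \<Omega> \<in> sdiff G G"
      using good_small_off[OF h0 D0 D0c] by metis
    have "val \<Omega> \<in> sdiff (sdiff G (sdiff G G)) W0" if O: "finite \<Omega>" "\<Xi> \<subseteq> \<Omega>" "\<Omega> \<subseteq> T" for \<Omega>
    proof -
      have Ot: "tagged \<Omega>" using Tt O(3) by (rule tagged_subset)
      have Of: "is_fine B h \<Omega>" using T(1) O(3) by (rule fine_subset)
      define \<F> where "\<F> = snd ` {p \<in> \<Omega>. fst p \<notin> A0}"
      have F: "finite \<F>" "\<F> \<subseteq> \<SS>" "disjoint \<F>" "\<Union>\<F> \<inter> A0 = {}"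
      proof -
        show "finite \<F>" "\<F> \<subseteq> \<SS>" using O(1) tagged_snd_SS[OF Ot] by (auto simp: \<F>_def)
        show "disjoint \<F>" using disjoint_snd[OF Ot] by (rule pairwise_subset) (auto simp: \<F>_def)
        have "snd p \<inter> A0 = {}" if "p \<in> \<Omega>" "fst p \<notin> A0" for p
          using fineD[OF Of, of "fst p" "snd p"] that hN[of "fst p"] by auto
        then show "\<Union>\<F> \<inter> A0 = {}" by (auto simp: \<F>_def)
      qed
      \<comment> \<open>A finite extension of \<open>A0\<close> that contains all sets of
        \<open>\<Omega>\<close>. Its gauge is only known after \<open>\<Omega>\<close>, which is why
        the layers have to be exchanged.\<close>
      define C where "C = A0 \<union> \<Union>\<F>"
      obtain gC where gC: "good C gC G" using near[OF F] unfolding C_def by auto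
      have ggC: "is_gauge C gC" using gC by (rule good_gauge)
      have OC: "E \<subseteq> C" if xE: "(x, E) \<in> \<Omega>" for x E
      proof (cases "x \<in> A0")
        case True
        then show ?thesis using fineD(2)[OF Of xE] hA(2) unfolding C_def by auto
      next
        case False
        then have "E \<in> \<F>" using xE unfolding \<F>_def by force
        then show ?thesis unfolding C_def by auto
      qed
      have OCc: "cover \<Omega> \<subseteq> C"
      proof
        fix z assume "z \<in> cover \<Omega>"
        then obtain x E where "(x, E) \<in> \<Omega>" "z \<in> E" by (rule in_coverE)
        then show "z \<in> C" using OC[of x E] by auto
      qed
      define On where "On n = {p \<in> \<Omega>. lev (fst p) = n}" for n
      have On: "finite (On n)" "is_fine (Bn n) (H n) (On n)" "cover (On n) \<subseteq> C" for n
      proof -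
        show "finite (On n)" using O(1) by (simp add: On_def)
        show "is_fine (Bn n) (H n) (On n)" unfolding is_fine_def
        proof (intro conjI)
          show "tagged (On n)" using Ot by (rule tagged_subset) (auto simp: On_def)
          show "\<forall>(x, E)\<in>On n. x \<in> Bn n \<and> E \<subseteq> H n x"
          proof clarify
            fix x E assume "(x, E) \<in> On n"
            then have xE: "(x, E) \<in> \<Omega>" "lev x = n" by (auto simp: On_def)
            show "x \<in> Bn n \<and> E \<subseteq> H n x"
              using fineD[OF Of xE(1)] levB[of x] hH[of x] xE(2) by auto
          qed
        qed
        show "cover (On n) \<subseteq> C" using cover_mono[of "On n" \<Omega>] OCc by (auto simp: On_def)
      qed
      have Ond: "cover (On m) \<inter> cover (On n) = {}" if "m \<noteq> n" for m n
        by (rule disjoint_cover, rule tagged_subset[OF Ot]) (use that in \<open>auto simp: On_def\<close>)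
      define R where "R = A0 - cover \<Omega>"
      \<comment> \<open>The replacement is fine for two gauges: for \<open>gC\<close>, to enter a
        division of \<open>C\<close>, and for \<open>H n\<close>, to be comparable with the layer by
        \<open>good_swap\<close>.\<close>
      have "\<exists>P. is_fine C gC P \<and> is_fine (Bn n) (H n) P \<and> cover P = cover (On n)" for n
      proof -
        obtain k where k: "is_gauge (C \<inter> Bn n) k" "\<And>x. x \<in> C \<inter> Bn n \<Longrightarrow> k x \<subseteq> gC x" "\<And>x. x \<in> C \<inter> Bn n \<Longrightarrow> k x \<subseteq> H n x"
          using gauge_Int[OF ggC gH] by metis
        have "cover (On n) \<in> Sig" by (rule cover_Sig[OF fine_tagged[OF On(2)]])
        moreover have "cover (On n) \<subseteq> C \<inter> Bn n"
          using On(3) fine_cover_subset[OF gH On(2)] by auto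
        ultimately obtain P where P: "is_fine (C \<inter> Bn n) k P" "cover P = cover (On n)"
          using fine_exists[OF k(1)] by metis
        show ?thesis
          using fine_mono[OF P(1), of C gC] fine_mono[OF P(1), of "Bn n" "H n"] k(2,3) P(2) by auto
      qed
      then have "\<forall>n. \<exists>P. is_fine C gC P \<and> is_fine (Bn n) (H n) P \<and> cover P = cover (On n)" by (rule allI)
      from choice[OF this] obtain Pn where "\<forall>n. is_fine C gC (Pn n) \<and> is_fine (Bn n) (H n) (Pn n) \<and> cover (Pn n) = cover (On n)" ..
      then have Pn: "is_fine C gC (Pn n)" "is_fine (Bn n) (H n) (Pn n)" "cover (Pn n) = cover (On n)" for n
        by auto
      have "\<exists>P0. finite P0 \<and> P0 \<subseteq> Pn n \<and>
        (\<forall>P'. finite P' \<longrightarrow> P0 \<subseteq> P' \<longrightarrow> P' \<subseteq> Pn n \<longrightarrow> val P' - val (On n) \<in> W n)" for n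
      proof -
        obtain P0 where P0: "finite P0" "P0 \<subseteq> Pn n"
          "\<And>P'. finite P' \<Longrightarrow> P0 \<subseteq> P' \<Longrightarrow> P' \<subseteq> Pn n \<Longrightarrow> val P' - val (On n) \<in> sdiff (Gn n) (Gn n)"
          using good_swap[OF Bn(2) On(2,1) Pn(2,3)] by metis
        then show ?thesis using Bn(3) by (intro exI[of _ P0]) auto
      qed
      then have "\<forall>n. \<exists>P0. finite P0 \<and> P0 \<subseteq> Pn n \<and>
        (\<forall>P'. finite P' \<longrightarrow> P0 \<subseteq> P' \<longrightarrow> P' \<subseteq> Pn n \<longrightarrow> val P' - val (On n) \<in> W n)" by (rule allI)
      from choice[OF this] obtain P0 where "\<forall>n. finite (P0 n) \<and> P0 n \<subseteq> Pn n \<and>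
        (\<forall>P'. finite P' \<longrightarrow> P0 n \<subseteq> P' \<longrightarrow> P' \<subseteq> Pn n \<longrightarrow> val P' - val (On n) \<in> W n)" ..
      then have P0: "finite (P0 n)" "P0 n \<subseteq> Pn n"
        "\<And>P'. finite P' \<Longrightarrow> P0 n \<subseteq> P' \<Longrightarrow> P' \<subseteq> Pn n \<Longrightarrow> val P' - val (On n) \<in> W n" for n
        by auto
      define N where "N = (\<lambda>p. lev (fst p)) ` \<Omega>"
      have N: "finite N" using O(1) by (simp add: N_def)
      have OU: "\<Omega> = (\<Union>n\<in>N. On n)" by (auto simp: N_def On_def)
      have AC: "A0 \<inter> C = A0" by (auto simp: C_def)
      \<comment> \<open>The family on the rest of \<open>A0\<close> also serves two purposes:
        \<open>h'\<close> makes its sums small off \<open>\<Xi>\<close>, and \<open>gC\<close>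
        admits it to the division of \<open>C\<close>.\<close>
      obtain k where k: "is_gauge A0 k" "\<And>x. x \<in> A0 \<Longrightarrow> k x \<subseteq> h' x" "\<And>x. x \<in> A0 \<Longrightarrow> k x \<subseteq> gC x"
        using gauge_Int[OF h'(1) ggC] unfolding AC by metis
      have "R \<in> Sig" unfolding R_def
        using Sig_Diff_Sig0[OF gauge_Sig[OF g0] cover_Sig0[OF Ot O(1)]] .
      then obtain Q where Q: "is_fine A0 k Q" "cover Q = R"
        using fine_exists[OF k(1)] by (auto simp: R_def)
      have Q1: "is_fine A0 h' Q" by (rule fine_mono[OF Q(1)]) (use k in auto)
      have Q2: "is_fine C gC Q" by (rule fine_mono[OF Q(1)]) (use k AC in auto)
      define P where "P = (\<Union>n\<in>N. Pn n)"
      have Pc: "cover P = cover \<Omega>" unfolding P_def OU cover_UN using Pn(3) by simp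
      have Pf: "is_fine C gC P" unfolding P_def
        by (rule fine_UN) (use N Pn Ond countable_finite in auto)
      have PQ: "is_fine C gC (P \<union> Q)" by (rule fine_Un[OF Pf Q2]) (use Pc Q(2) R_def in auto)
      have PQd: "P \<inter> Q = {}"
        by (rule cover_disjoint_imp[OF fine_tagged[OF Pf]]) (use Pc Q(2) R_def in auto)
      have "cover (P \<union> Q) = C"
      proof -
        have "\<Union>\<F> \<subseteq> cover \<Omega>" by (auto simp: \<F>_def cover_def)
        then show ?thesis using OCc Pc Q(2) by (auto simp: R_def C_def)
      qed
      from goodE[OF gC PQ this] obtain Y where Y: "finite Y" "Y \<subseteq> P \<union> Q"
        "\<And>\<Omega>. finite \<Omega> \<Longrightarrow> Y \<subseteq> \<Omega> \<Longrightarrow> \<Omega> \<subseteq> P \<union> Q \<Longrightarrow> val \<Omega> \<in> G" by metis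
      \<comment> \<open>Large enough for the comparison with the layer (\<open>P0 n\<close>) and for
        the division of \<open>C\<close> (\<open>Y\<close>) at the same time.\<close>
      define P' where "P' n = P0 n \<union> (Y \<inter> Pn n)" for n
      have P': "finite (P' n)" "P0 n \<subseteq> P' n" "P' n \<subseteq> Pn n" for n
        using P0(1,2)[of n] Y(1) by (auto simp: P'_def)
      have dis: "Pn m \<inter> Pn n = {}" if "m \<noteq> n" for m n
        by (rule cover_disjoint_imp[OF fine_tagged[OF Pn(1)]]) (use Ond[OF that] Pn(3) in auto)
      have v1: "val (\<Union>n\<in>N. P' n) = (\<Sum>n\<in>N. val (P' n))"
        unfolding val_def by (rule sum.UNION_disjoint) (use N P' dis in auto, use P'(3) dis in blast)
      have vO: "val \<Omega> = (\<Sum>n\<in>N. val (On n))"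
        unfolding val_def by (subst OU, rule sum.UNION_disjoint) (use N On(1) in \<open>auto simp: On_def\<close>)
      have v2: "val ((\<Union>n\<in>N. P' n) \<union> (Y \<inter> Q)) = val (\<Union>n\<in>N. P' n) + val (Y \<inter> Q)"
      proof (rule val_Un)
        have "(\<Union>n\<in>N. P' n) \<subseteq> P" unfolding P_def using P'(3) by (rule UN_mono[OF subset_refl])
        then show "(\<Union>n\<in>N. P' n) \<inter> (Y \<inter> Q) = {}" using PQd by auto
      qed (use N P' Y in auto)
      have v3: "val ((\<Union>n\<in>N. P' n) \<union> (Y \<inter> Q)) \<in> G"
      proof (rule Y(3))
        show "finite ((\<Union>n\<in>N. P' n) \<union> (Y \<inter> Q))" using N P' Y by auto
        show "Y \<subseteq> (\<Union>n\<in>N. P' n) \<union> (Y \<inter> Q)" using Y(2) by (auto simp: P'_def P_def)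
        have "(\<Union>n\<in>N. P' n) \<subseteq> P" unfolding P_def using P'(3) by (rule UN_mono[OF subset_refl])
        then show "(\<Union>n\<in>N. P' n) \<union> (Y \<inter> Q) \<subseteq> P \<union> Q" by auto
      qed
      have v4: "val (Y \<inter> Q) \<in> sdiff G G"
      proof (rule off)
        show "finite (Y \<inter> Q)" using Y by simp
        show "is_fine A0 h' (Y \<inter> Q)" by (rule fine_subset[OF Q1]) simp
        have "cover (Y \<inter> Q) \<subseteq> R" using cover_mono[of "Y \<inter> Q" Q] Q(2) by simp
        then show "cover (Y \<inter> Q) \<inter> cover \<Xi> = {}" using cover_mono[OF O(2)] by (auto simp: R_def)
      qed
      have v5: "(\<Sum>n\<in>N. val (P' n) - val (On n)) \<in> W0"
        by (rule sums[OF N P0(3)[OF P']])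
      \<comment> \<open>The sum along the division of \<open>C\<close> lies in \<open>G\<close>;
        from it the part on the rest of \<open>A0\<close> and then the collected exchange errors are
        removed.\<close>
      have v6: "val \<Omega> = (((\<Sum>n\<in>N. val (P' n)) + val (Y \<inter> Q)) - val (Y \<inter> Q)) - (\<Sum>n\<in>N. val (P' n) - val (On n))"
        by (simp add: vO sum_subtractf)
      have "(\<Sum>n\<in>N. val (P' n)) + val (Y \<inter> Q) \<in> G" using v1 v2 v3 by simp
      then show ?thesis unfolding v6 by (rule sdiffI[OF sdiffI[OF _ v4] v5])
    qed
    then show "\<exists>\<Xi>. finite \<Xi> \<and> \<Xi> \<subseteq> T \<and> (\<forall>\<Omega>. finite \<Omega> \<longrightarrow> \<Xi> \<subseteq> \<Omega> \<longrightarrow> \<Omega> \<subseteq> T \<longrightarrow>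
        val \<Omega> \<in> sdiff (sdiff G (sdiff G G)) W0)"
      using X(1,2) by (intro exI[of _ \<Xi>]) (auto simp: D0_def)
  qed
  from exI[of "\<lambda>h. good B h (sdiff (sdiff G (sdiff G G)) W0)", OF this] show ?thesis .
qed

end

section \<open>Step functions and absolute sums over partitions\<close>

lemma has_sum_nbhd:
  fixes f :: "'i \<Rightarrow> 'z::topological_ab_group_add"
  assumes "(f has_sum s) A" "0 \<in> interior W"
  shows "\<exists>Y0. finite Y0 \<and> Y0 \<subseteq> A \<and>
    (\<forall>Y. finite Y \<longrightarrow> Y0 \<subseteq> Y \<longrightarrow> Y \<subseteq> A \<longrightarrow> sum f Y - s \<in> W)"
proof -
  have "((\<lambda>Y. sum f Y - s) \<longlongrightarrow> s - s) (finite_subsets_at_top A)"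
    using assms(1) unfolding has_sum_def by (intro tendsto_diff tendsto_const)
  then have "eventually (\<lambda>Y. sum f Y - s \<in> interior W) (finite_subsets_at_top A)"
    by (rule topological_tendstoD) (use assms(2) in auto)
  then obtain Y0 where Y0: "finite Y0" "Y0 \<subseteq> A"
    "\<And>Y. finite Y \<Longrightarrow> Y0 \<subseteq> Y \<Longrightarrow> Y \<subseteq> A \<Longrightarrow> sum f Y - s \<in> interior W"
    unfolding eventually_finite_subsets_at_top by auto
  then show ?thesis using interior_subset[of W] by (intro exI[of _ Y0]) auto
qed

lemma has_sum_sum_finite:
  fixes f :: "'k \<Rightarrow> 'i \<Rightarrow> 'z::topological_comm_monoid_add"
  assumes "finite K" "\<And>k. k \<in> K \<Longrightarrow> (f k has_sum s k) A"
  shows "((\<lambda>i. \<Sum>k\<in>K. f k i) has_sum (\<Sum>k\<in>K. s k)) A"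
  using assms by (induction K) (auto intro: has_sum_add)

text \<open>Like \<open>step_sum\<close>, but with an arbitrary finite index set, so that sets of tagged
  pieces can index steps directly.\<close>

definition steps :: "'k set \<Rightarrow> ('k \<Rightarrow> 'v::ab_group_add) \<Rightarrow> ('k \<Rightarrow> 'x set) \<Rightarrow> 'x \<Rightarrow> 'v" where
  "steps K c E x = (\<Sum>k\<in>K. if x \<in> E k then c k else 0)"

lemma adapted_Un: "adapted (\<A> \<union> \<B>) P \<longleftrightarrow> adapted \<A> P \<and> adapted \<B> P"
  unfolding adapted_def by (rule ball_Un)

definition point :: "'x set \<Rightarrow> 'x" where
  "point P = (SOME z. z \<in> P)"

lemma point_in: "P \<noteq> {} \<Longrightarrow> point P \<in> P"
  unfolding point_def by (rule someI_ex) auto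

lemma steps_adapted:
  assumes "adapted (E ` K) P" "x \<in> P" "y \<in> P"
  shows "steps K c E x = steps K c E y"
proof -
  have "x \<in> E k \<longleftrightarrow> y \<in> E k" if "k \<in> K" for k
    using assms that unfolding adapted_def by auto
  then show ?thesis unfolding steps_def by (intro sum.cong) auto
qed

text \<open>Transfers constructions with natural index sets, such as sets of tagged pieces, to the
  index sets of naturals that \<open>step_function\<close> and the envelope integral demand.\<close>

lemma steps_nat:
  assumes "finite K"
  obtains J :: "nat set" and b where "finite J" "bij_betw b J K"
    "\<And>c E. step_sum J (c \<circ> b) (E \<circ> b) = steps K c E"
proof -
  obtain b where b: "bij_betw b {0..<card K} K" using ex_bij_betw_nat_finite[OF assms] by auto
  have "step_sum {0..<card K} (c \<circ> b) (E \<circ> b) = steps K c E" for c :: "'a \<Rightarrow> 'b" and E :: "'a \<Rightarrow> 'c set"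
    by (rule ext)
       (use sum.reindex_bij_betw[OF b, of "\<lambda>k. if x \<in> E k then c k else 0" for x]
        in \<open>simp add: step_sum_def steps_def comp_def\<close>)
  then show ?thesis using that[OF _ b] by simp
qed

locale lebesgue_mcshane = intervals X \<SS>
  for X :: "'x set" and \<SS> +
  fixes \<mu> :: "'x set \<Rightarrow> 'w::complete_hausdorff_ab_group_add"
    and L :: "'v::complete_hausdorff_ab_group_add \<Rightarrow> 'w \<Rightarrow> 'z::complete_hausdorff_ab_group_add"
    and f :: "'x \<Rightarrow> 'v"
  assumes measure: "group_measure \<SS> \<mu>"
    and biadd: "biadditive L"
    and cont: "\<And>v. continuous_on UNIV (L v)"

sublocale lebesgue_mcshane \<subseteq> valued_intervals X \<SS> "\<lambda>x E. L (f x) (\<mu> E)" ..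

context lebesgue_mcshane
begin

lemma L_add_right: "Modules.additive (L v)"
  using biadd by (simp add: biadditive_def)

lemma L_add_left: "Modules.additive (\<lambda>v. L v w)"
  using biadd by (simp add: biadditive_def)

lemma L_zero [simp]: "L 0 w = 0"
  using additive.zero[OF L_add_left] .

lemma L_diff: "L (u - v) w = L u w - L v w"
  using additive.diff[OF L_add_left] .

lemma L_sum: "L (sum c K) w = (\<Sum>k\<in>K. L (c k) w)"
  using additive.sum[OF L_add_left] .

lemma measure_has_sum:
  assumes "A \<in> \<SS>" "countable \<P>" "\<P> \<subseteq> \<SS>" "disjoint \<P>" "\<Union>\<P> = A"
  shows "(\<mu> has_sum \<mu> A) \<P>"
proof -
  let ?I = "to_nat_on \<P> ` \<P>" and ?E = "from_nat_into \<P>"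
  have E: "?E (to_nat_on \<P> P) = P" if "P \<in> \<P>" for P
    using from_nat_into_to_nat_on[OF assms(2) that] .
  have "?E ` ?I = \<P>" using E by (force simp: image_image)
  moreover have "\<forall>i\<in>?I. ?E i \<in> \<SS>" using E assms(3) by auto
  moreover have "disjoint_family_on ?E ?I"
    unfolding disjoint_family_on_def
  proof (intro ballI impI)
    fix i j assume ij: "i \<in> ?I" "j \<in> ?I" "i \<noteq> j"
    then obtain P Q where "P \<in> \<P>" "Q \<in> \<P>" "i = to_nat_on \<P> P" "j = to_nat_on \<P> Q" by auto
    then show "?E i \<inter> ?E j = {}" using E ij(3) disjointD[OF assms(4), of P Q] by auto
  qed
  ultimately have "((\<lambda>i. \<mu> (?E i)) has_sum \<mu> A) ?I"
    using measure assms(1,5) unfolding group_measure_def by (metis (mono_tags))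
  then have "((\<lambda>i. \<mu> (?E i)) \<circ> to_nat_on \<P> has_sum \<mu> A) \<P>"
    using has_sum_reindex[OF inj_on_to_nat_on[OF assms(2)]] by metis
  then show ?thesis
    by (subst has_sum_cong[of _ _ "(\<lambda>i. \<mu> (?E i)) \<circ> to_nat_on \<P>"]) (simp_all add: E)
qed

text \<open>Countable additivity of \<open>\<mu>\<close> over the pieces inside \<open>A\<close>,
  carried through the continuous homomorphism \<open>L v\<close>. The other pieces are disjoint from
  \<open>A\<close> and enter with 0, so that the sums for different \<open>A\<close> share the index
  set \<open>T\<close>.\<close>

lemma pieces_has_sum:
  assumes "A \<in> \<SS>" "tagged T" "\<And>t P. (t, P) \<in> T \<Longrightarrow> P \<subseteq> A \<or> P \<inter> A = {}" "A \<subseteq> cover T"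
  shows "((\<lambda>(t, P). if P \<subseteq> A then L v (\<mu> P) else 0) has_sum L v (\<mu> A)) T"
proof -
  let ?T = "{p \<in> T. snd p \<subseteq> A}"
  have T: "tagged ?T" using assms(2) by (rule tagged_subset) auto
  have "(\<mu> has_sum \<mu> A) (snd ` ?T)"
  proof (rule measure_has_sum[OF assms(1)])
    show "countable (snd ` ?T)" "snd ` ?T \<subseteq> \<SS>" "disjoint (snd ` ?T)"
      using tagged_countable[OF T] tagged_snd_SS[OF T] disjoint_snd[OF T] by simp_all
    show "\<Union>(snd ` ?T) = A"
    proof
      show "A \<subseteq> \<Union>(snd ` ?T)"
      proof
        fix z assume z: "z \<in> A"
        then have "z \<in> cover T" using assms(4) by auto
        then obtain t P where tP: "(t, P) \<in> T" "z \<in> P" by (rule in_coverE)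
        then have "P \<subseteq> A" using assms(3)[OF tP(1)] z by auto
        then have "(t, P) \<in> ?T" using tP by simp
        then show "z \<in> \<Union>(snd ` ?T)" using tP(2) by force
      qed
    qed auto
  qed
  then have "(\<mu> \<circ> snd has_sum \<mu> A) ?T"
    by (rule has_sum_reindex[OF tagged_inj[OF T], THEN iffD1])
  moreover have "L v \<midarrow>\<mu> A\<rightarrow> L v (\<mu> A)"
    using cont[of v] by (simp add: continuous_on_eq_continuous_at isCont_def)
  ultimately have "(L v \<circ> (\<mu> \<circ> snd) has_sum L v (\<mu> A)) ?T"
    by (intro has_sum_comm_additive[OF L_add_right])
  then show ?thesis
    by (subst has_sum_cong_neutral[where g = "L v \<circ> (\<mu> \<circ> snd)" and T = ?T])
       (auto simp: case_prod_beta)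
qed

definition step_integral :: "'k set \<Rightarrow> ('k \<Rightarrow> 'v) \<Rightarrow> ('k \<Rightarrow> 'x set) \<Rightarrow> 'z" where
  "step_integral K c E = (\<Sum>k\<in>K. L (c k) (\<mu> (E k)))"

abbreviation step_val :: "('x \<Rightarrow> 'v) \<Rightarrow> 'x set \<Rightarrow> 'z" where
  "step_val s P \<equiv> L (s (point P)) (\<mu> P)"

text \<open>A finite sum of absolute sums, one for each step. On an adapted piece the step function
  is constant, so its value at one point is enough. This expresses the integral through the step
  function itself instead of its representation, on any sufficiently fine partition.\<close>

lemma steps_has_sum:
  assumes "finite K" "E ` K \<subseteq> \<SS>" "tagged T" "\<And>t P. (t, P) \<in> T \<Longrightarrow> adapted (E ` K) P"
    and "\<Union>(E ` K) \<subseteq> cover T"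
  shows "((\<lambda>(t, P). step_val (steps K c E) P) has_sum step_integral K c E) T"
proof -
  have "((\<lambda>p. \<Sum>k\<in>K. (\<lambda>(t, P). if P \<subseteq> E k then L (c k) (\<mu> P) else 0) p) has_sum step_integral K c E) T"
    unfolding step_integral_def
  proof (rule has_sum_sum_finite[OF assms(1)])
    fix k assume k: "k \<in> K"
    show "((\<lambda>(t, P). if P \<subseteq> E k then L (c k) (\<mu> P) else 0) has_sum L (c k) (\<mu> (E k))) T"
    proof (rule pieces_has_sum[OF _ assms(3)])
      show "E k \<in> \<SS>" "E k \<subseteq> cover T" using assms(2,5) k by auto
      show "P \<subseteq> E k \<or> P \<inter> E k = {}" if "(t, P) \<in> T" for t P
        using assms(4)[OF that] k by (simp add: adapted_def)
    qed
  qed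
  moreover have "(\<Sum>k\<in>K. (\<lambda>(t, P). if P \<subseteq> E k then L (c k) (\<mu> P) else 0) p) = (\<lambda>(t, P). step_val (steps K c E) P) p"
    if p: "p \<in> T" for p
  proof -
    obtain t P where tP: "p = (t, P)" by (cases p)
    have P: "adapted (E ` K) P" "point P \<in> P"
      using assms(4) p tP point_in[OF tagged_nonempty[OF assms(3)]] by auto
    have "P \<subseteq> E k \<longleftrightarrow> point P \<in> E k" if "k \<in> K" for k
      using P that by (auto simp: adapted_def)
    then show ?thesis unfolding tP steps_def by (auto simp: L_sum intro!: sum.cong)
  qed
  ultimately show ?thesis by (rule has_sum_cong[THEN iffD1, rotated])
qed

text \<open>The envelope integral before taking the closure. All algebra is done here; the closure
  is handled at the end at the price of one more neighbourhood.\<close>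

definition raw_integral :: "('v \<times> 'x) set \<Rightarrow> 'z set" where
  "raw_integral \<B> = {step_integral J c E |(J::nat set) c E.
     finite J \<and> (\<forall>j\<in>J. E j \<in> \<SS>) \<and> graph_on X (step_sum J c E) \<subseteq> \<B>}"

lemma raw_integralI:
  assumes "finite K" "E ` K \<subseteq> \<SS>" "\<And>x. x \<in> X \<Longrightarrow> (steps K c E x, x) \<in> \<B>"
  shows "step_integral K c E \<in> raw_integral \<B>"
proof -
  obtain J :: "nat set" and b where J: "finite J" "bij_betw b J K"
    "\<And>c E. step_sum J (c \<circ> b :: _ \<Rightarrow> 'v) (E \<circ> b :: _ \<Rightarrow> 'x set) = steps K c E"
    using steps_nat[OF assms(1)] by metis
  have "step_integral K c E = step_integral J (c \<circ> b) (E \<circ> b)"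
    unfolding step_integral_def using sum.reindex_bij_betw[OF J(2), of "\<lambda>k. L (c k) (\<mu> (E k))"] by simp
  moreover have "\<forall>j\<in>J. (E \<circ> b) j \<in> \<SS>" using J(2) assms(2) by (auto simp: bij_betw_def)
  moreover have "graph_on X (step_sum J (c \<circ> b) (E \<circ> b)) \<subseteq> \<B>"
    unfolding J(3) graph_on_def using assms(3) by auto
  ultimately show ?thesis unfolding raw_integral_def using J(1)
    by (intro CollectI exI[of _ J] exI[of _ "c \<circ> b"] exI[of _ "E \<circ> b"] conjI) simp_all
qed

text \<open>On finitely many disjoint pieces the step function is overwritten by admissible
  constants. It is constant on an adapted piece, so overwriting means adding the step
  \<open>v t - steps K c E (point P)\<close> there, and the graph remains in \<open>\<B>\<close>.
  This is how sums with the values of \<open>f\<close> get into the integral of an envelope.\<close>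

lemma raw_integral_modify:
  fixes K :: "'k set" and Q :: "('t \<times> 'x set) set"
  assumes "finite K" "E ` K \<subseteq> \<SS>" "\<And>x. x \<in> X \<Longrightarrow> (steps K c E x, x) \<in> \<B>"
    and "finite Q" "tagged Q" "\<And>t P. (t, P) \<in> Q \<Longrightarrow> adapted (E ` K) P"
    and "\<And>t P z. (t, P) \<in> Q \<Longrightarrow> z \<in> P \<Longrightarrow> (v t, z) \<in> \<B>"
  shows "step_integral K c E + ((\<Sum>(t, P)\<in>Q. L (v t) (\<mu> P)) - (\<Sum>(t, P)\<in>Q. step_val (steps K c E) P))
    \<in> raw_integral \<B>"
proof -
  let ?s = "steps K c E"
  let ?K = "K <+> Q"
  define c' :: "'k + 't \<times> 'x set \<Rightarrow> 'v" where "c' = case_sum c (\<lambda>(t, P). v t - ?s (point P))"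
  define E' :: "'k + 't \<times> 'x set \<Rightarrow> 'x set" where "E' = case_sum E snd"
  note split = sum.Plus[OF assms(1,4)]
  have "step_integral ?K c' E' \<in> raw_integral \<B>"
  proof (rule raw_integralI)
    show "finite ?K" using assms(1,4) by simp
    show "E' ` ?K \<subseteq> \<SS>" using assms(2) tagged_snd_SS[OF assms(5)] by (auto simp: E'_def)
    fix x assume x: "x \<in> X"
    have st: "steps ?K c' E' x = ?s x + (\<Sum>(t, P)\<in>Q. if x \<in> P then v t - ?s (point P) else 0)"
      unfolding steps_def[of ?K] split
      by (simp add: c'_def E'_def case_prod_beta steps_def[of K c E x] cong: if_cong)
    show "(steps ?K c' E' x, x) \<in> \<B>"
    proof (cases "x \<in> cover Q")
      case True
      then obtain t P where tP: "(t, P) \<in> Q" "x \<in> P" by (rule in_coverE)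
      have "(\<Sum>(t, P)\<in>Q. if x \<in> P then v t - ?s (point P) else 0) = (\<Sum>(t, P)\<in>{(t, P)}. if x \<in> P then v t - ?s (point P) else 0)"
      proof (rule sum.mono_neutral_right[OF assms(4)])
        show "\<forall>q\<in>Q - {(t, P)}. (case q of (t, P) \<Rightarrow> if x \<in> P then v t - ?s (point P) else 0) = 0"
        proof
          fix q assume q: "q \<in> Q - {(t, P)}"
          then have "x \<notin> snd q"
            using tagged_eq[OF assms(5) tP(1) _ tP(2), of "fst q" "snd q"] by auto
          then show "(case q of (t, P) \<Rightarrow> if x \<in> P then v t - ?s (point P) else 0) = 0"
            by (simp add: case_prod_beta)
        qed
      qed (use tP in auto)
      also have "\<dots> = v t - ?s x"
        using steps_adapted[OF assms(6)[OF tP(1)] tP(2) point_in[OF tagged_nonempty[OF assms(5) tP(1)]], of c] tP(2)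
        by simp
      finally show ?thesis using st assms(7)[OF tP] by simp
    next
      case False
      have "(\<Sum>(t, P)\<in>Q. if x \<in> P then v t - ?s (point P) else 0) = 0"
        by (rule sum.neutral) (use False in \<open>auto dest: in_coverI\<close>)
      then show ?thesis using st assms(3)[OF x] by simp
    qed
  qed
  moreover have "step_integral ?K c' E' = step_integral K c E + ((\<Sum>(t, P)\<in>Q. L (v t) (\<mu> P)) - (\<Sum>(t, P)\<in>Q. step_val ?s P))"
    unfolding step_integral_def split
    by (simp add: c'_def E'_def case_prod_beta L_diff sum_subtractf)
  ultimately show ?thesis by simp
qed

section \<open>From an envelope to a good gauge and back\<close>

lemma in_envelopeE:
  assumes eq: "\<B> = (\<Union>D\<in>\<DD>. common_section \<B> D \<times> D) \<union> ({0} \<times> (X - \<Union>\<DD>))"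
    and "(v, z) \<in> \<B>"
  obtains D where "D \<in> \<DD>" "z \<in> D" "v \<in> common_section \<B> D" | "v = 0" "z \<notin> \<Union>\<DD>"
proof -
  have "(v, z) \<in> (\<Union>D\<in>\<DD>. common_section \<B> D \<times> D) \<union> ({0} \<times> (X - \<Union>\<DD>))"
    using assms(2) by (subst (asm) eq)
  then show ?thesis using that by auto
qed

lemma common_sectionD: "v \<in> common_section \<B> D \<Longrightarrow> z \<in> D \<Longrightarrow> (v, z) \<in> \<B>"
  by (simp add: common_section_def)

lemma zero_outside_graphD:
  assumes "graph_on X (zero_outside f B) \<subseteq> \<B>" "x \<in> X"
  shows "x \<in> B \<Longrightarrow> (f x, x) \<in> \<B>" "x \<notin> B \<Longrightarrow> (0, x) \<in> \<B>"
proof -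
  have "(zero_outside f B x, x) \<in> \<B>" using assms by (auto simp: graph_on_def)
  then show "x \<in> B \<Longrightarrow> (f x, x) \<in> \<B>" "x \<notin> B \<Longrightarrow> (0, x) \<in> \<B>"
    by (simp_all add: zero_outside_def)
qed

text \<open>In an envelope around \<open>f\<close> on \<open>B\<close>, every tag may be used on its gauge set; the remaining sets
  \<open>\<F>\<close> on which the value \<open>0\<close> is allowed cover what \<open>B\<close> leaves of the step function.\<close>

lemma envelope_gauge:
  assumes B: "B \<in> Sig"
    and env: "\<DD> \<subseteq> \<SS>" "countable \<DD>" "\<B> = (\<Union>D\<in>\<DD>. common_section \<B> D \<times> D) \<union> ({0} \<times> (X - \<Union>\<DD>))"
    and graph: "graph_on X (zero_outside f B) \<subseteq> \<B>"
    and step: "finite K" "E ` K \<subseteq> \<SS>" "\<And>x. x \<in> X \<Longrightarrow> (steps K c E x, x) \<in> \<B>"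
  obtains h \<F> where "is_gauge B h" "\<And>x z. x \<in> B \<Longrightarrow> z \<in> h x \<Longrightarrow> (f x, z) \<in> \<B>"
    "countable \<F>" "\<F> \<subseteq> \<SS>" "\<And>F z. F \<in> \<F> \<Longrightarrow> z \<in> F \<Longrightarrow> (0, z) \<in> \<B>" "\<Union>(E ` K) \<subseteq> B \<union> \<Union>\<F>"
proof -
  let ?s = "steps K c E"
  have finE: "finite (E ` K)" using step(1) by simp
  have sX: "?s x = 0" if "x \<in> X" "x \<notin> \<Union>\<DD>" for x
    using step(3)[OF that(1)] by (rule in_envelopeE[OF env(3)]) (use that in auto)
  have zero: "(0, z) \<in> \<B>" if P: "adapted (E ` K) P" "P \<in> \<SS>" "x \<in> P" "z \<in> P" "?s x = 0" for x z P
  proof -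
    have "?s z = 0" using steps_adapted[OF P(1,4,3), of c] P(5) by simp
    moreover have "z \<in> X" using SS_subset[OF P(2)] P(4) by auto
    ultimately show ?thesis using step(3)[of z] by simp
  qed
  obtain T1 :: "(unit \<times> 'x set) set" where T1: "tagged T1" "cover T1 = B"
    "\<And>t P. (t, P) \<in> T1 \<Longrightarrow> adapted (E ` K) P"
    using adapted_partition[OF finE step(2) B] by metis
  obtain T2 :: "(unit \<times> 'x set) set" where T2: "tagged T2" "cover T2 = \<Union>(E ` K)"
    "\<And>t P. (t, P) \<in> T2 \<Longrightarrow> adapted (E ` K) P"
    using adapted_partition[OF finE step(2) Sig0_Sig[OF Sig0_Union[OF finE step(2)]]] by metis
  have "\<forall>x\<in>B. \<exists>D. x \<in> D \<and> D \<in> \<DD> \<union> snd ` T1 \<and> D \<in> \<SS> \<and> (\<forall>z\<in>D. (f x, z) \<in> \<B>)"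
  proof
    fix x assume x: "x \<in> B"
    have xX: "x \<in> X" using Sig_subset[OF B] x by auto
    from zero_outside_graphD(1)[OF graph xX x]
    show "\<exists>D. x \<in> D \<and> D \<in> \<DD> \<union> snd ` T1 \<and> D \<in> \<SS> \<and> (\<forall>z\<in>D. (f x, z) \<in> \<B>)"
    proof (rule in_envelopeE[OF env(3)])
      fix D assume D: "D \<in> \<DD>" "x \<in> D" "f x \<in> common_section \<B> D"
      then show ?thesis using env(1) common_sectionD[OF D(3)] by (intro exI[of _ D]) auto
    next
      \<comment> \<open>No member of \<open>\<DD>\<close> is available around \<open>x\<close>. But
        the step function vanishes at \<open>x\<close>, hence on the whole adapted piece around
        \<open>x\<close>, and its graph shows that the value 0 is admissible on that piece.\<close>
      assume fx: "f x = 0" "x \<notin> \<Union>\<DD>"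
      have "x \<in> cover T1" using T1(2) x by simp
      then obtain t P where P: "(t, P) \<in> T1" "x \<in> P" by (rule in_coverE)
      have "(f x, z) \<in> \<B>" if "z \<in> P" for z
        unfolding fx(1) by (rule zero[OF T1(3)[OF P(1)] tagged_SS[OF T1(1) P(1)] P(2) that sX[OF xX fx(2)]])
      moreover have "P \<in> snd ` T1" using P(1) by force
      ultimately show ?thesis using P(2) tagged_SS[OF T1(1) P(1)] by (intro exI[of _ P]) auto
    qed
  qed
  from bchoice[OF this] obtain g where g: "\<forall>x\<in>B. x \<in> g x \<and> g x \<in> \<DD> \<union> snd ` T1 \<and> g x \<in> \<SS> \<and> (\<forall>z\<in>g x. (f x, z) \<in> \<B>)" ..
  have "\<exists>h. is_gauge B h \<and> (\<forall>x\<in>B. h x \<subseteq> g x)"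
  proof (rule gauge_refine[OF B])
    have "countable (\<DD> \<union> snd ` T1)" using env(2) tagged_countable[OF T1(1)] by simp
    moreover have "g ` B \<subseteq> \<DD> \<union> snd ` T1" using g by auto
    ultimately show "countable (g ` B)" by (rule countable_subset[rotated])
    show "x \<in> g x \<and> g x \<in> Sig" if "x \<in> B" for x using g that SS_Sig by auto
  qed
  then obtain h where h: "is_gauge B h" "\<forall>x\<in>B. h x \<subseteq> g x" by (elim exE conjE)
  \<comment> \<open>Outside \<open>B\<close> the value 0 is admissible for one of two reasons: the
    point lies in a member of \<open>\<DD>\<close> that admits 0, or off
    \<open>\<Union>\<DD>\<close>, where it lies in a piece on which the step function
    vanishes.\<close>
  define \<F> where "\<F> = {D \<in> \<DD>. 0 \<in> common_section \<B> D} \<union> {P \<in> snd ` T2. ?s (point P) = 0}"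
  show ?thesis
  proof (rule that[OF h(1)])
    show "(f x, z) \<in> \<B>" if xz: "x \<in> B" "z \<in> h x" for x z
    proof -
      have "z \<in> g x" using h(2) xz by auto
      then show ?thesis using bspec[OF g xz(1)] by simp
    qed
    have "countable (\<DD> \<union> snd ` T2)" using env(2) tagged_countable[OF T2(1)] by simp
    moreover have "\<F> \<subseteq> \<DD> \<union> snd ` T2" by (auto simp: \<F>_def)
    ultimately show "countable \<F>" by (rule countable_subset[rotated])
    show "\<F> \<subseteq> \<SS>" using env(1) tagged_snd_SS[OF T2(1)] by (auto simp: \<F>_def)
    show "(0, z) \<in> \<B>" if F: "F \<in> \<F>" "z \<in> F" for F z
    proof (cases "0 \<in> common_section \<B> F")
      case True
      then show ?thesis using F(2) by (rule common_sectionD)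
    next
      case False
      then obtain t where t: "(t, F) \<in> T2" "?s (point F) = 0" using F(1) by (auto simp: \<F>_def)
      show ?thesis
        by (rule zero[OF T2(3)[OF t(1)] tagged_SS[OF T2(1) t(1)] point_in[OF tagged_nonempty[OF T2(1) t(1)]] F(2) t(2)])
    qed
    show "\<Union>(E ` K) \<subseteq> B \<union> \<Union>\<F>"
    proof
      fix z assume z: "z \<in> \<Union>(E ` K)"
      then have zX: "z \<in> X" using step(2) SS_subset by auto
      show "z \<in> B \<union> \<Union>\<F>"
      proof (cases "z \<in> B")
        case False
        from zero_outside_graphD(2)[OF graph zX False] show ?thesis
        proof (rule in_envelopeE[OF env(3)])
          fix D assume "D \<in> \<DD>" "z \<in> D" "0 \<in> common_section \<B> D"
          then have "D \<in> \<F>" by (simp add: \<F>_def)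
          then show ?thesis using \<open>z \<in> D\<close> by auto
        next
          assume "z \<notin> \<Union>\<DD>"
          then have sz: "?s z = 0" using sX[OF zX] by simp
          have "z \<in> cover T2" using T2(2) z by simp
          then obtain t P where P: "(t, P) \<in> T2" "z \<in> P" by (rule in_coverE)
          have "?s (point P) = 0"
            using steps_adapted[OF T2(3)[OF P(1)] P(2) point_in[OF tagged_nonempty[OF T2(1) P(1)]], of c] sz by simp
          then have "P \<in> \<F>" using P(1) by (force simp: \<F>_def)
          then show ?thesis using P(2) by auto
        qed
      qed simp
    qed
  qed
qed

text \<open>The given step function has integral \<open>\<sigma>\<close>. Overwriting it by
  \<open>f\<close> along \<open>\<Omega>\<close> and by 0 on the sets of \<open>\<F>\<close> gives
  an element of \<open>R\<close>. What remains are its values on pieces whose tags lie outside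
  \<open>\<Omega>\<close>; they are small by the Cauchy property along the partition
  \<open>T\<close>, which has to be fixed before \<open>\<Omega>\<close> in order to yield
  \<open>\<Xi>\<close>.\<close>

lemma good_of_envelope:
  assumes B: "B \<in> Sig" and env: "envelope X \<SS> \<B>"
    and graph: "graph_on X (zero_outside f B) \<subseteq> \<B>" and W: "0 \<in> interior W"
  defines "R \<equiv> raw_integral \<B>"
  shows "\<exists>h. good B h (sdiff (sdiff R (sdiff R R)) (sdiff (sdiff W W) (sdiff W W)))"
proof -
  obtain s0 \<DD> where s0: "step_function \<SS> s0" "graph_on X s0 \<subseteq> \<B>"
    and D: "\<DD> \<subseteq> \<SS>" "countable \<DD>" "\<B> = (\<Union>D\<in>\<DD>. common_section \<B> D \<times> D) \<union> ({0} \<times> (X - \<Union>\<DD>))"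
    using env unfolding envelope_def by (elim conjE exE)
  obtain K :: "nat set" and c E where K: "finite K" "\<forall>k\<in>K. E k \<in> \<SS>" "s0 = step_sum K c E"
    using s0(1) unfolding step_function_def by (elim exE conjE)
  have s0_eq: "s0 = steps K c E" unfolding K(3) by (rule ext) (simp add: step_sum_def steps_def)
  have E: "E ` K \<subseteq> \<SS>" using K(2) by auto
  have finE: "finite (E ` K)" using K(1) by simp
  have sB: "(steps K c E x, x) \<in> \<B>" if "x \<in> X" for x
    using s0(2) that unfolding s0_eq by (auto simp: graph_on_def)
  let ?\<psi> = "\<lambda>(t, P). step_val (steps K c E) P"
  define \<sigma> where "\<sigma> = step_integral K c E"
  have sR: "\<sigma> \<in> R" unfolding \<sigma>_def R_def by (rule raw_integralI[OF K(1) E sB])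
  obtain h \<F> where h: "is_gauge B h" "\<And>x z. x \<in> B \<Longrightarrow> z \<in> h x \<Longrightarrow> (f x, z) \<in> \<B>"
    and F: "countable \<F>" "\<F> \<subseteq> \<SS>" "\<And>F z. F \<in> \<F> \<Longrightarrow> z \<in> F \<Longrightarrow> (0, z) \<in> \<B>" "\<Union>(E ` K) \<subseteq> B \<union> \<Union>\<F>"
    using envelope_gauge[OF B D graph K(1) E sB] by metis
  have "good B h (sdiff (sdiff R (sdiff R R)) (sdiff (sdiff W W) (sdiff W W)))"
  proof (rule goodI[OF h(1)])
    fix D assume D: "is_fine B h D" "cover D = B"
    have Dt: "tagged D" using D(1) by (rule fine_tagged)
    \<comment> \<open>The tag keeps the whole member \<open>d\<close> of the division and not only
      its point, so that each piece can be traced to the set it was cut from. \<open>None\<close>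
      marks the pieces that receive the value 0.\<close>
    define v :: "('x \<times> 'x set) option \<Rightarrow> 'v" where "v t = (case t of None \<Rightarrow> 0 | Some d \<Rightarrow> f (fst d))" for t
    have vD: "(v (Some d), z) \<in> \<B>" if d: "d \<in> D" "z \<in> snd d" for d z
    proof -
      have "fst d \<in> B" "snd d \<subseteq> h (fst d)" using fineD[OF D(1), of "fst d" "snd d"] d(1) by auto
      then show ?thesis using h(2) d(2) by (auto simp: v_def)
    qed
    define \<G> where "\<G> = (\<lambda>d. (Some d, snd d)) ` D \<union> Pair None ` \<F>"
    have "\<exists>T. tagged T \<and> cover T = cover \<G> \<and> (\<forall>(t, P)\<in>T. adapted (E ` K) P \<and> (\<exists>G. (t, G) \<in> \<G> \<and> P \<subseteq> G))"
    proof (rule refine_adapted[OF finE E])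
      show "countable \<G>" using tagged_countable[OF Dt] F(1) by (simp add: \<G>_def)
      show "G \<in> Sig" if "(t, G) \<in> \<G>" for t G
        using that tagged_snd_SS[OF Dt] F(2) SS_Sig by (auto simp: \<G>_def)
    qed
    then obtain T where T: "tagged T" "cover T = cover \<G>"
      "\<forall>(t, P)\<in>T. adapted (E ` K) P \<and> (\<exists>G. (t, G) \<in> \<G> \<and> P \<subseteq> G)" by (elim exE conjE)
    have Ta: "adapted (E ` K) P" if "(t, P) \<in> T" for t P using T(3) that by auto
    have TS: "d \<in> D \<and> P \<subseteq> snd d" if "(Some d, P) \<in> T" for d P
      using T(3) that by (auto simp: \<G>_def)
    have TN: "(0, z) \<in> \<B>" if tP: "(None, P) \<in> T" "z \<in> P" for P z
    proof -
      obtain G where "G \<in> \<F>" "P \<subseteq> G" using T(3) tP(1) by (auto simp: \<G>_def)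
      then show ?thesis using F(3)[of G z] tP(2) by auto
    qed
    have "cover \<G> = B \<union> \<Union>\<F>" using D(2) by (simp add: \<G>_def cover_def image_Un image_image)
    then have Tc: "\<Union>(E ` K) \<subseteq> cover T" using T(2) F(4) by simp
    have "(?\<psi> has_sum \<sigma>) T" unfolding \<sigma>_def by (rule steps_has_sum[OF K(1) E T(1) Ta Tc])
    from has_sum_nbhd[OF this W] obtain Y0 where Y0: "finite Y0" "Y0 \<subseteq> T"
      "\<forall>Y. finite Y \<longrightarrow> Y0 \<subseteq> Y \<longrightarrow> Y \<subseteq> T \<longrightarrow> sum ?\<psi> Y - \<sigma> \<in> W"
        by (elim exE conjE)
    \<comment> \<open>As soon as \<open>\<Omega>\<close> contains \<open>\<Xi>\<close>, no piece in
      \<open>Y0\<close> has a tag outside \<open>\<Omega>\<close>; pieces with such tags may then be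
      added to \<open>Y0\<close> in the Cauchy estimate.\<close>
    define \<Xi> where "\<Xi> = {d \<in> D. \<exists>P. (Some d, P) \<in> Y0}"
    have Xi: "finite \<Xi>" "\<Xi> \<subseteq> D"
    proof -
      have "\<Xi> \<subseteq> (\<lambda>p. the (fst p)) ` Y0" by (force simp: \<Xi>_def)
      then show "finite \<Xi>" using Y0(1) finite_surj by blast
    qed (auto simp: \<Xi>_def)
    have "val \<Omega> \<in> sdiff (sdiff R (sdiff R R)) (sdiff (sdiff W W) (sdiff W W))"
      if O: "finite \<Omega>" "\<Xi> \<subseteq> \<Omega>" "\<Omega> \<subseteq> D" for \<Omega>
    proof -
      have Ot: "tagged \<Omega>" using Dt O(3) by (rule tagged_subset)
      have OS: "snd ` \<Omega> \<subseteq> \<SS>" using tagged_snd_SS[OF Ot] .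
      have finO: "finite (E ` K \<union> snd ` \<Omega>)" "E ` K \<union> snd ` \<Omega> \<subseteq> \<SS>" using finE E O(1) OS by auto
      \<comment> \<open>The partition \<open>T\<close> may have assigned points of
        \<open>\<Omega>\<close> to sets of \<open>\<F>\<close>. The sets of \<open>\<Omega>\<close>
        are therefore partitioned anew with their own tags (\<open>A\<close>), the pieces with tags
        outside \<open>\<Omega>\<close> are kept (\<open>A'\<close>), and the pieces with tag
        \<open>None\<close> are reduced to what lies off \<open>\<Omega>\<close>
        (\<open>A0\<close>).\<close>
      define \<G>1 where "\<G>1 = (\<lambda>d. (Some d, snd d)) ` \<Omega>"
      have "\<exists>T. tagged T \<and> cover T = cover \<G>1 \<and>
          (\<forall>(t, P)\<in>T. adapted (E ` K \<union> snd ` \<Omega>) P \<and> (\<exists>G. (t, G) \<in> \<G>1 \<and> P \<subseteq> G))"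
      proof (rule refine_adapted[OF finO])
        show "countable \<G>1" using tagged_countable[OF Ot] by (simp add: \<G>1_def)
        show "G \<in> Sig" if "(t, G) \<in> \<G>1" for t G using that OS SS_Sig by (auto simp: \<G>1_def)
      qed
      then obtain A where A: "tagged A" "cover A = cover \<G>1"
        "\<forall>(t, P)\<in>A. adapted (E ` K \<union> snd ` \<Omega>) P \<and> (\<exists>G. (t, G) \<in> \<G>1 \<and> P \<subseteq> G)" by (elim exE conjE)
      have Ac: "cover A = cover \<Omega>" unfolding A(2) by (simp add: \<G>1_def cover_def image_image)
      have Aa: "adapted (E ` K) P" "adapted (snd ` \<Omega>) P" if "(t, P) \<in> A" for t P
        using A(3) that by (auto simp: adapted_Un)
      have AS: "\<exists>d. t = Some d \<and> d \<in> \<Omega> \<and> P \<subseteq> snd d" if "(t, P) \<in> A" for t P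
        using A(3) that by (auto simp: \<G>1_def)
      define A' where "A' = {p \<in> T. \<exists>d. fst p = Some d \<and> d \<notin> \<Omega>}"
      define \<G>2 where "\<G>2 = (\<lambda>p. (None :: ('x \<times> 'x set) option, snd p - cover \<Omega>)) ` {p \<in> T. fst p = None}"
      have "\<exists>T. tagged T \<and> cover T = cover \<G>2 \<and> (\<forall>(t, P)\<in>T. adapted (E ` K) P \<and> (\<exists>G. (t, G) \<in> \<G>2 \<and> P \<subseteq> G))"
      proof (rule refine_adapted[OF finE E])
        show "countable \<G>2" using tagged_countable[OF T(1)] by (simp add: \<G>2_def)
        show "G \<in> Sig" if tG: "(t, G) \<in> \<G>2" for t G
        proof -
          obtain p where "p \<in> T" "G = snd p - cover \<Omega>" using tG by (auto simp: \<G>2_def)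
          then show ?thesis
            using Sig_Diff_Sig0[OF SS_Sig cover_Sig0[OF Ot O(1)]] tagged_snd_SS[OF T(1)] by auto
        qed
      qed
      then obtain A0 where A0: "tagged A0" "cover A0 = cover \<G>2"
        "\<forall>(t, P)\<in>A0. adapted (E ` K) P \<and> (\<exists>G. (t, G) \<in> \<G>2 \<and> P \<subseteq> G)" by (elim exE conjE)
      have A0a: "adapted (E ` K) P" if "(t, P) \<in> A0" for t P using A0(3) that by auto
      have A0N: "t = None \<and> (\<exists>P'. (None, P') \<in> T \<and> P \<subseteq> P')" if "(t, P) \<in> A0" for t P
        using A0(3) that by (fastforce simp: \<G>2_def)
      have A't: "tagged A'" using T(1) by (rule tagged_subset) (auto simp: A'_def)
      have A'S: "\<exists>d. t = Some d \<and> d \<in> D \<and> d \<notin> \<Omega> \<and> P \<subseteq> snd d \<and> (t, P) \<in> T" if "(t, P) \<in> A'" for t P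
        using that TS by (auto simp: A'_def)
      have c1: "cover A \<inter> cover A' = {}"
      proof (rule Int_emptyI)
        fix z assume z: "z \<in> cover A" "z \<in> cover A'"
        from z(2) obtain t P where tP: "(t, P) \<in> A'" "z \<in> P" by (rule in_coverE)
        from A'S[OF tP(1)] obtain d where d: "d \<in> D" "d \<notin> \<Omega>" "P \<subseteq> snd d" by auto
        from z(1) have "z \<in> cover \<Omega>" using Ac by simp
        then obtain x F where xF: "(x, F) \<in> \<Omega>" "z \<in> F" by (rule in_coverE)
        have "d = (x, F)"
          using tagged_disjoint[OF Dt d(1), of "(x, F)"] xF O(3) d(3) tP(2) by auto
        then show False using d(2) xF(1) by simp
      qed
      have c2: "cover A \<inter> cover A0 = {}" unfolding Ac A0(2) by (auto simp: \<G>2_def cover_def)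
      have c3: "cover A' \<inter> cover A0 = {}"
      proof (rule Int_emptyI)
        fix z assume z: "z \<in> cover A'" "z \<in> cover A0"
        from z(1) obtain t P where tP: "(t, P) \<in> A'" "z \<in> P" by (rule in_coverE)
        from z(2) obtain t' P' where tP': "(t', P') \<in> A0" "z \<in> P'" by (rule in_coverE)
        from A0N[OF tP'(1)] obtain P'' where P'': "(None, P'') \<in> T" "z \<in> P''" using tP'(2) by auto
        from A'S[OF tP(1)] obtain d where "t = Some d" "(t, P) \<in> T" by auto
        then show False using tagged_eq[OF T(1) _ P''(1) tP(2) P''(2)] by auto
      qed
      have At: "tagged (A \<union> A')" by (rule tagged_Un[OF A(1) A't c1])
      have T't: "tagged (A \<union> A' \<union> A0)" by (rule tagged_Un[OF At A0(1)]) (use c2 c3 in auto)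
      have T'a: "adapted (E ` K) P" if "(t, P) \<in> A \<union> A' \<union> A0" for t P
        using that Aa(1) A0a Ta by (auto simp: A'_def)
      have T'v: "(v t, z) \<in> \<B>" if tP: "(t, P) \<in> A \<union> A' \<union> A0" "z \<in> P" for t P z
      proof -
        consider "(t, P) \<in> A" | "(t, P) \<in> A'" | "(t, P) \<in> A0" using tP(1) by auto
        then show ?thesis
        proof cases
          case 1
          then obtain d where "t = Some d" "d \<in> \<Omega>" "P \<subseteq> snd d" using AS[OF 1] by (elim exE conjE)
          then show ?thesis using vD[of d z] O(3) tP(2) by auto
        next
          case 2
          then obtain d where "t = Some d" "d \<in> D" "P \<subseteq> snd d" using A'S[OF 2] by (elim exE conjE)
          then show ?thesis using vD[of d z] tP(2) by auto
        next
          case 3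
          from A0N[OF this] obtain P' where "t = None" "(None, P') \<in> T" "P \<subseteq> P'" by (elim exE conjE)
          then show ?thesis using TN[of P' z] tP(2) by (auto simp: v_def)
        qed
      qed
      have T'c: "cover T \<subseteq> cover (A \<union> A' \<union> A0)"
      proof
        fix z assume "z \<in> cover T"
        then obtain t P where tP: "(t, P) \<in> T" "z \<in> P" by (rule in_coverE)
        show "z \<in> cover (A \<union> A' \<union> A0)"
        proof (cases "z \<in> cover \<Omega>")
          case True
          then show ?thesis using Ac by simp
        next
          case z: False
          show ?thesis
          proof (cases t)
            case None
            then have "z \<in> cover \<G>2" using tP z by (force simp: \<G>2_def cover_def)
            then show ?thesis using A0(2) by simp
          next
            case (Some d)
            have "z \<in> snd d" using TS[of d P] tP Some by auto
            then have "d \<notin> \<Omega>" using z by (auto simp: cover_def)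
            then have "(t, P) \<in> A'" using tP(1) Some unfolding A'_def by (intro CollectI conjI exI[of _ d]) simp_all
            then have "z \<in> cover A'" using tP(2) by (rule in_coverI)
            then show ?thesis by simp
          qed
        qed
      qed
      have "(?\<psi> has_sum \<sigma>) (A \<union> A' \<union> A0)"
        unfolding \<sigma>_def by (rule steps_has_sum[OF K(1) E T't T'a subset_trans[OF Tc T'c]])
      from has_sum_nbhd[OF this W] obtain Y1 where Y1: "finite Y1" "Y1 \<subseteq> A \<union> A' \<union> A0"
        "\<forall>Y. finite Y \<longrightarrow> Y1 \<subseteq> Y \<longrightarrow> Y \<subseteq> A \<union> A' \<union> A0 \<longrightarrow> sum ?\<psi> Y - \<sigma> \<in> W"
        by (elim exE conjE)
      let ?V = "\<lambda>(t, P). L (v t) (\<mu> P)"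
      have "step_integral \<Omega> (\<lambda>d. f (fst d)) snd = val \<Omega>"
        by (simp add: step_integral_def val_def case_prod_beta)
      moreover have "((\<lambda>(t, P). step_val (steps \<Omega> (\<lambda>d. f (fst d)) snd) P) has_sum step_integral \<Omega> (\<lambda>d. f (fst d)) snd) A"
        by (rule steps_has_sum[OF O(1) OS A(1) Aa(2)]) (assumption, unfold Ac, unfold cover_def, rule subset_refl)
      ultimately have "((\<lambda>(t, P). step_val (steps \<Omega> (\<lambda>d. f (fst d)) snd) P) has_sum val \<Omega>) A"
        by (simp only:)
      moreover have "(\<lambda>(t, P). step_val (steps \<Omega> (\<lambda>d. f (fst d)) snd) P) p = ?V p" if p: "p \<in> A" for p
      proof -
        obtain t P where tP: "p = (t, P)" by (cases p)
        then obtain d where d: "t = Some d" "d \<in> \<Omega>" "P \<subseteq> snd d" using AS[of t P] p by auto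
        have pt: "point P \<in> snd d" using point_in[OF tagged_nonempty[OF A(1)], of t P] p tP d(3) by auto
        have "steps \<Omega> (\<lambda>d. f (fst d)) snd (point P) = (\<Sum>e\<in>\<Omega>. if e = d then f (fst e) else 0)"
          unfolding steps_def
        proof (rule sum.cong[OF refl])
          fix e assume "e \<in> \<Omega>"
          then have "point P \<in> snd e \<longleftrightarrow> e = d" using tagged_disjoint[OF Ot _ d(2), of e] pt by auto
          then show "(if point P \<in> snd e then f (fst e) else 0) = (if e = d then f (fst e) else 0)" by simp
        qed
        also have "\<dots> = f (fst d)" using O(1) d(2) by simp
        finally show ?thesis by (simp add: tP d(1) v_def)
      qed
      ultimately have "(?V has_sum val \<Omega>) A" by (rule has_sum_cong[THEN iffD1, rotated])
      from has_sum_nbhd[OF this W] obtain Y2 where Y2: "finite Y2" "Y2 \<subseteq> A"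
        "\<forall>Y. finite Y \<longrightarrow> Y2 \<subseteq> Y \<longrightarrow> Y \<subseteq> A \<longrightarrow> sum ?V Y - val \<Omega> \<in> W"
        by (elim exE conjE)
      define Q where "Q = Y1 \<union> Y2"
      have Q: "finite Q" "Q \<subseteq> A \<union> A' \<union> A0" using Y1(1,2) Y2(1,2) by (auto simp: Q_def)
      have e1: "sum ?\<psi> Q - \<sigma> \<in> W" by (rule Y1(3)[rule_format, OF Q(1) _ Q(2)]) (simp add: Q_def)
      have e2: "sum ?V (Q \<inter> A) - val \<Omega> \<in> W" by (rule Y2(3)[rule_format]) (use Q(1) Y2(2) in \<open>auto simp: Q_def\<close>)
      have m1: "\<sigma> + (sum ?V Q - sum ?\<psi> Q) \<in> R" unfolding \<sigma>_def R_def
        by (rule raw_integral_modify[OF K(1) E sB Q(1) tagged_subset[OF T't Q(2)] T'a[OF subsetD[OF Q(2)]]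
              T'v[OF subsetD[OF Q(2)]]])
      have QA': "Q \<inter> A' \<subseteq> T" by (auto simp: A'_def)
      have QA'': "Q \<inter> A' \<subseteq> A \<union> A' \<union> A0" by auto
      \<comment> \<open>The same overwriting restricted to \<open>A'\<close>. In the difference of
        both results the effect of the tags outside \<open>\<Omega>\<close> cancels, and only the
        changes on \<open>A\<close> and \<open>A0\<close> are left.\<close>
      have m2: "\<sigma> + (sum ?V (Q \<inter> A') - sum ?\<psi> (Q \<inter> A')) \<in> R" unfolding \<sigma>_def R_def
        by (rule raw_integral_modify[OF K(1) E sB finite_Int[OF disjI1[OF Q(1)]]
              tagged_subset[OF T(1) QA'] T'a[OF subsetD[OF QA'']] T'v[OF subsetD[OF QA'']]])
      have "sum ?\<psi> (Y0 \<union> (Q \<inter> A')) - \<sigma> \<in> W" "sum ?\<psi> Y0 - \<sigma> \<in> W"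
        by (rule Y0(3)[rule_format]; use Y0(1,2) Q(1) QA' in auto)+
      moreover have "sum ?\<psi> (Y0 \<union> (Q \<inter> A')) = sum ?\<psi> Y0 + sum ?\<psi> (Q \<inter> A')"
      proof (rule sum.union_disjoint)
        show "Y0 \<inter> (Q \<inter> A') = {}"
        proof (rule Int_emptyI)
          fix p assume p: "p \<in> Y0" "p \<in> Q \<inter> A'"
          then obtain d where d: "fst p = Some d" "d \<notin> \<Omega>" by (auto simp: A'_def)
          have "(Some d, snd p) \<in> T" "(Some d, snd p) \<in> Y0" using p(1) Y0(2) d(1)[symmetric] by auto
          then have "d \<in> \<Xi>" using TS[of d "snd p"] by (auto simp: \<Xi>_def)
          then show False using O(2) d(2) by auto
        qed
      qed (use Y0(1) Q(1) in auto)
      ultimately obtain w3 w4 where e3: "w3 \<in> W" "w4 \<in> W"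
        "w3 = sum ?\<psi> Y0 + sum ?\<psi> (Q \<inter> A') - \<sigma>" "w4 = sum ?\<psi> Y0 - \<sigma>" by simp
      have "sum ?V Q = sum ?V (Q \<inter> A) + sum ?V (Q \<inter> A')"
      proof -
        have d1: "A \<inter> A' = {}" by (rule cover_disjoint_imp[OF A(1) c1])
        have "sum ?V ((Q \<inter> A) \<union> (Q \<inter> A')) = sum ?V (Q \<inter> A) + sum ?V (Q \<inter> A')"
          by (rule sum.union_disjoint) (use Q(1) d1 in auto)
        moreover have "sum ?V ((Q \<inter> A) \<union> (Q \<inter> A')) = sum ?V Q"
        proof (rule sum.mono_neutral_left[OF Q(1)])
          show "\<forall>p\<in>Q - (Q \<inter> A \<union> Q \<inter> A'). ?V p = 0"
          proof
            fix p assume "p \<in> Q - (Q \<inter> A \<union> Q \<inter> A')"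
            then have "(fst p, snd p) \<in> A0" using Q(2) by auto
            then have "fst p = None" using A0N[of "fst p" "snd p"] by simp
            then show "?V p = 0" by (simp add: case_prod_beta v_def)
          qed
        qed auto
        ultimately show ?thesis by simp
      qed
      define r1 where "r1 = \<sigma> + (sum ?V Q - sum ?\<psi> Q)"
      define r2 where "r2 = \<sigma> + (sum ?V (Q \<inter> A') - sum ?\<psi> (Q \<inter> A'))"
      define w1 where "w1 = sum ?V (Q \<inter> A) - val \<Omega>"
      define w2 where "w2 = sum ?\<psi> Q - \<sigma>"
      \<comment> \<open>The term \<open>r1 - (r2 - \<sigma>)\<close> differs from the sum over
        \<open>Q \<inter> A\<close> by \<open>- w2\<close> and by the step values on
        \<open>Q \<inter> A'\<close>, which are \<open>w3 - w4\<close>; the sum over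
        \<open>Q \<inter> A\<close> differs from \<open>val \<Omega>\<close> by
        \<open>w1\<close>.\<close>
      have "val \<Omega> = (r1 - (r2 - \<sigma>)) - ((w3 - w2) - (w4 - w1))"
        unfolding r1_def r2_def w1_def w2_def e3(3,4) \<open>sum ?V Q = _\<close> by (simp add: algebra_simps)
      moreover have "r1 \<in> R" "r2 \<in> R" "w1 \<in> W" "w2 \<in> W"
        using m1 m2 e1 e2 by (simp_all add: r1_def r2_def w1_def w2_def)
      ultimately show ?thesis using sR e3(1,2) by (simp add: sdiffI)
    qed
    then show "\<exists>\<Xi>. finite \<Xi> \<and> \<Xi> \<subseteq> D \<and> (\<forall>\<Omega>. finite \<Omega> \<longrightarrow> \<Xi> \<subseteq> \<Omega> \<longrightarrow> \<Omega> \<subseteq> D \<longrightarrow>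
        val \<Omega> \<in> sdiff (sdiff R (sdiff R R)) (sdiff (sdiff W W) (sdiff W W)))"
      using Xi by (intro exI[of _ \<Xi>]) auto
  qed
  from exI[of "\<lambda>h. good B h (sdiff (sdiff R (sdiff R R)) (sdiff (sdiff W W) (sdiff W W)))", OF this]
  show ?thesis .
qed

lemma envelope_of_good:
  assumes good: "good B h G" and W: "0 \<in> interior W"
  shows "\<exists>\<B>. envelope X \<SS> \<B> \<and> graph_on X (zero_outside f B) \<subseteq> \<B> \<and>
    raw_integral \<B> \<subseteq> sdiff (sdiff G (sdiff (sdiff G G) (sdiff G G))) W"
proof -
  have g: "is_gauge B h" using good by (rule good_gauge)
  have BS: "B \<in> Sig" using g by (rule gauge_Sig)
  have BX: "B \<subseteq> X" using BS by (rule Sig_subset)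
  obtain D where D: "is_fine B h D" "cover D = B" using fine_exists[OF g BS subset_refl] by auto
  have Dt: "tagged D" using D(1) by (rule fine_tagged)
  obtain h' \<Xi> where h': "is_gauge B h'" "\<And>x. x \<in> B \<Longrightarrow> h' x \<subseteq> h x"
    and Xi: "finite \<Xi>" "\<Xi> \<subseteq> D" "val \<Xi> \<in> G"
    and off: "\<And>\<Omega>. finite \<Omega> \<Longrightarrow> is_fine B h' \<Omega> \<Longrightarrow> cover \<Omega> \<inter> cover \<Xi> = {} \<Longrightarrow> val \<Omega> \<in> sdiff G G"
    using good_small_off[OF good D] by metis
  have Xt: "tagged \<Xi>" using Dt Xi(2) by (rule tagged_subset)
  have Xf: "is_fine B h \<Xi>" using D(1) Xi(2) by (rule fine_subset)
  have XB: "cover \<Xi> \<subseteq> B" using cover_mono[OF Xi(2)] D(2) by simp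
  \<comment> \<open>The gauge sets of \<open>h'\<close> already cover \<open>B\<close>. The members
    of \<open>\<Xi>\<close> are added so that the step function with the values of \<open>f\<close>
    along \<open>\<Xi>\<close> lies in the envelope.\<close>
  define \<P> where "\<P> = (\<lambda>y. (y, h' y)) ` B \<union> \<Xi>"
  have P: "y \<in> B" "H \<subseteq> h y" "H \<in> \<SS>" "H = h' y \<or> (y, H) \<in> \<Xi>" if yH: "(y, H) \<in> \<P>" for y H
  proof -
    consider "y \<in> B" "H = h' y" | "(y, H) \<in> \<Xi>" using yH by (auto simp: \<P>_def)
    then have "y \<in> B \<and> H \<subseteq> h y \<and> H \<in> \<SS> \<and> (H = h' y \<or> (y, H) \<in> \<Xi>)"
    proof cases
      case 1
      then show ?thesis using gaugeD(2)[OF h'(1)] h'(2) by auto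
    next
      case 2
      then show ?thesis using fineD[OF Xf 2] tagged_SS[OF Xt 2] by auto
    qed
    then show "y \<in> B" "H \<subseteq> h y" "H \<in> \<SS>" "H = h' y \<or> (y, H) \<in> \<Xi>" by auto
  qed
  have PB: "H \<subseteq> B" if "(y, H) \<in> \<P>" for y H
    using P(1,2)[OF that] gaugeD(3)[OF g] by auto
  have Pc: "countable (snd ` \<P>)" "snd ` \<P> \<subseteq> \<SS>"
  proof -
    have "snd ` \<P> = h' ` B \<union> snd ` \<Xi>" by (auto simp: \<P>_def image_Un image_image)
    then show "countable (snd ` \<P>)" using gauge_countable[OF h'(1)] Xi(1) by (simp add: countable_finite)
    show "snd ` \<P> \<subseteq> \<SS>" using P(3) by auto
  qed
  define \<B> where "\<B> = {(f y, z) |y z. \<exists>H. (y, H) \<in> \<P> \<and> z \<in> H} \<union> {0} \<times> (X - cover \<Xi>)"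
  have BI: "(f y, z) \<in> \<B>" if "(y, H) \<in> \<P>" "z \<in> H" for y H z using that by (auto simp: \<B>_def)
  have B0: "(0, z) \<in> \<B>" if "z \<in> X" "z \<notin> cover \<Xi>" for z using that by (simp add: \<B>_def)
  have BE: "(\<exists>y H. v = f y \<and> (y, H) \<in> \<P> \<and> z \<in> H) \<or> (v = 0 \<and> z \<in> X \<and> z \<notin> cover \<Xi>)"
    if "(v, z) \<in> \<B>" for v z using that by (auto simp: \<B>_def)
  have BsubX: "\<B> \<subseteq> UNIV \<times> X" using PB BX by (fastforce simp: \<B>_def)
  have graph: "graph_on X (zero_outside f B) \<subseteq> \<B>"
  proof -
    have "(zero_outside f B x, x) \<in> \<B>" if x: "x \<in> X" for x
    proof (cases "x \<in> B")
      case True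
      then have "(x, h' x) \<in> \<P>" "x \<in> h' x" using gaugeD(1)[OF h'(1)] by (auto simp: \<P>_def)
      then show ?thesis using BI True by (simp add: zero_outside_def)
    next
      case False
      then show ?thesis using B0[OF x] XB by (auto simp: zero_outside_def)
    qed
    then show ?thesis by (auto simp: graph_on_def)
  qed
  have env: "envelope X \<SS> \<B>"
  proof -
    have st1: "steps \<Xi> (\<lambda>p. f (fst p)) snd x = f (fst q)" if q: "q \<in> \<Xi>" "x \<in> snd q" for q x
    proof -
      have "steps \<Xi> (\<lambda>p. f (fst p)) snd x = (\<Sum>p\<in>\<Xi>. if p = q then f (fst p) else 0)"
        unfolding steps_def
      proof (rule sum.cong[OF refl])
        fix p assume "p \<in> \<Xi>"
        then have "x \<in> snd p \<longleftrightarrow> p = q" using tagged_disjoint[OF Xt _ q(1), of p] q(2) by auto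
        then show "(if x \<in> snd p then f (fst p) else 0) = (if p = q then f (fst p) else 0)" by simp
      qed
      then show ?thesis using Xi(1) q by simp
    qed
    have st0: "steps \<Xi> (\<lambda>p. f (fst p)) snd x = 0" if "x \<notin> cover \<Xi>" for x
      unfolding steps_def by (rule sum.neutral) (use that in \<open>auto simp: cover_def\<close>)
    have "(steps \<Xi> (\<lambda>p. f (fst p)) snd x, x) \<in> \<B>" if x: "x \<in> X" for x
    proof (cases "x \<in> cover \<Xi>")
      case True
      then obtain y H where yH: "(y, H) \<in> \<Xi>" "x \<in> H" by (rule in_coverE)
      have "(y, H) \<in> \<P>" using yH(1) by (simp add: \<P>_def)
      from BI[OF this yH(2)] show ?thesis using st1[of "(y, H)" x] yH by simp
    next
      case False
      then show ?thesis using B0[OF x False] st0[OF False] by simp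
    qed
    then have "graph_on X (steps \<Xi> (\<lambda>p. f (fst p)) snd) \<subseteq> \<B>" by (auto simp: graph_on_def)
    moreover have "step_function \<SS> (steps \<Xi> (\<lambda>p. f (fst p)) snd)"
    proof -
      obtain J :: "nat set" and b where J: "finite J" "bij_betw b J \<Xi>"
        "\<And>c E. step_sum J (c \<circ> b :: _ \<Rightarrow> 'v) (E \<circ> b :: _ \<Rightarrow> 'x set) = steps \<Xi> c E"
        using steps_nat[OF Xi(1)] by metis
      have "\<forall>j\<in>J. (snd \<circ> b) j \<in> \<SS>" using J(2) tagged_snd_SS[OF Xt] by (auto simp: bij_betw_def)
      then show ?thesis unfolding step_function_def J(3)[symmetric] using J(1)
        by (intro exI[of _ J] exI[of _ "(\<lambda>p. f (fst p)) \<circ> b"] exI[of _ "snd \<circ> b"] conjI) simp_all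
    qed
    moreover have "\<exists>\<DD>. \<DD> \<subseteq> \<SS> \<and> countable \<DD> \<and>
        \<B> = (\<Union>D\<in>\<DD>. common_section \<B> D \<times> D) \<union> ({0} \<times> (X - \<Union>\<DD>))"
    proof -
      have "B - cover \<Xi> \<in> Sig" using Sig_Diff_Sig0[OF BS cover_Sig0[OF Xt Xi(1)]] .
      then obtain \<R> where R: "\<R> \<subseteq> \<SS>" "countable \<R>" "B - cover \<Xi> = \<Union>\<R>" by (rule in_SigE)
      \<comment> \<open>The family \<open>\<R>\<close> accounts for the value 0 on \<open>B\<close>
        off \<open>\<Xi>\<close>; outside \<open>B\<close>, which is the union of
        \<open>\<DD>\<close>, the value 0 is part of the form of an envelope.\<close>
      define \<DD> where "\<DD> = snd ` \<P> \<union> \<R>"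
      have UD: "\<Union>\<DD> = B"
      proof -
        have "\<Union>(snd ` \<P>) = B"
        proof
          show "\<Union>(snd ` \<P>) \<subseteq> B" by (rule Union_least) (use PB in fastforce)
          show "B \<subseteq> \<Union>(snd ` \<P>)" using gaugeD(1)[OF h'(1)] by (auto simp: \<P>_def)
        qed
        then show ?thesis unfolding \<DD>_def Union_Un_distrib R(3)[symmetric] by auto
      qed
      have "\<B> = (\<Union>D\<in>\<DD>. common_section \<B> D \<times> D) \<union> ({0} \<times> (X - \<Union>\<DD>))"
      proof
        show "\<B> \<subseteq> (\<Union>D\<in>\<DD>. common_section \<B> D \<times> D) \<union> ({0} \<times> (X - \<Union>\<DD>))"
        proof (rule subrelI)
          fix v z assume "(v, z) \<in> \<B>"
          from BE[OF this] show "(v, z) \<in> (\<Union>D\<in>\<DD>. common_section \<B> D \<times> D) \<union> ({0} \<times> (X - \<Union>\<DD>))"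
          proof (elim disjE exE conjE)
            fix y H assume yH: "v = f y" "(y, H) \<in> \<P>" "z \<in> H"
            then have "H \<in> \<DD>" "v \<in> common_section \<B> H"
              using BI[OF yH(2)] by (force simp: \<DD>_def common_section_def)+
            then show ?thesis using yH(3) by auto
          next
            assume z: "v = 0" "z \<in> X" "z \<notin> cover \<Xi>"
            show ?thesis
            proof (cases "z \<in> B")
              case True
              then have "z \<in> \<Union>\<R>" using R(3) z(3) by auto
              then obtain F where F: "F \<in> \<R>" "z \<in> F" by auto
              have "F \<subseteq> B - cover \<Xi>" using F(1) R(3) by auto
              then have "0 \<in> common_section \<B> F" using B0 BX by (auto simp: common_section_def)
              then show ?thesis using F z(1) by (auto simp: \<DD>_def)
            next
              case False
              then show ?thesis using z UD by auto
            qed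
          qed
        qed
        show "(\<Union>D\<in>\<DD>. common_section \<B> D \<times> D) \<union> ({0} \<times> (X - \<Union>\<DD>)) \<subseteq> \<B>"
        proof (rule subrelI)
          fix v z assume "(v, z) \<in> (\<Union>D\<in>\<DD>. common_section \<B> D \<times> D) \<union> ({0} \<times> (X - \<Union>\<DD>))"
          then consider F where "F \<in> \<DD>" "v \<in> common_section \<B> F" "z \<in> F" | "v = 0" "z \<in> X" "z \<notin> B"
            unfolding UD by auto
          then show "(v, z) \<in> \<B>"
          proof cases
            case 1
            show ?thesis using 1(2,3) by (rule common_sectionD)
          next
            case 2
            then show ?thesis using B0[of z] XB by auto
          qed
        qed
      qed
      moreover have "\<DD> \<subseteq> \<SS>" "countable \<DD>" using Pc R by (auto simp: \<DD>_def)
      ultimately show ?thesis by (intro exI[of _ \<DD>] conjI)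
    qed
    ultimately show ?thesis unfolding envelope_def using BsubX by auto
  qed
  have "r \<in> sdiff (sdiff G (sdiff (sdiff G G) (sdiff G G))) W" if "r \<in> raw_integral \<B>" for r
  proof -
    obtain J :: "nat set" and c E where J: "finite J" "\<forall>j\<in>J. E j \<in> \<SS>"
      "graph_on X (step_sum J c E) \<subseteq> \<B>" "r = step_integral J c E"
      using \<open>r \<in> raw_integral \<B>\<close> unfolding raw_integral_def by auto
    let ?s = "steps J c E"
    have "step_sum J c E = ?s" by (rule ext) (simp add: step_sum_def steps_def)
    then have sB: "(?s x, x) \<in> \<B>" if "x \<in> X" for x using J(3) that by (auto simp: graph_on_def)
    have EJ: "E ` J \<subseteq> \<SS>" using J(2) by auto
    let ?A = "E ` J \<union> snd ` \<Xi>"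
    have A: "finite ?A" "?A \<subseteq> \<SS>" using J(1) Xi(1) EJ tagged_snd_SS[OF Xt] by auto
    define U where "U = B \<union> \<Union>(E ` J)"
    have US: "U \<in> Sig" unfolding U_def
      by (rule Sig_Un[OF BS Sig0_Sig[OF Sig0_Union]]) (use J(1) EJ in auto)
    obtain T1 :: "(unit \<times> 'x set) set" where T1: "tagged T1" "cover T1 = U"
      "\<And>t P. (t, P) \<in> T1 \<Longrightarrow> adapted ?A P"
      using adapted_partition[OF A US] by metis
    have T1a: "adapted (E ` J) P" "adapted (snd ` \<Xi>) P" if "P \<in> snd ` T1" for P
      using T1(3)[of "()" P] that by (auto simp: adapted_Un)
    have const: "?s z = ?s (point P)" if "adapted (E ` J) P" "z \<in> P" for z P
      by (rule steps_adapted[OF that point_in]) (use that in auto)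
    have inX: "P = {} \<or> P \<inter> cover \<Xi> = {} \<or> P \<subseteq> cover \<Xi>" if P: "adapted (snd ` \<Xi>) P" for P
    proof -
      have "P \<subseteq> cover \<Xi>" if "H \<in> snd ` \<Xi>" "P \<inter> H \<noteq> {}" for H
        using P that by (auto simp: adapted_def cover_def)
      then show ?thesis by (auto simp: cover_def)
    qed
    define ok where "ok y H P \<longleftrightarrow> (y, H) \<in> \<P> \<and> f y = ?s (point P)" for y H P
    \<comment> \<open>Uncountably many points \<open>y\<close> may have the same set
      \<open>H\<close> and the same value \<open>f y\<close>. One tag for each pair of
      \<open>H\<close> and \<open>P\<close> keeps the tagged family countable.\<close>
    define ch where "ch H P = (SOME y. ok y H P)" for H P
    have ch: "ok (ch H P) H P" if "ok y H P" for y H P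
      unfolding ch_def using that by (rule someI)
    define \<G>a where "\<G>a = (\<lambda>(H, P). (Some (ch H P, H), P \<inter> H)) ` {(H, P) \<in> snd ` \<P> \<times> snd ` T1. \<exists>y. ok y H P}"
    define \<G>b where "\<G>b = Pair (None :: ('x \<times> 'x set) option) ` {P \<in> snd ` T1. P \<inter> cover \<Xi> = {} \<and> ?s (point P) = 0}"
    have T1S: "snd ` T1 \<subseteq> \<SS>" using tagged_snd_SS[OF T1(1)] .
    have "\<exists>T. tagged T \<and> cover T = cover (\<G>a \<union> \<G>b) \<and>
        (\<forall>(t, P)\<in>T. adapted ?A P \<and> (\<exists>G. (t, G) \<in> \<G>a \<union> \<G>b \<and> P \<subseteq> G))"
    proof (rule refine_adapted[OF A])
      have cT1: "countable (snd ` T1)" using tagged_countable[OF T1(1)] by simp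
      have "countable {(H, P) \<in> snd ` \<P> \<times> snd ` T1. \<exists>y. ok y H P}"
        by (rule countable_subset[of _ "snd ` \<P> \<times> snd ` T1"]) (use Pc(1) cT1 in auto)
      moreover have "countable {P \<in> snd ` T1. P \<inter> cover \<Xi> = {} \<and> ?s (point P) = 0}"
        by (rule countable_subset[OF _ cT1]) auto
      ultimately show "countable (\<G>a \<union> \<G>b)" by (simp add: \<G>a_def \<G>b_def)
      fix t F assume "(t, F) \<in> \<G>a \<union> \<G>b"
      then consider H P where "F = P \<inter> H" "H \<in> snd ` \<P>" "P \<in> snd ` T1" | "F \<in> snd ` T1"
        by (auto simp: \<G>a_def \<G>b_def)
      then show "F \<in> Sig"
      proof cases
        case 1
        then have "P \<in> \<SS>" "H \<in> \<SS>" using Pc(2) T1S by auto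
        then show ?thesis unfolding 1(1) by (intro Sig_Int SS_Sig)
      next
        case 2
        then have "F \<in> \<SS>" using T1S by auto
        then show ?thesis by (rule SS_Sig)
      qed
    qed
    then obtain T where T: "tagged T" "cover T = cover (\<G>a \<union> \<G>b)"
      "\<forall>(t, P)\<in>T. adapted ?A P \<and> (\<exists>G. (t, G) \<in> \<G>a \<union> \<G>b \<and> P \<subseteq> G)" by (elim exE conjE)
    have Ta: "adapted (E ` J) P" "adapted (snd ` \<Xi>) P" if "(t, P) \<in> T" for t P
      using T(3) that by (auto simp: adapted_Un)
    have TN: "?s (point P) = 0 \<and> P \<inter> cover \<Xi> = {}" if tP: "(None, P) \<in> T" for P
    proof -
      obtain F where F: "(None, F) \<in> \<G>b" "P \<subseteq> F" using T(3) tP by (auto simp: \<G>a_def)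
      then have F2: "F \<in> snd ` T1" "F \<inter> cover \<Xi> = {}" "?s (point F) = 0" by (auto simp: \<G>b_def)
      have "point P \<in> F" using point_in[OF tagged_nonempty[OF T(1) tP]] F(2) by auto
      from const[OF T1a(1)[OF F2(1)] this] show ?thesis using F2 F(2) by auto
    qed
    have TS: "(y, H) \<in> \<P> \<and> P \<subseteq> H \<and> ?s (point P) = f y" if tP: "(Some (y, H), P) \<in> T" for y H P
    proof -
      obtain F where F: "(Some (y, H), F) \<in> \<G>a" "P \<subseteq> F" using T(3) tP by (auto simp: \<G>b_def)
      then obtain P1 y' where P1: "P1 \<in> snd ` T1" "ok y' H P1" "y = ch H P1" "F = P1 \<inter> H" by (auto simp: \<G>a_def)
      have ok: "(y, H) \<in> \<P>" "f y = ?s (point P1)" using ch[OF P1(2)] P1(3) by (simp_all add: ok_def)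
      have "point P \<in> P1" using point_in[OF tagged_nonempty[OF T(1) tP]] F(2) P1(4) by auto
      from const[OF T1a(1)[OF P1(1)] this] show ?thesis using ok F(2) P1(4) by auto
    qed
    have Tc: "U \<subseteq> cover T"
    proof
      fix z assume z: "z \<in> U"
      then have zX: "z \<in> X" using Sig_subset[OF US] by auto
      have "z \<in> cover T1" using T1(2) z by simp
      then obtain t P where tP: "(t, P) \<in> T1" "z \<in> P" by (rule in_coverE)
      have P1: "P \<in> snd ` T1" using tP(1) by force
      have sz: "?s z = ?s (point P)" using const[OF T1a(1)[OF P1] tP(2)] .
      from BE[OF sB[OF zX]] have "z \<in> cover \<G>a \<or> z \<in> cover \<G>b"
      proof (elim disjE exE conjE)
        fix y H assume y: "?s z = f y" "(y, H) \<in> \<P>" "z \<in> H"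
        then have "ok y H P" using sz by (simp add: ok_def)
        moreover have "H \<in> snd ` \<P>" using y(2) by force
        ultimately have "(Some (ch H P, H), P \<inter> H) \<in> \<G>a" using P1 unfolding \<G>a_def by (intro image_eqI[of _ _ "(H, P)"]) auto
        then have "z \<in> cover \<G>a" by (rule in_coverI) (use tP(2) y(3) in auto)
        then show ?thesis ..
      next
        assume "?s z = 0" "z \<in> X" "z \<notin> cover \<Xi>"
        moreover from this have "P \<inter> cover \<Xi> = {}" using inX[OF T1a(2)[OF P1]] tP(2) by auto
        ultimately have "(None, P) \<in> \<G>b" using P1 sz by (simp add: \<G>b_def)
        then have "z \<in> cover \<G>b" using tP(2) by (rule in_coverI)
        then show ?thesis ..
      qed
      then show "z \<in> cover T" using T(2) by simp
    qed
    let ?\<psi> = "\<lambda>(t, P). step_val ?s P"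
    have "(?\<psi> has_sum r) T" unfolding J(4)
      by (rule steps_has_sum[OF J(1) EJ T(1) Ta(1)]) (assumption, use Tc in \<open>auto simp: U_def\<close>)
    from has_sum_nbhd[OF this W] obtain Y0 where Y0: "finite Y0" "Y0 \<subseteq> T"
      "\<forall>Y. finite Y \<longrightarrow> Y0 \<subseteq> Y \<longrightarrow> Y \<subseteq> T \<longrightarrow> sum ?\<psi> Y - r \<in> W" by (elim exE conjE)
    \<comment> \<open>Forgets the set \<open>H\<close> recorded in the tag. On pieces with tag
      \<open>None\<close> the result is unspecified, but none of them belongs to \<open>In\<close>
      or \<open>Out\<close>, and injectivity on \<open>T\<close> follows from the sets
      alone.\<close>
    define \<tau> where "\<tau> p = (fst (the (fst p)), snd p)" for p :: "('x \<times> 'x set) option \<times> 'x set"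
    have inj: "inj_on \<tau> T" using tagged_inj[OF T(1)] by (auto simp: inj_on_def \<tau>_def)
    have tau_fine: "is_fine B k (\<tau> ` S)"
      if S: "S \<subseteq> T" and some: "\<And>p. p \<in> S \<Longrightarrow> \<exists>y H. fst p = Some (y, H) \<and> snd p \<subseteq> k y" for S k
      unfolding is_fine_def
    proof (intro conjI taggedI)
      have St: "tagged S" using T(1) S by (rule tagged_subset)
      show "countable (\<tau> ` S)" using tagged_countable[OF St] by simp
      show "F \<in> \<SS>" "F \<noteq> {}" if "(x, F) \<in> \<tau> ` S" for x F
        using that tagged_SS[OF St] tagged_nonempty[OF St] by (auto simp: \<tau>_def)
      show "snd p \<inter> snd q = {}" if ne: "p \<in> \<tau> ` S" "q \<in> \<tau> ` S" "p \<noteq> q" for p q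
      proof -
        obtain p' q' where pq: "p' \<in> S" "q' \<in> S" "p = \<tau> p'" "q = \<tau> q'" using ne(1,2) by auto
        then show ?thesis using tagged_disjoint[OF St pq(1,2)] ne(3) by (auto simp: \<tau>_def)
      qed
      show "\<forall>(x, F)\<in>\<tau> ` S. x \<in> B \<and> F \<subseteq> k x"
      proof (intro ballI, unfold split_paired_all, unfold case_prod_conv)
        fix x F assume "(x, F) \<in> \<tau> ` S"
        then obtain p where p: "p \<in> S" "(x, F) = \<tau> p" by auto
        from some[OF p(1)] obtain y H where y: "fst p = Some (y, H)" "snd p \<subseteq> k y" by auto
        have "(Some (y, H), snd p) \<in> T" using p(1) S y(1)[symmetric] by auto
        from TS[OF this] have "y \<in> B" using P(1) by auto
        then show "x \<in> B \<and> F \<subseteq> k x" using p(2) y by (simp add: \<tau>_def)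
      qed
    qed
    have tau_val: "val (\<tau> ` S) = sum ?\<psi> S" if S: "S \<subseteq> T" "\<And>p. p \<in> S \<Longrightarrow> fst p \<noteq> None" for S
    proof -
      have "val (\<tau> ` S) = (\<Sum>p\<in>S. (case \<tau> p of (x, F) \<Rightarrow> L (f x) (\<mu> F)))"
        unfolding val_def by (rule sum.reindex_cong[OF inj_on_subset[OF inj S(1)] refl refl])
      also have "\<dots> = sum ?\<psi> S"
      proof (rule sum.cong[OF refl])
        fix p assume p: "p \<in> S"
        from S(2)[OF this] obtain y H where y: "fst p = Some (y, H)" by auto
        have "(Some (y, H), snd p) \<in> T" using p S(1) y[symmetric] by auto
        from TS[OF this] show "(case \<tau> p of (x, F) \<Rightarrow> L (f x) (\<mu> F)) = ?\<psi> p"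
          by (simp add: \<tau>_def y case_prod_beta)
      qed
      finally show ?thesis .
    qed
    define In where "In = {p \<in> T. snd p \<subseteq> cover \<Xi>}"
    define Out where "Out = {p \<in> T. \<not> snd p \<subseteq> cover \<Xi> \<and> fst p \<noteq> None}"
    have InS: "\<exists>y H. fst p = Some (y, H) \<and> snd p \<subseteq> h y" if p: "p \<in> In" for p
    proof (cases "fst p")
      case None
      then have N: "(None, snd p) \<in> T" using p by (metis (no_types, lifting) In_def mem_Collect_eq prod.collapse)
      then have False using TN[OF N] p tagged_nonempty[OF T(1) N] by (auto simp: In_def)
      then show ?thesis ..
    next
      case (Some d)
      obtain y H where d: "d = (y, H)" by (cases d)
      have "(Some (y, H), snd p) \<in> T" using p Some d by (metis (no_types, lifting) In_def mem_Collect_eq prod.collapse)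
      from TS[OF this] have "snd p \<subseteq> h y" using P(2)[of y H] by auto
      then show ?thesis using Some d by simp
    qed
    have OutS: "\<exists>y H. fst p = Some (y, H) \<and> snd p \<subseteq> h' y" if p: "p \<in> Out" for p
    proof -
      obtain y H where y: "fst p = Some (y, H)" using p by (auto simp: Out_def)
      have "(Some (y, H), snd p) \<in> T" using p y[symmetric] by (auto simp: Out_def)
      from TS[OF this] have TSp: "(y, H) \<in> \<P>" "snd p \<subseteq> H" by auto
      \<comment> \<open>A piece cut from a member of \<open>\<Xi>\<close> would lie inside its
        union, so the pieces of \<open>Out\<close> come from gauge sets of \<open>h'\<close>, as the
        smallness off \<open>\<Xi>\<close> requires.\<close>
      have "(y, H) \<notin> \<Xi>"
      proof
        assume "(y, H) \<in> \<Xi>"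
        then have "H \<subseteq> cover \<Xi>" by (force simp: cover_def)
        then show False using TSp(2) p by (auto simp: Out_def)
      qed
      then have "H = h' y" using P(4)[OF TSp(1)] by auto
      then show ?thesis using y TSp(2) by simp
    qed
    have InT: "In \<subseteq> T" and OutT: "Out \<subseteq> T" by (auto simp: In_def Out_def)
    have Inf: "is_fine B h (\<tau> ` In)" by (rule tau_fine[OF InT InS])
    have Inc: "cover (\<tau> ` In) = cover \<Xi>"
    proof
      show "cover (\<tau> ` In) \<subseteq> cover \<Xi>" by (auto simp: cover_def In_def \<tau>_def)
      show "cover \<Xi> \<subseteq> cover (\<tau> ` In)"
      proof
        fix z assume z: "z \<in> cover \<Xi>"
        then have "z \<in> cover T" using XB Tc by (auto simp: U_def)
        then obtain t P where tP: "(t, P) \<in> T" "z \<in> P" by (rule in_coverE)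
        then have "P \<subseteq> cover \<Xi>" using inX[OF Ta(2)[OF tP(1)]] z by auto
        then have "(t, P) \<in> In" using tP(1) by (simp add: In_def)
        then have "(fst (the t), P) \<in> \<tau> ` In" by (force simp: \<tau>_def)
        then show "z \<in> cover (\<tau> ` In)" using tP(2) by (rule in_coverI)
      qed
    qed
    obtain P0 where P0: "finite P0" "P0 \<subseteq> \<tau> ` In"
      "\<And>P'. finite P' \<Longrightarrow> P0 \<subseteq> P' \<Longrightarrow> P' \<subseteq> \<tau> ` In \<Longrightarrow> val P' - val \<Xi> \<in> sdiff G G"
      using good_swap[OF good Xf Xi(1) Inf Inc] by metis
    obtain S0 where S0: "S0 \<subseteq> In" "finite S0" "P0 = \<tau> ` S0"
      using finite_subset_image[OF P0(1,2)] by metis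
    define Y where "Y = Y0 \<union> S0"
    have Y: "finite Y" "Y0 \<subseteq> Y" "Y \<subseteq> T" using Y0(1,2) S0(1,2) InT by (auto simp: Y_def)
    have yr: "sum ?\<psi> Y - r \<in> W" using Y0(3)[rule_format, OF Y] .
    have in_val: "val (\<tau> ` (Y \<inter> In)) - val \<Xi> \<in> sdiff G G"
    proof (rule P0(3))
      show "finite (\<tau> ` (Y \<inter> In))" using Y(1) by simp
      show "P0 \<subseteq> \<tau> ` (Y \<inter> In)" unfolding S0(3) by (rule image_mono) (use S0(1) in \<open>auto simp: Y_def\<close>)
      show "\<tau> ` (Y \<inter> In) \<subseteq> \<tau> ` In" by (rule image_mono) auto
    qed
    have out_val: "val (\<tau> ` (Y \<inter> Out)) \<in> sdiff G G"
    proof (rule off)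
      show "finite (\<tau> ` (Y \<inter> Out))" using Y(1) by simp
      show "is_fine B h' (\<tau> ` (Y \<inter> Out))" by (rule tau_fine) (use OutT OutS in auto)
      have "snd p \<inter> cover \<Xi> = {}" if p: "p \<in> Out" for p
        using inX[OF Ta(2), of "fst p" "snd p"] p by (auto simp: Out_def)
      moreover have "cover (\<tau> ` (Y \<inter> Out)) \<subseteq> \<Union>(snd ` Out)" by (auto simp: cover_def \<tau>_def)
      ultimately show "cover (\<tau> ` (Y \<inter> Out)) \<inter> cover \<Xi> = {}" by fastforce
    qed
    have "sum ?\<psi> Y = sum ?\<psi> (Y \<inter> In) + sum ?\<psi> (Y \<inter> Out)"
    proof -
      have "sum ?\<psi> ((Y \<inter> In) \<union> (Y \<inter> Out)) = sum ?\<psi> (Y \<inter> In) + sum ?\<psi> (Y \<inter> Out)"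
        by (rule sum.union_disjoint) (use Y(1) in \<open>auto simp: In_def Out_def\<close>)
      moreover have "sum ?\<psi> ((Y \<inter> In) \<union> (Y \<inter> Out)) = sum ?\<psi> Y"
      proof (rule sum.mono_neutral_left[OF Y(1)])
        show "\<forall>p\<in>Y - (Y \<inter> In \<union> Y \<inter> Out). ?\<psi> p = 0"
        proof
          fix p assume p: "p \<in> Y - (Y \<inter> In \<union> Y \<inter> Out)"
          then have "fst p = None" "p \<in> T" using Y(3) by (auto simp: In_def Out_def)
          then have "(None, snd p) \<in> T" by (metis prod.collapse)
          from TN[OF this] show "?\<psi> p = 0" by (simp add: case_prod_beta)
        qed
      qed auto
      ultimately show ?thesis by simp
    qed
    also have "sum ?\<psi> (Y \<inter> In) = val (\<tau> ` (Y \<inter> In))"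
      by (rule tau_val[symmetric]) (use InT InS in \<open>auto, fastforce\<close>)
    also have "sum ?\<psi> (Y \<inter> Out) = val (\<tau> ` (Y \<inter> Out))"
      by (rule tau_val[symmetric]) (use OutT in \<open>auto simp: Out_def\<close>)
    finally have total: "sum ?\<psi> Y = val (\<tau> ` (Y \<inter> In)) + val (\<tau> ` (Y \<inter> Out))" .
    from in_val obtain g1 g2 where g12: "g1 \<in> G" "g2 \<in> G" "val (\<tau> ` (Y \<inter> In)) - val \<Xi> = g1 - g2" by (rule sdiffE)
    \<comment> \<open>Written with differences only, in order to match \<open>sdiff\<close>; this is
      why \<open>g1 - g2\<close> occurs with its sign reversed.\<close>
    have "r = (val \<Xi> - ((g2 - g1) - val (\<tau> ` (Y \<inter> Out)))) - (sum ?\<psi> Y - r)"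
      using g12(3) total by (simp add: algebra_simps)
    moreover have "(val \<Xi> - ((g2 - g1) - val (\<tau> ` (Y \<inter> Out)))) - (sum ?\<psi> Y - r) \<in>
        sdiff (sdiff G (sdiff (sdiff G G) (sdiff G G))) W"
      by (intro sdiffI Xi(3) g12(1,2) out_val yr)
    ultimately show ?thesis by simp
  qed
  then have "raw_integral \<B> \<subseteq> sdiff (sdiff G (sdiff (sdiff G G) (sdiff G G))) W" by auto
  with env graph show ?thesis by (intro exI[of _ \<B>] conjI)
qed

section \<open>Formal sums and filter bases in terms of good gauges\<close>

abbreviation eval :: "(('x \<times> 'x set) \<Rightarrow>\<^sub>0 int) \<Rightarrow> 'z" where
  "eval \<equiv> formal_sum_eval L f \<mu>"

text \<open>The keys \<open>(c E, E)\<close> are distinct for distinct \<open>E\<close>, so every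
  coefficient is 1 and nothing merges or cancels in the formal sum.\<close>

lemma eval_frag_sum:
  assumes "finite \<Omega>"
  shows "eval (\<Sum>E\<in>\<Omega>. frag_of (c E, E)) = val ((\<lambda>E. (c E, E)) ` \<Omega>)"
proof -
  let ?u = "\<Sum>E\<in>\<Omega>. frag_of (c E, E)"
  have lk: "Poly_Mapping.lookup ?u p = (if p \<in> (\<lambda>E. (c E, E)) ` \<Omega> then 1 else 0)" for p
  proof -
    have "Poly_Mapping.lookup ?u p = (\<Sum>E\<in>\<Omega>. if E = snd p then (if p = (c (snd p), snd p) then 1 else 0) else 0)"
      unfolding lookup_sum by (rule sum.cong) (auto simp: lookup_single when_def)
    also have "\<dots> = (if snd p \<in> \<Omega> then (if p = (c (snd p), snd p) then 1 else 0) else 0)"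
      using assms by (simp add: sum.delta)
    also have "\<dots> = (if p \<in> (\<lambda>E. (c E, E)) ` \<Omega> then 1 else 0)" by (cases p) auto
    finally show ?thesis .
  qed
  then have keys: "Poly_Mapping.keys ?u = (\<lambda>E. (c E, E)) ` \<Omega>"
    by (auto simp: Poly_Mapping.keys.rep_eq)
  have "eval ?u = (\<Sum>p\<in>(\<lambda>E. (c E, E)) ` \<Omega>. case p of (x, E) \<Rightarrow> int_multiple (Poly_Mapping.lookup ?u p) (L (f x) (\<mu> E)))"
    unfolding formal_sum_eval_def keys by (rule sum.cong) auto
  also have "\<dots> = val ((\<lambda>E. (c E, E)) ` \<Omega>)"
    unfolding val_def by (rule sum.cong[OF refl]) (auto simp: lk int_multiple_def)
  finally show ?thesis .
qed

lemma tag_system_gauge: "tag_system \<SS> \<DD> h \<Longrightarrow> is_gauge (\<Union>\<DD>) h"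
  unfolding tag_system_def is_gauge_def
proof (intro conjI ballI)
  assume t: "\<DD> \<subseteq> \<SS> \<and> countable \<DD> \<and> h \<in> \<Union>\<DD> \<rightarrow>\<^sub>E \<DD> \<and> (\<forall>x\<in>\<Union>\<DD>. x \<in> h x)"
  then have hD: "h ` \<Union>\<DD> \<subseteq> \<DD>" by auto
  show "countable (h ` \<Union>\<DD>)" by (rule countable_subset[OF hD]) (use t in simp)
  fix x assume x: "x \<in> \<Union>\<DD>"
  then have "h x \<in> \<DD>" using hD by auto
  then show "x \<in> h x" "h x \<in> \<SS>" "h x \<subseteq> \<Union>\<DD>" using t x by auto
qed

lemma gauge_tag_system:
  assumes "is_gauge A h"
  shows "tag_system \<SS> (h ` A) (restrict h A)" "\<Union>(h ` A) = A"
proof -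
  show U: "\<Union>(h ` A) = A" using gaugeD[OF assms] by auto
  show "tag_system \<SS> (h ` A) (restrict h A)"
    unfolding tag_system_def U using gaugeD[OF assms] gauge_countable[OF assms] by auto
qed

lemma LM_division_fine:
  assumes "(\<E>, c) \<in> LM_divisions \<SS> \<DD> h"
  shows "is_fine (\<Union>\<DD>) h ((\<lambda>E. (c E, E)) ` \<E>)" "cover ((\<lambda>E. (c E, E)) ` \<E>) = \<Union>\<DD>"
proof -
  have a: "\<E> \<subseteq> \<SS>" "countable \<E>" "disjoint \<E>" "{} \<notin> \<E>" "\<Union>\<E> = \<Union>\<DD>" "c \<in> \<E> \<rightarrow>\<^sub>E \<Union>\<DD>"
    "\<forall>E\<in>\<E>. E \<subseteq> h (c E)"
    using assms by (simp_all add: LM_divisions_def)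
  show "cover ((\<lambda>E. (c E, E)) ` \<E>) = \<Union>\<DD>" using a(5) by (simp add: cover_def image_image)
  have "tagged ((\<lambda>E. (c E, E)) ` \<E>)"
  proof (rule taggedI)
    show "snd p \<inter> snd q = {}" if "p \<in> (\<lambda>E. (c E, E)) ` \<E>" "q \<in> (\<lambda>E. (c E, E)) ` \<E>" "p \<noteq> q" for p q
      by (rule disjointD[OF a(3)]) (use that in auto)
  qed (use a in auto)
  then show "is_fine (\<Union>\<DD>) h ((\<lambda>E. (c E, E)) ` \<E>)"
    unfolding is_fine_def using a(6,7) by (auto dest: PiE_mem)
qed

text \<open>In a fine family the set determines the tag, so the tags form a function on the sets; it
  is made extensional to meet \<open>LM_divisions\<close>.\<close>

lemma fine_LM_division:
  assumes "is_fine (\<Union>\<DD>) h T" "cover T = \<Union>\<DD>"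
  obtains c where "(snd ` T, c) \<in> LM_divisions \<SS> \<DD> h" "\<And>p. p \<in> T \<Longrightarrow> (c (snd p), snd p) = p"
proof -
  have T: "tagged T" using assms(1) by (rule fine_tagged)
  define c where "c = restrict (\<lambda>E. fst (inv_into T snd E)) (snd ` T)"
  have c: "(c (snd p), snd p) = p" if "p \<in> T" for p
    using that inv_into_f_f[OF tagged_inj[OF T] that] by (simp add: c_def)
  have cD: "c (snd p) \<in> \<Union>\<DD> \<and> snd p \<subseteq> h (c (snd p))" if "p \<in> T" for p
  proof -
    have "(c (snd p), snd p) \<in> T" using c[OF that] that by simp
    from fineD[OF assms(1) this] show ?thesis by simp
  qed
  have "{} \<notin> snd ` T" using tagged_nonempty[OF T] by fastforce
  moreover have "\<Union>(snd ` T) = \<Union>\<DD>" using assms(2) by (simp add: cover_def)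
  moreover have "c \<in> snd ` T \<rightarrow>\<^sub>E \<Union>\<DD>"
  proof (rule PiE_I)
    fix E assume "E \<in> snd ` T"
    then obtain p where "p \<in> T" "E = snd p" by auto
    then show "c E \<in> \<Union>\<DD>" using cD by auto
  qed (simp add: c_def)
  moreover have "\<forall>E\<in>snd ` T. E \<subseteq> h (c E)" using cD by auto
  ultimately have "(snd ` T, c) \<in> LM_divisions \<SS> \<DD> h"
    using tagged_snd_SS[OF T] tagged_countable[OF T] disjoint_snd[OF T] by (simp add: LM_divisions_def)
  then show ?thesis using c by (rule that)
qed

text \<open>An element of \<open>LM_fb_on\<close> amounts to a tag system, that is a gauge, together
  with a choice of a finite \<open>\<Xi>\<close> for each division separately. This is exactly the
  order of quantifiers in \<open>good\<close>.\<close>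

lemma LM_fb_on_iff_good: "(\<exists>F\<in>LM_fb_on \<SS> A. eval ` F \<subseteq> G) \<longleftrightarrow> (\<exists>h. good A h G)"
proof
  assume "\<exists>F\<in>LM_fb_on \<SS> A. eval ` F \<subseteq> G"
  then obtain F \<DD> h where F: "F \<in> LM_fb_tag \<SS> \<DD> h" "tag_system \<SS> \<DD> h" "\<Union>\<DD> = A" "eval ` F \<subseteq> G"
    by (auto simp: LM_fb_on_def)
  from F(1) obtain F' where F': "F = (\<Union>l\<in>LM_divisions \<SS> \<DD> h. F' l)"
    "\<forall>l\<in>LM_divisions \<SS> \<DD> h. F' l \<in> division_fb l"
    unfolding LM_fb_tag_def fb_prod_def by auto
  have "good A h G"
  proof (rule goodI)
    show "is_gauge A h" using tag_system_gauge[OF F(2)] F(3) by simp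
    fix T assume T: "is_fine A h T" "cover T = A"
    have Tt: "tagged T" using T(1) by (rule fine_tagged)
    obtain c where c: "(snd ` T, c) \<in> LM_divisions \<SS> \<DD> h" "\<And>p. p \<in> T \<Longrightarrow> (c (snd p), snd p) = p"
      using fine_LM_division[of \<DD> h T] T F(3) by metis
    from F'(2) c(1) have "F' (snd ` T, c) \<in> division_fb (snd ` T, c)" by auto
    then obtain \<Xi> where Xi: "finite \<Xi>" "\<Xi> \<subseteq> snd ` T"
      "F' (snd ` T, c) = {\<Sum>E\<in>\<Omega>. frag_of (c E, E) |\<Omega>. finite \<Omega> \<and> \<Xi> \<subseteq> \<Omega> \<and> \<Omega> \<subseteq> snd ` T}"
      by (auto simp: division_fb_def)
    have sub: "F' (snd ` T, c) \<subseteq> F" unfolding F'(1) using c(1) by (rule UN_upper)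
    obtain \<Xi>' where Xi': "\<Xi>' \<subseteq> T" "finite \<Xi>'" "\<Xi> = snd ` \<Xi>'"
      using finite_subset_image[OF Xi(1,2)] by metis
    have "val \<Omega> \<in> G" if O: "finite \<Omega>" "\<Xi>' \<subseteq> \<Omega>" "\<Omega> \<subseteq> T" for \<Omega>
    proof -
      have "(\<Sum>E\<in>snd ` \<Omega>. frag_of (c E, E)) \<in> F' (snd ` T, c)"
        unfolding Xi(3) Xi'(3) using O by (intro CollectI exI[of _ "snd ` \<Omega>"]) auto
      then have "eval (\<Sum>E\<in>snd ` \<Omega>. frag_of (c E, E)) \<in> G" using sub F(4) by auto
      moreover have "(\<lambda>E. (c E, E)) ` snd ` \<Omega> = \<Omega>"
      proof -
        have "(\<lambda>E. (c E, E)) ` snd ` \<Omega> = (\<lambda>p. p) ` \<Omega>"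
          unfolding image_image by (rule image_cong[OF refl]) (use c(2) O(3) in auto)
        then show ?thesis by simp
      qed
      ultimately show ?thesis using eval_frag_sum[of "snd ` \<Omega>" c] O(1) by simp
    qed
    then show "\<exists>\<Xi>. finite \<Xi> \<and> \<Xi> \<subseteq> T \<and> (\<forall>\<Omega>. finite \<Omega> \<longrightarrow> \<Xi> \<subseteq> \<Omega> \<longrightarrow> \<Omega> \<subseteq> T \<longrightarrow> val \<Omega> \<in> G)"
      using Xi'(1,2) by (intro exI[of _ \<Xi>']) auto
  qed
  from exI[of "\<lambda>h. good A h G", OF this] show "\<exists>h. good A h G" .
next
  assume "\<exists>h. good A h G"
  then obtain h where h: "good A h G" by (rule exE)
  have g: "is_gauge A h" using h by (rule good_gauge)
  let ?h = "restrict h A"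
  have "\<forall>l\<in>LM_divisions \<SS> (h ` A) ?h. \<exists>F. F \<in> division_fb l \<and> eval ` F \<subseteq> G"
  proof
    fix l assume l: "l \<in> LM_divisions \<SS> (h ` A) ?h"
    obtain \<E> c where lE: "l = (\<E>, c)" by (cases l)
    let ?T = "(\<lambda>E. (c E, E)) ` \<E>"
    have T: "is_fine A ?h ?T" "cover ?T = A"
      using LM_division_fine[of \<E> c "h ` A" ?h] l gauge_tag_system(2)[OF g] by (simp_all add: lE)
    have "is_fine A h ?T" using fine_mono[OF T(1) subset_refl, of h] by simp
    then have "\<exists>\<Xi>. finite \<Xi> \<and> \<Xi> \<subseteq> ?T \<and> (\<forall>\<Omega>. finite \<Omega> \<and> \<Xi> \<subseteq> \<Omega> \<and> \<Omega> \<subseteq> ?T \<longrightarrow> val \<Omega> \<in> G)"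
      using h T(2) by (simp add: good_def)
    then obtain \<Xi> where Xi: "finite \<Xi>" "\<Xi> \<subseteq> ?T"
      "\<forall>\<Omega>. finite \<Omega> \<and> \<Xi> \<subseteq> \<Omega> \<and> \<Omega> \<subseteq> ?T \<longrightarrow> val \<Omega> \<in> G" by (elim exE conjE)
    obtain \<Xi>' where Xi': "\<Xi>' \<subseteq> \<E>" "finite \<Xi>'" "\<Xi> = (\<lambda>E. (c E, E)) ` \<Xi>'"
      using finite_subset_image[OF Xi(1,2)] by metis
    let ?F = "{\<Sum>E\<in>\<Omega>. frag_of (c E, E) |\<Omega>. finite \<Omega> \<and> \<Xi>' \<subseteq> \<Omega> \<and> \<Omega> \<subseteq> \<E>}"
    have "?F \<in> division_fb l" unfolding lE division_fb_def using Xi'(1,2) by auto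
    moreover have "eval ` ?F \<subseteq> G"
    proof (rule image_subsetI)
      fix u assume "u \<in> ?F"
      then obtain \<Omega> where O: "u = (\<Sum>E\<in>\<Omega>. frag_of (c E, E))" "finite \<Omega>" "\<Xi>' \<subseteq> \<Omega>" "\<Omega> \<subseteq> \<E>" by auto
      have "val ((\<lambda>E. (c E, E)) ` \<Omega>) \<in> G"
        by (rule Xi(3)[rule_format]) (use O Xi'(3) in auto)
      then show "eval u \<in> G" using eval_frag_sum[OF O(2), of c] O(1) by simp
    qed
    ultimately show "\<exists>F. F \<in> division_fb l \<and> eval ` F \<subseteq> G" by (intro exI[of _ ?F] conjI)
  qed
  from bchoice[OF this] obtain F' where F': "\<forall>l\<in>LM_divisions \<SS> (h ` A) ?h. F' l \<in> division_fb l \<and> eval ` F' l \<subseteq> G" ..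
  let ?F = "\<Union>l\<in>LM_divisions \<SS> (h ` A) ?h. F' l"
  have "?F \<in> LM_fb_tag \<SS> (h ` A) ?h" unfolding LM_fb_tag_def fb_prod_def using F' by auto
  then have "?F \<in> LM_fb_on \<SS> A" unfolding LM_fb_on_def
    using gauge_tag_system[OF g] by (intro UnionI[of "LM_fb_tag \<SS> (h ` A) ?h"] CollectI exI[of _ "h ` A"] exI[of _ ?h]) auto
  moreover have "eval ` ?F \<subseteq> G" using F' by auto
  ultimately show "\<exists>F\<in>LM_fb_on \<SS> A. eval ` F \<subseteq> G" by (rule bexI[rotated])
qed

definition good_top :: "'x set set \<Rightarrow> ('x set \<Rightarrow> 'x set \<Rightarrow> bool) \<Rightarrow> 'z set \<Rightarrow> bool" where
  "good_top P le G \<longleftrightarrow> (\<exists>S. is_top P le S \<and> (\<forall>A\<in>S. \<exists>h. good A h G))"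

text \<open>The same unfolding one level higher: an element of \<open>fb_dir\<close> is a top with
  one choice for each of its members, and its image lies in \<open>G\<close> iff the image of every
  chosen set does.\<close>

lemma fb_dir_iff_good_top:
  "(\<exists>F\<in>fb_image eval (fb_dir P le (LM_fb_on \<SS>)). F \<subseteq> G) \<longleftrightarrow> good_top P le G"
proof
  assume "\<exists>F\<in>fb_image eval (fb_dir P le (LM_fb_on \<SS>)). F \<subseteq> G"
  then obtain F S where F: "is_top P le S" "F \<in> fb_prod S (LM_fb_on \<SS>)" "eval ` F \<subseteq> G"
    by (auto simp: fb_image_def fb_dir_def)
  from F(2) obtain F' where F': "F = (\<Union>A\<in>S. F' A)" "\<forall>A\<in>S. F' A \<in> LM_fb_on \<SS> A"
    unfolding fb_prod_def by auto
  have "\<exists>h. good A h G" if A: "A \<in> S" for A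
  proof -
    have "F' A \<in> LM_fb_on \<SS> A" using F'(2) A by simp
    moreover have "F' A \<subseteq> F" unfolding F'(1) using A by (rule UN_upper)
    then have "eval ` F' A \<subseteq> G" using F(3) by auto
    ultimately have "\<exists>F\<in>LM_fb_on \<SS> A. eval ` F \<subseteq> G" by (rule bexI[rotated])
    then show ?thesis by (simp only: LM_fb_on_iff_good)
  qed
  then show "good_top P le G" unfolding good_top_def using F(1) by (intro exI[of _ S]) simp
next
  assume "good_top P le G"
  then obtain S where S: "is_top P le S" "\<forall>A\<in>S. \<exists>h. good A h G" unfolding good_top_def by (elim exE conjE)
  have "\<forall>A\<in>S. \<exists>F. F \<in> LM_fb_on \<SS> A \<and> eval ` F \<subseteq> G"
    using S(2) unfolding LM_fb_on_iff_good[symmetric] by auto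
  from bchoice[OF this] obtain F' where F': "\<forall>A\<in>S. F' A \<in> LM_fb_on \<SS> A \<and> eval ` F' A \<subseteq> G" ..
  let ?F = "\<Union>A\<in>S. F' A"
  have "?F \<in> fb_prod S (LM_fb_on \<SS>)" unfolding fb_prod_def using F' by auto
  then have "?F \<in> fb_dir P le (LM_fb_on \<SS>)" unfolding fb_dir_def
    using S(1) by (intro UnionI[of "fb_prod S (LM_fb_on \<SS>)"] CollectI exI[of _ S]) auto
  then have "eval ` ?F \<in> fb_image eval (fb_dir P le (LM_fb_on \<SS>))" unfolding fb_image_def
    by (intro CollectI exI[of _ ?F]) simp
  moreover have "eval ` ?F \<subseteq> G" using F' by auto
  ultimately show "\<exists>F\<in>fb_image eval (fb_dir P le (LM_fb_on \<SS>)). F \<subseteq> G" by (rule bexI[rotated])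
qed

end

section \<open>Neighbourhoods of zero and small sums\<close>

definition translate :: "'z::ab_group_add \<Rightarrow> 'z set \<Rightarrow> 'z set" where
  "translate a U = (\<lambda>t. a + t) ` U"

lemma in_translate: "x \<in> translate a U \<longleftrightarrow> x - a \<in> U"
proof
  assume "x - a \<in> U"
  then have "a + (x - a) \<in> translate a U" unfolding translate_def by (rule imageI)
  then show "x \<in> translate a U" by simp
qed (auto simp: translate_def)

lemma translate_nbhd:
  fixes a :: "'z::topological_ab_group_add"
  shows "a \<in> interior (translate a U) \<longleftrightarrow> 0 \<in> interior U"
proof -
  have "a \<in> interior (translate a U)" if "0 \<in> interior U"
  proof (rule interiorI)
    show "open ((\<lambda>x. x - a) -` interior U)"
      by (rule open_vimage) (auto intro!: continuous_intros)
    show "a \<in> (\<lambda>x. x - a) -` interior U" using that by simp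
    show "(\<lambda>x. x - a) -` interior U \<subseteq> translate a U"
      using interior_subset[of U] by (auto simp: in_translate)
  qed
  moreover have "0 \<in> interior U" if "a \<in> interior (translate a U)"
  proof (rule interiorI)
    show "open ((\<lambda>x. a + x) -` interior (translate a U))"
      by (rule open_vimage) (auto intro!: continuous_intros)
    show "0 \<in> (\<lambda>x. a + x) -` interior (translate a U)" using that by simp
    show "(\<lambda>x. a + x) -` interior (translate a U) \<subseteq> U"
    proof
      fix x assume "x \<in> (\<lambda>x. a + x) -` interior (translate a U)"
      then have "a + x \<in> translate a U" using interior_subset[of "translate a U"] by auto
      then show "x \<in> U" by (simp add: in_translate)
    qed
  qed
  ultimately show ?thesis by auto
qed

lemma nbhd_halve:
  fixes T :: "'z::topological_ab_group_add set"
  assumes "open T" "0 \<in> T"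
  shows "\<exists>U. open U \<and> 0 \<in> U \<and> sdiff U U \<subseteq> T"
proof -
  have "open ((\<lambda>p. fst p - snd p) -` T)"
    by (rule open_vimage[OF assms(1)]) (auto intro!: continuous_intros)
  moreover have "(0, 0) \<in> (\<lambda>p. fst p - snd p) -` T" using assms(2) by simp
  ultimately obtain A B where AB: "open A" "open B" "(0, 0) \<in> A \<times> B" "A \<times> B \<subseteq> (\<lambda>p. fst p - snd p) -` T"
    by (rule open_prod_elim)
  have "sdiff (A \<inter> B) (A \<inter> B) \<subseteq> T"
    using AB(4) by (auto simp: sdiff_def)
  then show ?thesis using AB by (intro exI[of _ "A \<inter> B"]) auto
qed

text \<open>The substitute for a sequence \<open>\<epsilon> / 2 ^ n\<close> in a group without a
  metric: a difference costs one index, a sum \<open>x + y = x - (0 - y)\<close> costs two.\<close>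

locale nbhd_sequence =
  fixes U :: "nat \<Rightarrow> 'z::topological_ab_group_add set"
  assumes opn: "open (U n)" and zero: "0 \<in> U n" and diff_sub: "sdiff (U (Suc n)) (U (Suc n)) \<subseteq> U n"
begin

lemma diff: "x \<in> U (Suc n) \<Longrightarrow> y \<in> U (Suc n) \<Longrightarrow> x - y \<in> U n"
  using diff_sub[of n] sdiffI[of x "U (Suc n)" y "U (Suc n)"] by auto

lemma mono: "x \<in> U (Suc n) \<Longrightarrow> x \<in> U n"
  using diff[OF _ zero, of x n] by simp

lemma add: "x \<in> U (Suc (Suc n)) \<Longrightarrow> y \<in> U (Suc (Suc n)) \<Longrightarrow> x + y \<in> U n"
  using diff[OF mono diff[OF zero], of x n y] by simp

lemma nbhd: "0 \<in> interior (U n)"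
  using opn zero by (simp add: interior_open)

text \<open>The first term is split off: it and the remaining sum both lie two indices deeper than
  the claim, and \<open>add\<close> loses exactly two. This is the origin of the factor 2 and of the
  offset 2.\<close>

lemma sum_interval:
  "(\<And>i. u i \<in> U (k + 2 * i + 2)) \<Longrightarrow> (\<Sum>i\<in>{n..<n + m}. u i) \<in> U (k + 2 * n)"
proof (induction m arbitrary: n)
  case 0
  then show ?case using zero by simp
next
  case (Suc m)
  have "(\<Sum>i\<in>{Suc n..<Suc n + m}. u i) \<in> U (k + 2 * Suc n)" by (rule Suc.IH[OF Suc.prems])
  then have "(\<Sum>i\<in>{Suc n..<Suc n + m}. u i) \<in> U (Suc (Suc (k + 2 * n)))" by simp
  moreover have "u n \<in> U (Suc (Suc (k + 2 * n)))" using Suc.prems[of n] by simp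
  ultimately have "u n + (\<Sum>i\<in>{Suc n..<Suc n + m}. u i) \<in> U (k + 2 * n)" by (intro add)
  moreover have "(\<Sum>i\<in>{n..<n + Suc m}. u i) = u n + (\<Sum>i\<in>{Suc n..<Suc n + m}. u i)"
    by (simp add: sum.atLeast_Suc_lessThan)
  ultimately show ?case by simp
qed

lemma sum:
  assumes "finite F" "\<And>i. i \<in> F \<Longrightarrow> u i \<in> U (k + 2 * i + 2)"
  shows "sum u F \<in> U k"
proof -
  obtain m where m: "F \<subseteq> {0..<m}" using finite_nat_iff_bounded[THEN iffD1, OF assms(1)] by (auto simp: atLeast0LessThan)
  \<comment> \<open>Gaps in \<open>F\<close> are filled with 0, which lies in every
    \<open>U n\<close>.\<close>
  have "(\<Sum>i\<in>{0..<0 + m}. if i \<in> F then u i else 0) \<in> U (k + 2 * 0)"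
    by (rule sum_interval) (use assms(2) zero in auto)
  moreover have "(\<Sum>i\<in>{0..<0 + m}. if i \<in> F then u i else 0) = sum u F"
    using m by (simp add: sum.inter_restrict[symmetric] Int_absorb1)
  ultimately show ?thesis by simp
qed

end

lemma nbhd_sequence_exists:
  fixes T :: "'z::topological_ab_group_add set"
  assumes "0 \<in> interior T"
  obtains U where "nbhd_sequence U" "U 0 \<subseteq> T"
proof -
  have "\<exists>U. \<forall>n. (open (U n) \<and> 0 \<in> U n \<and> U n \<subseteq> T) \<and> sdiff (U (Suc n)) (U (Suc n)) \<subseteq> U n"
  proof (rule dependent_nat_choice)
    show "\<exists>U. open U \<and> 0 \<in> U \<and> U \<subseteq> T"
      using assms interior_subset by (intro exI[of _ "interior T"]) auto
    fix V :: "'z set" and n :: nat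
    assume V: "open V \<and> 0 \<in> V \<and> V \<subseteq> T"
    then obtain U where U: "open U" "0 \<in> U" "sdiff U U \<subseteq> V" using nbhd_halve by metis
    have "U \<subseteq> V"
    proof
      fix x assume "x \<in> U"
      from sdiffI[OF this U(2)] show "x \<in> V" using U(3) by auto
    qed
    then show "\<exists>U. (open U \<and> 0 \<in> U \<and> U \<subseteq> T) \<and> sdiff U U \<subseteq> V" using U V by (intro exI[of _ U]) auto
  qed
  then obtain U where U: "\<forall>n. (open (U n) \<and> 0 \<in> U n \<and> U n \<subseteq> T) \<and> sdiff (U (Suc n)) (U (Suc n)) \<subseteq> U n" ..
  show ?thesis by (rule that[of U]) (use U in \<open>auto simp: nbhd_sequence_def\<close>)
qed

section \<open>The integral and the filter bases compared through good gauges\<close>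

context lebesgue_mcshane
begin

definition eventually_good :: "'z \<Rightarrow> bool" where
  "eventually_good a \<longleftrightarrow> (\<forall>T. 0 \<in> interior T \<longrightarrow>
     (\<exists>A\<in>Sig. \<forall>B\<in>Sig. A \<subseteq> B \<longrightarrow> (\<exists>h. good B h (translate a T))))"

lemma fb_converges_iff:
  "fb_converges (fb_image eval (fb_dir P le (LM_fb_on \<SS>))) a \<longleftrightarrow>
    (\<forall>T. 0 \<in> interior T \<longrightarrow> good_top P le (translate a T))"
proof -
  have "(\<forall>G. a \<in> interior G \<longrightarrow> good_top P le G) \<longleftrightarrow> (\<forall>T. 0 \<in> interior T \<longrightarrow> good_top P le (translate a T))"
  proof (intro iffI allI impI)
    fix T :: "'z set" assume "\<forall>G. a \<in> interior G \<longrightarrow> good_top P le G" "0 \<in> interior T"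
    then show "good_top P le (translate a T)" using translate_nbhd[of a T] by simp
  next
    fix G assume G: "\<forall>T. 0 \<in> interior T \<longrightarrow> good_top P le (translate a T)" "a \<in> interior G"
    have eq: "translate a (translate (- a) G) = G" by (auto simp: in_translate)
    have "0 \<in> interior (translate (- a) G)" using G(2) translate_nbhd[of a "translate (- a) G"] by (simp add: eq)
    then have "good_top P le (translate a (translate (- a) G))" using G(1) by simp
    then show "good_top P le G" by (simp only: eq)
  qed
  then show ?thesis unfolding fb_converges_def fb_dir_iff_good_top .
qed

lemma envelope_integral_eq: "envelope_integral X \<SS> L \<mu> \<B> = closure (raw_integral \<B>)"
  unfolding envelope_integral_def raw_integral_def step_integral_def ..

text \<open>In both directions the elements of the raw integral, respectively of the target of the
  gauge, enter with coefficients of sum 1. Subtracting \<open>a\<close> from each of them subtracts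
  \<open>a\<close> from the result, and only the depth of nested differences remains to be
  counted.\<close>

lemma extended_integral_iff: "has_extended_LM_integral X \<SS> L \<mu> f a \<longleftrightarrow> eventually_good a"
proof
  assume int: "has_extended_LM_integral X \<SS> L \<mu> f a"
  show "eventually_good a" unfolding eventually_good_def
  proof (intro allI impI)
    fix T :: "'z set" assume "0 \<in> interior T"
    then obtain U where "nbhd_sequence U" and UT: "U 0 \<subseteq> T" by (rule nbhd_sequence_exists)
    then interpret U: nbhd_sequence U by simp
    \<comment> \<open>Index 3, because \<open>good_of_envelope\<close> nests three
      differences.\<close>
    from int U.nbhd[of 3] obtain A where A: "A \<in> Sig" "\<forall>B\<in>Sig. A \<subseteq> B \<longrightarrow>
         (\<exists>\<B>. envelope X \<SS> \<B> \<and> graph_on X (zero_outside f B) \<subseteq> \<B> \<and>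
              envelope_integral X \<SS> L \<mu> \<B> \<subseteq> (\<lambda>t. a + t) ` U 3)"
      unfolding has_extended_LM_integral_def by (elim allE impE bexE) auto
    have "\<exists>h. good B h (translate a T)" if B: "B \<in> Sig" "A \<subseteq> B" for B
    proof -
      from A(2) B obtain \<B> where env: "envelope X \<SS> \<B>" "graph_on X (zero_outside f B) \<subseteq> \<B>"
        "envelope_integral X \<SS> L \<mu> \<B> \<subseteq> (\<lambda>t. a + t) ` U 3" by auto
      have R: "r - a \<in> U 3" if "r \<in> raw_integral \<B>" for r
        using env(3) closure_subset[of "raw_integral \<B>"] that
        unfolding envelope_integral_eq translate_def[symmetric] by (auto simp: in_translate[symmetric])
      obtain h where h: "good B h (sdiff (sdiff (raw_integral \<B>) (sdiff (raw_integral \<B>) (raw_integral \<B>)))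
          (sdiff (sdiff (U 3) (U 3)) (sdiff (U 3) (U 3))))"
        using good_of_envelope[OF B(1) env(1,2) U.nbhd[of 3]] by (elim exE)
      have "good B h (translate a T)"
      proof (rule good_mono[OF h], rule subsetI)
        fix x assume "x \<in> sdiff (sdiff (raw_integral \<B>) (sdiff (raw_integral \<B>) (raw_integral \<B>)))
          (sdiff (sdiff (U 3) (U 3)) (sdiff (U 3) (U 3)))"
        then obtain r1 r2 r3 w1 w2 w3 w4 where x: "x = (r1 - (r2 - r3)) - ((w1 - w2) - (w3 - w4))"
          and r: "r1 \<in> raw_integral \<B>" "r2 \<in> raw_integral \<B>" "r3 \<in> raw_integral \<B>"
          and w: "w1 \<in> U 3" "w2 \<in> U 3" "w3 \<in> U 3" "w4 \<in> U 3"
          by (elim sdiffE) auto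
        have "((r1 - a) - ((r2 - a) - (r3 - a))) - ((w1 - w2) - (w3 - w4)) \<in> U 0"
        proof (rule U.diff)
          have "(r2 - a) - (r3 - a) \<in> U 2" by (rule U.diff) (use R r in \<open>simp_all add: numeral_3_eq_3\<close>)
          moreover have "r1 - a \<in> U 2" by (rule U.mono) (use R r in \<open>simp add: numeral_3_eq_3\<close>)
          ultimately show "(r1 - a) - ((r2 - a) - (r3 - a)) \<in> U (Suc 0)"
            by (intro U.diff[of "r1 - a"]) (simp_all add: numeral_2_eq_2)
          have "w1 - w2 \<in> U 2" by (rule U.diff) (use w in \<open>simp_all add: numeral_3_eq_3\<close>)
          moreover have "w3 - w4 \<in> U 2" by (rule U.diff) (use w in \<open>simp_all add: numeral_3_eq_3\<close>)
          ultimately show "(w1 - w2) - (w3 - w4) \<in> U (Suc 0)"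
            by (intro U.diff[of "w1 - w2"]) (simp_all add: numeral_2_eq_2)
        qed
        then have "x - a \<in> U 0" unfolding x by (simp add: algebra_simps)
        then show "x \<in> translate a T" using UT by (auto simp: in_translate)
      qed
      from exI[of "\<lambda>h. good B h (translate a T)", OF this] show ?thesis .
    qed
    then show "\<exists>A\<in>Sig. \<forall>B\<in>Sig. A \<subseteq> B \<longrightarrow> (\<exists>h. good B h (translate a T))" using A(1) by (intro bexI[of _ A]) auto
  qed
next
  assume ev: "eventually_good a"
  show "has_extended_LM_integral X \<SS> L \<mu> f a" unfolding has_extended_LM_integral_def
  proof (intro allI impI)
    fix T :: "'z set" assume "0 \<in> interior T"
    then obtain U where "nbhd_sequence U" and UT: "U 0 \<subseteq> T" by (rule nbhd_sequence_exists)
    then interpret U: nbhd_sequence U by simp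
    \<comment> \<open>Index 5: \<open>envelope_of_good\<close> nests four differences, which leads
      to \<open>U 1\<close>, and the passage to the closure takes the last index.\<close>
    from ev U.nbhd[of 5] obtain A where A: "A \<in> Sig" "\<forall>B\<in>Sig. A \<subseteq> B \<longrightarrow> (\<exists>h. good B h (translate a (U 5)))"
      unfolding eventually_good_def by (elim allE impE bexE) auto
    have "\<exists>\<B>. envelope X \<SS> \<B> \<and> graph_on X (zero_outside f B) \<subseteq> \<B> \<and>
        envelope_integral X \<SS> L \<mu> \<B> \<subseteq> (\<lambda>t. a + t) ` T" if B: "B \<in> Sig" "A \<subseteq> B" for B
    proof -
      from A(2) B obtain h where h: "good B h (translate a (U 5))" by (elim ballE impE exE) auto
      let ?G = "translate a (U 5)"
      obtain \<B> where env: "envelope X \<SS> \<B>" "graph_on X (zero_outside f B) \<subseteq> \<B>"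
        "raw_integral \<B> \<subseteq> sdiff (sdiff ?G (sdiff (sdiff ?G ?G) (sdiff ?G ?G))) (U 5)"
        using envelope_of_good[OF h U.nbhd[of 5]] by (elim exE conjE)
      have R: "r - a \<in> U 1" if r: "r \<in> raw_integral \<B>" for r
      proof -
        from subsetD[OF env(3) r] obtain g0 g1 g2 g3 g4 w where
          g: "g0 \<in> ?G" "g1 \<in> ?G" "g2 \<in> ?G" "g3 \<in> ?G" "g4 \<in> ?G" "w \<in> U 5"
          and req: "r = (g0 - ((g1 - g2) - (g3 - g4))) - w" by (elim sdiffE) auto
        have g': "g0 - a \<in> U 5" "g1 - a \<in> U 5" "g2 - a \<in> U 5" "g3 - a \<in> U 5" "g4 - a \<in> U 5"
          using g by (simp_all add: in_translate)
        have down: "x - y \<in> U n" if "x \<in> U m" "y \<in> U m" "m = Suc n" for x y m n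
          using U.diff[of x n y] that by simp
        have up: "x \<in> U n" if "x \<in> U m" "m = Suc n" for x m n
          using U.mono[of x n] that by simp
        have "((g1 - a) - (g2 - a)) - ((g3 - a) - (g4 - a)) \<in> U 3"
          by (rule down[OF down[OF g'(2,3), of 4] down[OF g'(4,5), of 4]]) simp_all
        moreover have "g0 - a \<in> U 4" by (rule up[OF g'(1)]) simp
        then have "g0 - a \<in> U 3" by (rule up) simp
        ultimately have d: "(g0 - a) - (((g1 - a) - (g2 - a)) - ((g3 - a) - (g4 - a))) \<in> U 2"
          by (intro down[of "g0 - a" 3]) simp_all
        have "w \<in> U 4" by (rule up[OF g(6)]) simp
        then have "w \<in> U 3" by (rule up) simp
        then have "w \<in> U 2" by (rule up) simp
        from d this have "((g0 - a) - (((g1 - a) - (g2 - a)) - ((g3 - a) - (g4 - a)))) - w \<in> U 1"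
          by (rule down) simp
        then show ?thesis unfolding req by (simp add: algebra_simps)
      qed
      have "p - a \<in> T" if p: "p \<in> closure (raw_integral \<B>)" for p
      proof -
        let ?V = "(\<lambda>q. q - p) -` U 1"
        have opV: "open ?V" by (rule open_vimage[OF U.opn]) (auto intro!: continuous_intros)
        have "p \<in> ?V" using U.zero by simp
        then have "p \<in> ?V \<inter> closure (raw_integral \<B>)" using p by (rule IntI)
        then have "?V \<inter> closure (raw_integral \<B>) \<noteq> {}" by (metis empty_iff)
        then have "?V \<inter> raw_integral \<B> \<noteq> {}"
          using open_Int_closure_eq_empty[OF opV, of "raw_integral \<B>"] by simp
        then obtain q where q: "q - p \<in> U 1" "q \<in> raw_integral \<B>" by auto
        have "(q - a) - (q - p) \<in> U 0" by (rule U.diff) (use R[OF q(2)] q(1) in simp_all)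
        then show ?thesis using UT by auto
      qed
      then have "envelope_integral X \<SS> L \<mu> \<B> \<subseteq> (\<lambda>t. a + t) ` T"
        unfolding envelope_integral_eq translate_def[symmetric] by (auto simp: in_translate)
      then show ?thesis using env(1,2) by (intro exI[of _ \<B>]) auto
    qed
    then show "\<exists>A\<in>Sig. \<forall>B\<in>Sig. A \<subseteq> B \<longrightarrow> (\<exists>\<B>. envelope X \<SS> \<B> \<and>
        graph_on X (zero_outside f B) \<subseteq> \<B> \<and> envelope_integral X \<SS> L \<mu> \<B> \<subseteq> (\<lambda>t. a + t) ` T)"
      using A(1) by (intro bexI[of _ A]) auto
  qed
qed

text \<open>\<open>Sig\<close> is closed under unions, so the members above a fixed \<open>A\<close>
  form a top. Conversely a top is nonempty, having a member above the empty set, and contains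
  everything in \<open>Sig\<close> above that member.\<close>

lemma good_top_Sig_iff: "good_top Sig (\<subseteq>) G \<longleftrightarrow> (\<exists>A\<in>Sig. \<forall>B\<in>Sig. A \<subseteq> B \<longrightarrow> (\<exists>h. good B h G))"
proof
  assume "good_top Sig (\<subseteq>) G"
  then obtain S where S: "is_top Sig (\<subseteq>) S" "\<forall>A\<in>S. \<exists>h. good A h G" unfolding good_top_def by (elim exE conjE)
  have "\<exists>s\<in>S. {} \<subseteq> s" using S(1) Sig_empty by (auto simp: is_top_def)
  then obtain A where A: "A \<in> S" by auto
  have "\<exists>h. good B h G" if "B \<in> Sig" "A \<subseteq> B" for B
  proof -
    have "B \<in> S" using S(1) A that by (auto simp: is_top_def)
    then show ?thesis using S(2) by simp
  qed
  moreover have "A \<in> Sig" using S(1) A by (auto simp: is_top_def)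
  ultimately show "\<exists>A\<in>Sig. \<forall>B\<in>Sig. A \<subseteq> B \<longrightarrow> (\<exists>h. good B h G)" by (intro bexI[of _ A]) auto
next
  assume "\<exists>A\<in>Sig. \<forall>B\<in>Sig. A \<subseteq> B \<longrightarrow> (\<exists>h. good B h G)"
  then obtain A where A: "A \<in> Sig" "\<forall>B\<in>Sig. A \<subseteq> B \<longrightarrow> (\<exists>h. good B h G)" by (elim bexE)
  have "is_top Sig (\<subseteq>) {B \<in> Sig. A \<subseteq> B}" unfolding is_top_def
  proof (intro conjI ballI impI)
    fix P assume "P \<in> Sig"
    then have "P \<union> A \<in> {B \<in> Sig. A \<subseteq> B}" using Sig_Un A(1) by simp
    then show "\<exists>s\<in>{B \<in> Sig. A \<subseteq> B}. P \<subseteq> s" by (rule bexI[rotated]) simp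
  qed auto
  then show "good_top Sig (\<subseteq>) G" unfolding good_top_def using A(2) by (intro exI[of _ "{B \<in> Sig. A \<subseteq> B}"]) simp
qed

end

text \<open>What \<open>Sigma0_unions\<close> under inclusion and \<open>Sigma00_unions\<close> under \<open>dot_subset\<close> have in
  common. The second order need not be directed.\<close>

locale finite_exhaustion = lebesgue_mcshane X \<SS> \<mu> L f
  for X :: "'x set" and \<SS>
    and \<mu> :: "'x set \<Rightarrow> 'w::complete_hausdorff_ab_group_add"
    and L :: "'v::complete_hausdorff_ab_group_add \<Rightarrow> 'w \<Rightarrow> 'z::complete_hausdorff_ab_group_add"
    and f :: "'x \<Rightarrow> 'v" +
  fixes P :: "'x set set" and le :: "'x set \<Rightarrow> 'x set \<Rightarrow> bool"
  assumes P_Sig0: "A \<in> P \<Longrightarrow> A \<in> Sigma0_unions \<SS>"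
    and P_empty: "{} \<in> P"
    and le_refl: "A \<in> P \<Longrightarrow> le A A"
    and le_trans: "A \<in> P \<Longrightarrow> B \<in> P \<Longrightarrow> C \<in> P \<Longrightarrow> le A B \<Longrightarrow> le B C \<Longrightarrow> le A C"
    and le_subset: "le A B \<Longrightarrow> A \<subseteq> B"
    and P_extend: "A \<in> P \<Longrightarrow> finite \<E> \<Longrightarrow> \<E> \<subseteq> \<SS> \<Longrightarrow> disjoint \<E> \<Longrightarrow> \<Union>\<E> \<inter> A = {} \<Longrightarrow> A \<union> \<Union>\<E> \<in> P"
    and le_extend: "A \<in> P \<Longrightarrow> finite \<E> \<Longrightarrow> \<E> \<subseteq> \<SS> \<Longrightarrow> disjoint \<E> \<Longrightarrow> \<Union>\<E> \<inter> A = {} \<Longrightarrow> le A (A \<union> \<Union>\<E>)"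
begin

text \<open>Good gauges on countable unions are passed down by \<open>good_restrict\<close>. The top
  collects the sets all of whose successors have good gauges, so it is upward closed by transitivity
  and no common upper bounds in \<open>P\<close> are required.\<close>

lemma good_top_of_eventually_good:
  assumes ev: "eventually_good a" and T: "0 \<in> interior T"
  shows "good_top P le (translate a T)"
proof -
  obtain U where "nbhd_sequence U" and UT: "U 0 \<subseteq> T" using T by (rule nbhd_sequence_exists)
  then interpret U: nbhd_sequence U by simp
  let ?G = "translate a (U 2)"
  from ev U.nbhd[of 2] obtain A where A: "A \<in> Sig" "\<forall>B\<in>Sig. A \<subseteq> B \<longrightarrow> (\<exists>h. good B h ?G)"
    unfolding eventually_good_def by (elim allE impE bexE) auto
  define S where "S = {s \<in> P. \<forall>t\<in>P. le s t \<longrightarrow> (\<exists>h. good t h (translate a T))}"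
  have three: "sdiff ?G (sdiff ?G ?G) \<subseteq> translate a T"
  proof
    fix x assume "x \<in> sdiff ?G (sdiff ?G ?G)"
    then obtain g1 g2 g3 where g: "g1 \<in> ?G" "g2 \<in> ?G" "g3 \<in> ?G" and x: "x = g1 - (g2 - g3)"
      by (elim sdiffE) auto
    have "(g2 - a) - (g3 - a) \<in> U 1" by (rule U.diff) (use g in \<open>simp_all add: in_translate numeral_2_eq_2\<close>)
    moreover have "g1 - a \<in> U 1" by (rule U.mono) (use g in \<open>simp add: in_translate numeral_2_eq_2\<close>)
    ultimately have "(g1 - a) - ((g2 - a) - (g3 - a)) \<in> U 0" by (intro U.diff[of "g1 - a"]) simp_all
    then have "x - a \<in> U 0" unfolding x by (simp add: algebra_simps)
    then show "x \<in> translate a T" using UT by (auto simp: in_translate)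
  qed
  have top: "\<exists>s\<in>S. le p s" if p: "p \<in> P" for p
  proof -
    have p0: "p \<in> Sig0" using P_Sig0[OF p] .
    let ?C = "A \<union> p"
    have C: "?C \<in> Sig" using Sig_Un[OF A(1) Sig0_Sig[OF p0]] .
    from bspec[OF A(2) this] obtain h where h: "good ?C h ?G" by auto
    have g: "is_gauge ?C h" using h by (rule good_gauge)
    \<comment> \<open>The division is split along \<open>p\<close>, so that the members of
      \<open>\<Xi>\<close> outside \<open>D1\<close> are whole sets disjoint from \<open>p\<close>.
      Adding them to \<open>p\<close> is then an extension in the sense of \<open>le\<close>, also
      for \<open>dot_subset\<close>.\<close>
    obtain D1 where D1: "is_fine ?C h D1" "cover D1 = p"
      using fine_exists[OF g Sig0_Sig[OF p0]] by auto
    obtain D2 where D2: "is_fine ?C h D2" "cover D2 = ?C - p"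
      using fine_exists[OF g Sig_Diff_Sig0[OF C p0]] by auto
    have D: "is_fine ?C h (D1 \<union> D2)" "cover (D1 \<union> D2) = ?C"
      using fine_Un[OF D1(1) D2(1)] D1(2) D2(2) by auto
    obtain \<Xi> where Xi: "finite \<Xi>" "\<Xi> \<subseteq> D1 \<union> D2"
      "\<And>B h1 G. B \<in> Sig0 \<Longrightarrow> cover \<Xi> \<subseteq> B \<Longrightarrow> good (?C \<union> B) h1 G \<Longrightarrow> \<exists>h2. good B h2 (sdiff G (sdiff ?G ?G))"
      using good_restrict[OF h D] by metis
    let ?E = "\<Xi> \<inter> D2"
    have Et: "tagged ?E" by (rule tagged_subset[OF fine_tagged[OF D2(1)]]) auto
    have Efin: "finite (snd ` ?E)" using Xi(1) by simp
    have "cover ?E \<inter> p = {}" using cover_mono[of ?E D2] D2(2) by auto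
    then have Ep: "\<Union>(snd ` ?E) \<inter> p = {}" by (simp add: cover_def)
    note ext = p Efin tagged_snd_SS[OF Et] disjoint_snd[OF Et] Ep
    let ?s = "p \<union> \<Union>(snd ` ?E)"
    have Xs: "cover \<Xi> \<subseteq> ?s"
    proof -
      have "\<Xi> \<subseteq> D1 \<union> ?E" using Xi(2) by auto
      from cover_mono[OF this] show ?thesis using D1(2) by (simp add: cover_def)
    qed
    have "\<exists>h. good t h (translate a T)" if t: "t \<in> P" "le ?s t" for t
    proof -
      have t0: "t \<in> Sig0" using P_Sig0[OF t(1)] .
      have "?C \<union> t \<in> Sig" using Sig_Un[OF C Sig0_Sig[OF t0]] .
      from bspec[OF A(2) this] obtain h1 where h1: "good (?C \<union> t) h1 ?G" by auto
      from Xi(3)[OF t0 subset_trans[OF Xs le_subset[OF t(2)]] h1]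
      obtain h2 where h2: "good t h2 (sdiff ?G (sdiff ?G ?G))" by (elim exE)
      from exI[of "\<lambda>h. good t h (translate a T)", OF good_mono[OF h2 three]] show ?thesis .
    qed
    then have "?s \<in> S" using P_extend[OF ext] by (simp add: S_def)
    then show ?thesis using le_extend[OF ext] by (rule bexI[rotated])
  qed
  have "is_top P le S" unfolding is_top_def
  proof (intro conjI ballI impI)
    show "S \<subseteq> P" by (auto simp: S_def)
    show "\<exists>s\<in>S. le p s" if "p \<in> P" for p using top[OF that] .
    fix s t assume st: "s \<in> S" "t \<in> P" "le s t"
    have sP: "s \<in> P" using st(1) by (simp add: S_def)
    have "\<exists>h. good u h (translate a T)" if u: "u \<in> P" "le t u" for u
      using st(1) u(1) le_trans[OF sP st(2) u(1) st(3) u(2)] by (simp add: S_def)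
    then show "t \<in> S" using st(2) by (simp add: S_def)
  qed
  moreover have "\<forall>A\<in>S. \<exists>h. good A h (translate a T)" using le_refl by (simp add: S_def)
  ultimately show ?thesis unfolding good_top_def by (intro exI[of _ S]) simp
qed

lemma eventually_good_of_good_top:
  assumes top: "\<And>T. 0 \<in> interior T \<Longrightarrow> good_top P le (translate a T)"
  shows "eventually_good a"
  unfolding eventually_good_def
proof (intro allI impI)
  fix T :: "'z set" assume "0 \<in> interior T"
  then obtain U where "nbhd_sequence U" and UT: "U 0 \<subseteq> T" by (rule nbhd_sequence_exists)
  then interpret U: nbhd_sequence U by simp
  \<comment> \<open>Index 3, because \<open>good_extend\<close> nests three differences, the last
    one with the total error of the layers.\<close>
  let ?G = "translate a (U 3)"
  obtain S where S: "is_top P le S" "\<forall>A\<in>S. \<exists>h. good A h ?G"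
    using top[OF U.nbhd[of 3]] unfolding good_top_def by (elim exE conjE)
  obtain A0 where A0: "A0 \<in> S" using S(1) P_empty by (auto simp: is_top_def)
  have AP: "A0 \<in> P" using S(1) A0 by (auto simp: is_top_def)
  have A0S: "A0 \<in> Sig0" using P_Sig0[OF AP] .
  have near: "\<exists>h. good (A0 \<union> \<Union>\<E>) h ?G"
    if E: "finite \<E>" "\<E> \<subseteq> \<SS>" "disjoint \<E>" "\<Union>\<E> \<inter> A0 = {}" for \<E>
  proof -
    have "A0 \<union> \<Union>\<E> \<in> S" using S(1) A0 P_extend[OF AP E] le_extend[OF AP E] by (simp add: is_top_def)
    then show ?thesis using S(2) by simp
  qed
  \<comment> \<open>The index \<open>3 + 2 * n + 2\<close> is what \<open>U.sum\<close> requires for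
    a total in \<open>U 3\<close>. The set \<open>?H\<close> is taken one index deeper, since
    \<open>sdiff ?H ?H\<close> loses one.\<close>
  have cauchy: "\<exists>B' h G'. A0 \<union> \<Union>\<E> \<subseteq> B' \<and> good B' h G' \<and> sdiff G' G' \<subseteq> U (3 + 2 * n + 2)"
    if E: "finite \<E>" "\<E> \<subseteq> \<SS>" "disjoint \<E>" "\<Union>\<E> \<inter> A0 = {}" for \<E> n
  proof -
    let ?H = "translate a (U (Suc (3 + 2 * n + 2)))"
    obtain S' where S': "is_top P le S'" "\<forall>A\<in>S'. \<exists>h. good A h ?H"
      using top[OF U.nbhd[of "Suc (3 + 2 * n + 2)"]] unfolding good_top_def by (elim exE conjE)
    obtain B' where B': "B' \<in> S'" "le (A0 \<union> \<Union>\<E>) B'"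
      using S'(1) P_extend[OF AP E] by (auto simp: is_top_def)
    obtain h where h: "good B' h ?H" using bspec[OF S'(2) B'(1)] by (elim exE)
    have "sdiff ?H ?H \<subseteq> U (3 + 2 * n + 2)"
    proof
      fix x assume "x \<in> sdiff ?H ?H"
      then obtain g1 g2 where g: "g1 \<in> ?H" "g2 \<in> ?H" "x = g1 - g2" by (rule sdiffE)
      have "(g1 - a) - (g2 - a) \<in> U (3 + 2 * n + 2)"
        by (rule U.diff) (use g(1,2) in \<open>simp_all only: in_translate\<close>)
      then show "x \<in> U (3 + 2 * n + 2)" using g(3) by simp
    qed
    then show ?thesis using le_subset[OF B'(2)] h by (intro exI[of _ B'] exI[of _ h] exI[of _ ?H]) simp
  qed
  have four: "sdiff (sdiff ?G (sdiff ?G ?G)) (U 3) \<subseteq> translate a T"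
  proof
    fix x assume "x \<in> sdiff (sdiff ?G (sdiff ?G ?G)) (U 3)"
    then obtain g1 g2 g3 w where g: "g1 \<in> ?G" "g2 \<in> ?G" "g3 \<in> ?G" "w \<in> U 3" and x: "x = (g1 - (g2 - g3)) - w"
      by (elim sdiffE) auto
    have "(g2 - a) - (g3 - a) \<in> U 2" by (rule U.diff) (use g in \<open>simp_all add: in_translate numeral_3_eq_3\<close>)
    moreover have "g1 - a \<in> U 2" by (rule U.mono) (use g in \<open>simp add: in_translate numeral_3_eq_3\<close>)
    ultimately have 1: "(g1 - a) - ((g2 - a) - (g3 - a)) \<in> U 1"
      by (intro U.diff[of "g1 - a"]) (simp_all add: numeral_2_eq_2)
    have "w \<in> U 2" by (rule U.mono) (use g(4) in \<open>simp add: numeral_3_eq_3\<close>)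
    then have "w \<in> U 1" using U.mono[of w 1] by (simp add: numeral_2_eq_2)
    with 1 have "((g1 - a) - ((g2 - a) - (g3 - a))) - w \<in> U 0" using U.diff[of _ 0 w] by simp
    then have "x - a \<in> U 0" unfolding x by (simp add: algebra_simps)
    then show "x \<in> translate a T" using UT by (auto simp: in_translate)
  qed
  have "\<exists>h. good B h (translate a T)" if B: "B \<in> Sig" "A0 \<subseteq> B" for B
  proof -
    have "\<exists>h. good B h (sdiff (sdiff ?G (sdiff ?G ?G)) (U 3))"
      by (rule good_extend[where W = "\<lambda>n. U (3 + 2 * n + 2)", OF A0S near cauchy U.sum B])
    then obtain h where h: "good B h (sdiff (sdiff ?G (sdiff ?G ?G)) (U 3))" by (elim exE)
    from exI[of "\<lambda>h. good B h (translate a T)", OF good_mono[OF h four]] show ?thesis .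
  qed
  then show "\<exists>A\<in>Sig. \<forall>B\<in>Sig. A \<subseteq> B \<longrightarrow> (\<exists>h. good B h (translate a T))"
    using Sig0_Sig[OF A0S] by (intro bexI[of _ A0]) auto
qed

lemma fb_converges_iff_eventually_good:
  "fb_converges (fb_image eval (fb_dir P le (LM_fb_on \<SS>))) a \<longleftrightarrow> eventually_good a"
  unfolding fb_converges_iff
  using good_top_of_eventually_good eventually_good_of_good_top by metis

end

section \<open>Finite disjoint unions and their order\<close>

context intervals
begin

lemma Sig00_Sig0: "A \<in> Sigma00_unions \<SS> \<Longrightarrow> A \<in> Sig0"
  by (auto simp: Sigma00_unions_def Sigma0_unions_def)

lemma Sig00_Union: "finite \<E> \<Longrightarrow> \<E> \<subseteq> \<SS> \<Longrightarrow> disjoint \<E> \<Longrightarrow> \<Union>\<E> \<in> Sigma00_unions \<SS>"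
  by (auto simp: Sigma00_unions_def)

lemma Sig00_Un:
  assumes "A \<in> Sigma00_unions \<SS>" "B \<in> Sigma00_unions \<SS>" "A \<inter> B = {}"
  shows "A \<union> B \<in> Sigma00_unions \<SS>"
proof -
  obtain \<D> where D: "finite \<D>" "\<D> \<subseteq> \<SS>" "disjoint \<D>" "A = \<Union>\<D>"
    using assms(1) by (auto simp: Sigma00_unions_def)
  obtain \<E> where E: "finite \<E>" "\<E> \<subseteq> \<SS>" "disjoint \<E>" "B = \<Union>\<E>"
    using assms(2) by (auto simp: Sigma00_unions_def)
  have "disjoint (\<D> \<union> \<E>)"
    using disjoint_union[OF D(3) E(3)] assms(3) D(4) E(4) by simp
  then have "\<Union>(\<D> \<union> \<E>) \<in> Sigma00_unions \<SS>" using D E by (intro Sig00_Union) auto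
  then show ?thesis by (simp add: D(4) E(4) Union_Un_distrib)
qed

lemma dot_subset_trans:
  assumes "dot_subset \<SS> A B" "dot_subset \<SS> B C"
  shows "dot_subset \<SS> A C"
proof -
  obtain D where D: "D \<in> Sigma00_unions \<SS>" "A \<inter> D = {}" "B = A \<union> D"
    using assms(1) by (auto simp: dot_subset_def)
  obtain E where E: "E \<in> Sigma00_unions \<SS>" "B \<inter> E = {}" "C = B \<union> E"
    using assms(2) by (auto simp: dot_subset_def)
  have "D \<union> E \<in> Sigma00_unions \<SS>" using Sig00_Un[OF D(1) E(1)] D(3) E(2) by auto
  moreover have "A \<inter> (D \<union> E) = {}" "C = A \<union> (D \<union> E)" using D E by auto
  ultimately show ?thesis unfolding dot_subset_def by auto
qed

end

theorem lemma9p24: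
  fixes X :: "'x set" and \<SS> :: "'x set set"
    and \<mu> :: "'x set \<Rightarrow> 'w::complete_hausdorff_ab_group_add"
    and L :: "'v::complete_hausdorff_ab_group_add \<Rightarrow> 'w \<Rightarrow> 'z::complete_hausdorff_ab_group_add"
    and f :: "'x \<Rightarrow> 'v" and a :: 'z
  assumes "interval_system X \<SS>"
    and "group_measure \<SS> \<mu>"
    and "biadditive L"
    and "\<And>v. continuous_on UNIV (L v)"
  shows "(has_extended_LM_integral X \<SS> L \<mu> f a \<longleftrightarrow>
            fb_converges (fb_image (formal_sum_eval L f \<mu>) (LM_fb \<SS>)) a)
       \<and> (has_extended_LM_integral X \<SS> L \<mu> f a \<longleftrightarrow>
            fb_converges (fb_image (formal_sum_eval L f \<mu>) (LM_fb0 \<SS>)) a)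
       \<and> (has_extended_LM_integral X \<SS> L \<mu> f a \<longleftrightarrow>
            fb_converges (fb_image (formal_sum_eval L f \<mu>) (LM_fb00 \<SS>)) a)"
proof -
  interpret lebesgue_mcshane X \<SS> \<mu> L f
    using assms by (simp add: lebesgue_mcshane_def intervals_def lebesgue_mcshane_axioms_def)
  have Sig00_empty: "{} \<in> Sigma00_unions \<SS>" using Sig00_Union[of "{}"] by simp
  interpret S0: finite_exhaustion X \<SS> \<mu> L f "Sigma0_unions \<SS>" "(\<subseteq>)"
  proof
    show "{} \<in> Sigma0_unions \<SS>" using Sig0_Union[of "{}"] by simp
    show "A \<union> \<Union>\<E> \<in> Sigma0_unions \<SS>" if "A \<in> Sigma0_unions \<SS>" "finite \<E>" "\<E> \<subseteq> \<SS>" for A \<E>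
      using Sig0_Un[OF that(1) Sig0_Union[OF that(2,3)]] .
  qed auto
  interpret S00: finite_exhaustion X \<SS> \<mu> L f "Sigma00_unions \<SS>" "dot_subset \<SS>"
  proof
    show "{} \<in> Sigma00_unions \<SS>" by (rule Sig00_empty)
    show "A \<in> Sigma0_unions \<SS>" if "A \<in> Sigma00_unions \<SS>" for A using Sig00_Sig0[OF that] .
    show "dot_subset \<SS> A A" for A using Sig00_empty by (auto simp: dot_subset_def)
    show "dot_subset \<SS> A C" if "dot_subset \<SS> A B" "dot_subset \<SS> B C" for A B C
      using dot_subset_trans[OF that] .
    show "A \<subseteq> B" if "dot_subset \<SS> A B" for A B using that by (auto simp: dot_subset_def)
    fix A \<E> assume A: "A \<in> Sigma00_unions \<SS>" "finite \<E>" "\<E> \<subseteq> \<SS>" "disjoint \<E>" "\<Union>\<E> \<inter> A = {}"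
    have E: "\<Union>\<E> \<in> Sigma00_unions \<SS>" using Sig00_Union[OF A(2-4)] .
    have d: "A \<inter> \<Union>\<E> = {}" using A(5) by auto
    show "A \<union> \<Union>\<E> \<in> Sigma00_unions \<SS>" using Sig00_Un[OF A(1) E d] .
    show "dot_subset \<SS> A (A \<union> \<Union>\<E>)" unfolding dot_subset_def using E d by auto
  qed
  have "fb_converges (fb_image eval (LM_fb \<SS>)) a \<longleftrightarrow> eventually_good a"
    unfolding LM_fb_def fb_converges_iff good_top_Sig_iff eventually_good_def ..
  moreover have "fb_converges (fb_image eval (LM_fb0 \<SS>)) a \<longleftrightarrow> eventually_good a"
    unfolding LM_fb0_def by (rule S0.fb_converges_iff_eventually_good)
  moreover have "fb_converges (fb_image eval (LM_fb00 \<SS>)) a \<longleftrightarrow> eventually_good a"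
    unfolding LM_fb00_def by (rule S00.fb_converges_iff_eventually_good)
  ultimately show ?thesis using extended_integral_iff[of a] by simp
qed

end
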